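(* Let $(M^n,g)$ be an $n$-dimensional semi-Riemannian manifold of constant curvature and let $\phi:\Sigma\to M$ be an isometric immersion of a closed oriented $(n-1)$-dimensional semi-Riemannian manifold (a closed oriented hypersurface), with unit normal vector field $\nu$. Let $X\in\Gamma(\phi^*(TM))$ be a conformal vector field along $\Sigma$ with conformal factor $\alpha$, and let $f$ be a smooth function on $\Sigma$. Then for every integer $0\le k\le n-2$, $$\int_\Sigma \alpha f \sigma_k =\int_\Sigma f\sigma_{k+1}\,\nu\cdot X- \frac{1}{(n-1-k)\binom{n-1}{k}}\int_\Sigma \langle T_k(\nabla f), X^T\rangle .$$
   Context: Write $g(X,Y)=X\cdot Y$, let $\langle\cdot,\cdot\rangle$ be the induced metric on $\Sigma$, and let $\overline\nabla,\nabla$ be the Levi-Civita connections of $M$ and $\Sigma$ ($\overline\nabla$ also denotes the pulled-back connection on $\phi^*(TM)$; $\nabla f$ is the gradient). $X$ is conformal along $\Sigma$ with factor $\alpha$ (a function on $\Sigma$) if $\overline\nabla_YX\cdot Z+\overline\nabla_ZX\cdot Y=2\alpha\langle Y,Z\rangle$ for all $Y,Z$ tangent to $\Sigma$ (this holds in particular if $\mathcal L_Xg=2\alpha g$). $X^T$ is the component of $X$ tangent to $\Sigma$. The second fundamental form is $A(Y,Z)=-(\overline\nabla_YZ)^\perp=h(Y,Z)\nu$ for tangent $Y,Z$, and the shape operator $S$ is the $(1,1)$ tensor with $\langle S Y,Z\rangle=h(Y,Z)$. $H_k$ is the $k$-th elementary symmetric function of the eigenvalues of $S$, counted with algebraic multiplicity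 (i.e. $\det(I+tS)=\sum_k H_kt^k$), $H_0=1$; the normalized $k$-th mean curvature is $\sigma_k=H_k/\binom{n-1}{k}$. The Newton transformations are $T_0=I$, $T_k=H_kI-S\,T_{k-1}$ for $k\ge1$. *)

theory Defs
  imports
    "HOL-Analysis.Analysis"
    "HOL-Computational_Algebra.Polynomial"
begin

section \<open>Smooth functions on open subsets of Euclidean space\<close>

primrec Ck_on :: "nat \<Rightarrow> ('a::real_normed_vector \<Rightarrow> 'b::real_normed_vector) \<Rightarrow> 'a set \<Rightarrow> bool" where
  "Ck_on 0 f S \<longleftrightarrow> continuous_on S f"
| "Ck_on (Suc k) f S \<longleftrightarrow>
     f differentiable_on S \<and> (\<forall>v. Ck_on k (\<lambda>x. frechet_derivative f (at x) v) S)"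

text \<open>Only used for open \<open>S\<close>.\<close>

definition smooth_on :: "'a::real_normed_vector set \<Rightarrow> ('a \<Rightarrow> 'b::real_normed_vector) \<Rightarrow> bool" where
  "smooth_on S f \<longleftrightarrow> (\<forall>k. Ck_on k f S)"


section \<open>Atlases\<close>

text \<open>
  The points of a manifold form a whole type (Hausdorff and second countable wherever a manifold
  is assumed), and its dimension is the cardinality of the index type \<open>'n\<close>.  A chart is an open
  domain together with its coordinate map; the values of the coordinate map outside the domain
  are irrelevant.  There are no boundary charts, so a compact manifold is closed.
\<close>

type_synonym ('p, 'n) chart = "'p set \<times> ('p \<Rightarrow> real^'n)"

abbreviation cdom :: "('p, 'n) chart \<Rightarrow> 'p set" where
  "cdom c \<equiv> fst c"

abbreviation coords :: "('p, 'n) chart \<Rightarrow> 'p \<Rightarrow> real^'n" where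
  "coords c \<equiv> snd c"

definition chart_inv :: "('p, 'n) chart \<Rightarrow> real^'n \<Rightarrow> 'p" where
  "chart_inv c = inv_into (cdom c) (coords c)"

definition is_chart :: "('p::topological_space, 'n::finite) chart \<Rightarrow> bool" where
  "is_chart c \<longleftrightarrow> open (cdom c) \<and> open (coords c ` cdom c) \<and>
     homeomorphism (cdom c) (coords c ` cdom c) (coords c) (chart_inv c)"

definition smooth_atlas :: "('p::topological_space, 'n::finite) chart set \<Rightarrow> bool" where
  "smooth_atlas \<A> \<longleftrightarrow>
     (\<forall>c\<in>\<A>. is_chart c) \<and> (\<Union>c\<in>\<A>. cdom c) = UNIV \<and>
     (\<forall>c\<in>\<A>. \<forall>d\<in>\<A>. smooth_on (coords c ` (cdom c \<inter> cdom d)) (coords d \<circ> chart_inv c))"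

definition charts_at :: "('p, 'n) chart set \<Rightarrow> 'p \<Rightarrow> ('p, 'n) chart set" where
  "charts_at \<A> p = {c \<in> \<A>. p \<in> cdom c}"

definition jacobian :: "('p, 'n::finite) chart \<Rightarrow> ('p, 'n) chart \<Rightarrow> 'p \<Rightarrow> real^'n^'n" where
  "jacobian c d p = matrix (frechet_derivative (coords d \<circ> chart_inv c) (at (coords c p)))"

definition oriented_atlas :: "('p::topological_space, 'n::finite) chart set \<Rightarrow> bool" where
  "oriented_atlas \<A> \<longleftrightarrow>
     smooth_atlas \<A> \<and> (\<forall>p. \<forall>c\<in>charts_at \<A> p. \<forall>d\<in>charts_at \<A> p. det (jacobian c d p) > 0)"

definition smooth_fun :: "('p, 'n::finite) chart set \<Rightarrow> ('p \<Rightarrow> real) \<Rightarrow> bool" where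
  "smooth_fun \<A> f \<longleftrightarrow> (\<forall>c\<in>\<A>. smooth_on (coords c ` cdom c) (f \<circ> chart_inv c))"


section \<open>Semi-Riemannian manifolds\<close>

text \<open>
  Tensors are given by their components in the charts of the atlas, subject to the usual
  transformation law; \<open>metric M c p\<close> is the Gram matrix at \<open>p\<close> of the coordinate frame of \<open>c\<close>.
  It is only meaningful for \<open>c\<close> in \<open>charts_at (atlas M) p\<close>.
\<close>

record ('p, 'n) semi_riem =
  atlas :: "('p, 'n) chart set"
  metric :: "('p, 'n) chart \<Rightarrow> 'p \<Rightarrow> real^'n^'n"

definition ip :: "real^'n^'n \<Rightarrow> real^'n \<Rightarrow> real^'n \<Rightarrow> real" where
  "ip Q u v = u \<bullet> (Q *v v)"

definition form_index :: "real^'n^'n \<Rightarrow> nat" where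
  "form_index Q = Max {dim W | W. subspace W \<and> (\<forall>w\<in>W. w \<noteq> 0 \<longrightarrow> ip Q w w < 0)}"

definition local_metric ::
    "('p, 'n) semi_riem \<Rightarrow> ('p, 'n) chart \<Rightarrow> real^'n \<Rightarrow> real^'n^'n" where
  "local_metric M c x = metric M c (chart_inv c x)"

definition semi_riemannian_manifold ::
    "('p::{t2_space, second_countable_topology}, 'n::finite) semi_riem \<Rightarrow> bool" where
  "semi_riemannian_manifold M \<longleftrightarrow>
     smooth_atlas (atlas M) \<and>
     (\<forall>c\<in>atlas M. smooth_on (coords c ` cdom c) (local_metric M c)) \<and>
     (\<forall>p. \<forall>c\<in>charts_at (atlas M) p.
        transpose (metric M c p) = metric M c p \<and> invertible (metric M c p)) \<and>
     (\<forall>p. \<forall>c\<in>charts_at (atlas M) p. \<forall>d\<in>charts_at (atlas M) p.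
        metric M c p = transpose (jacobian c d p) ** metric M d p ** jacobian c d p) \<and>
     (\<exists>i. \<forall>p. \<forall>c\<in>charts_at (atlas M) p. form_index (metric M c p) = i)"


section \<open>Levi-Civita connection and curvature in coordinates\<close>

text \<open>
  Here \<open>G\<close> is a metric on an open set of \<open>\<real>\<^sup>n\<close>.  A connection is given by its Christoffel map
  \<open>\<Gamma> u v\<close>, the covariant derivative at \<open>x\<close> of the constant field \<open>v\<close> in direction \<open>u\<close>;
  \<open>levi_civita G x\<close> is the one that is torsion-free and compatible with \<open>G\<close>.
\<close>

definition levi_civita ::
    "(real^'n \<Rightarrow> real^'n^'n) \<Rightarrow> real^'n \<Rightarrow> real^'n \<Rightarrow> real^'n \<Rightarrow> real^'n" where
  "levi_civita G x = (THE \<Gamma>. bilinear \<Gamma> \<and> (\<forall>u v. \<Gamma> u v = \<Gamma> v u) \<and>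
     (\<forall>u v w. frechet_derivative (\<lambda>y. ip (G y) v w) (at x) u
                = ip (G x) (\<Gamma> u v) w + ip (G x) v (\<Gamma> u w)))"

definition cov_deriv ::
    "(real^'n \<Rightarrow> real^'n^'n) \<Rightarrow> real^'n \<Rightarrow> (real^'n \<Rightarrow> real^'n) \<Rightarrow> real^'n \<Rightarrow> real^'n" where
  "cov_deriv G u W x = frechet_derivative W (at x) u + levi_civita G x u (W x)"

text \<open>The curvature tensor \<open>R(u,v)w\<close>, computed on constant fields, whose Lie bracket vanishes.\<close>

definition curvature ::
    "(real^'n \<Rightarrow> real^'n^'n) \<Rightarrow> real^'n \<Rightarrow> real^'n \<Rightarrow> real^'n \<Rightarrow> real^'n \<Rightarrow> real^'n" where
  "curvature G x u v w =
     cov_deriv G u (cov_deriv G v (\<lambda>_. w)) x - cov_deriv G v (cov_deriv G u (\<lambda>_. w)) x"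

definition plane_area :: "real^'n^'n \<Rightarrow> real^'n \<Rightarrow> real^'n \<Rightarrow> real" where
  "plane_area Q u v = ip Q u u * ip Q v v - (ip Q u v)\<^sup>2"

definition sectional_curvature ::
    "(real^'n \<Rightarrow> real^'n^'n) \<Rightarrow> real^'n \<Rightarrow> real^'n \<Rightarrow> real^'n \<Rightarrow> real" where
  "sectional_curvature G x u v = ip (G x) (curvature G x u v v) u / plane_area (G x) u v"

text \<open>Sectional curvature is only defined on nondegenerate tangent planes.\<close>

definition constant_curvature :: "('p, 'n::finite) semi_riem \<Rightarrow> bool" where
  "constant_curvature M \<longleftrightarrow>
     (\<exists>\<kappa>. \<forall>p. \<forall>c\<in>charts_at (atlas M) p. \<forall>u v. plane_area (metric M c p) u v \<noteq> 0 \<longrightarrow>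
        sectional_curvature (local_metric M c) (coords c p) u v = \<kappa>)"


section \<open>Isometric immersions and sections along them\<close>

text \<open>
  Below, \<open>S\<close> is the source manifold, \<open>M\<close> the target, \<open>c\<close> a chart of \<open>S\<close> at \<open>p\<close> and \<open>d\<close> a chart of
  \<open>M\<close> at \<open>\<phi> p\<close>.  Tangent vectors to \<open>S\<close> at \<open>p\<close> are written in \<open>c\<close>, tangent vectors to \<open>M\<close> at \<open>\<phi> p\<close>
  in \<open>d\<close>.
\<close>

definition smooth_map ::
    "('q::topological_space, 'm::finite) semi_riem \<Rightarrow> ('p::topological_space, 'n::finite) semi_riem
      \<Rightarrow> ('q \<Rightarrow> 'p) \<Rightarrow> bool" where
  "smooth_map S M \<phi> \<longleftrightarrow> continuous_on UNIV \<phi> \<and>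
     (\<forall>c\<in>atlas S. \<forall>d\<in>atlas M.
        smooth_on (coords c ` (cdom c \<inter> \<phi> -` cdom d)) (coords d \<circ> \<phi> \<circ> chart_inv c))"

definition differential ::
    "('q \<Rightarrow> 'p) \<Rightarrow> ('q, 'm::finite) chart \<Rightarrow> ('p, 'n::finite) chart \<Rightarrow> 'q \<Rightarrow> real^'m \<Rightarrow> real^'n" where
  "differential \<phi> c d p = frechet_derivative (coords d \<circ> \<phi> \<circ> chart_inv c) (at (coords c p))"

definition isometric_immersion ::
    "('q::topological_space, 'm::finite) semi_riem \<Rightarrow> ('p::topological_space, 'n::finite) semi_riem
      \<Rightarrow> ('q \<Rightarrow> 'p) \<Rightarrow> bool" where
  "isometric_immersion S M \<phi> \<longleftrightarrow> smooth_map S M \<phi> \<and>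
     (\<forall>p. \<forall>c\<in>charts_at (atlas S) p. \<forall>d\<in>charts_at (atlas M) (\<phi> p).
        inj (differential \<phi> c d p) \<and>
        (\<forall>y z. ip (metric M d (\<phi> p)) (differential \<phi> c d p y) (differential \<phi> c d p z)
                 = ip (metric S c p) y z))"

text \<open>
  A section \<open>X\<close> of \<open>\<phi>\<^sup>*(TM)\<close>: \<open>X d p\<close> is the component vector of \<open>X\<close> at \<open>p\<close> in the chart \<open>d\<close>.
\<close>

type_synonym ('q, 'p, 'n) vector_along = "('p, 'n) chart \<Rightarrow> 'q \<Rightarrow> real^'n"

definition section_along ::
    "('q, 'm::finite) semi_riem \<Rightarrow> ('p, 'n::finite) semi_riem \<Rightarrow> ('q \<Rightarrow> 'p)
      \<Rightarrow> ('q, 'p, 'n) vector_along \<Rightarrow> bool" where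
  "section_along S M \<phi> X \<longleftrightarrow>
     (\<forall>c\<in>atlas S. \<forall>d\<in>atlas M.
        smooth_on (coords c ` (cdom c \<inter> \<phi> -` cdom d)) (X d \<circ> chart_inv c)) \<and>
     (\<forall>p. \<forall>d\<in>charts_at (atlas M) (\<phi> p). \<forall>e\<in>charts_at (atlas M) (\<phi> p).
        X e p = jacobian d e (\<phi> p) *v X d p)"

text \<open>The pulled-back Levi-Civita connection of \<open>M\<close>.\<close>

definition pullback_deriv ::
    "('p, 'n::finite) semi_riem \<Rightarrow> ('q \<Rightarrow> 'p) \<Rightarrow> ('q, 'm::finite) chart \<Rightarrow> ('p, 'n) chart
      \<Rightarrow> 'q \<Rightarrow> real^'m \<Rightarrow> ('q, 'p, 'n) vector_along \<Rightarrow> real^'n" where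
  "pullback_deriv M \<phi> c d p y X =
     frechet_derivative (X d \<circ> chart_inv c) (at (coords c p)) y
     + levi_civita (local_metric M d) (coords d (\<phi> p)) (differential \<phi> c d p y) (X d p)"

definition conformal_along ::
    "('q, 'm::finite) semi_riem \<Rightarrow> ('p, 'n::finite) semi_riem \<Rightarrow> ('q \<Rightarrow> 'p)
      \<Rightarrow> ('q, 'p, 'n) vector_along \<Rightarrow> ('q \<Rightarrow> real) \<Rightarrow> bool" where
  "conformal_along S M \<phi> X \<alpha> \<longleftrightarrow>
     (\<forall>p. \<forall>c\<in>charts_at (atlas S) p. \<forall>d\<in>charts_at (atlas M) (\<phi> p). \<forall>y z.
        ip (metric M d (\<phi> p)) (pullback_deriv M \<phi> c d p y X) (differential \<phi> c d p z)
        + ip (metric M d (\<phi> p)) (pullback_deriv M \<phi> c d p z X) (differential \<phi> c d p y)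
        = 2 * \<alpha> p * ip (metric S c p) y z)"

definition unit_normal ::
    "('q, 'm::finite) semi_riem \<Rightarrow> ('p, 'n::finite) semi_riem \<Rightarrow> ('q \<Rightarrow> 'p)
      \<Rightarrow> ('q, 'p, 'n) vector_along \<Rightarrow> bool" where
  "unit_normal S M \<phi> \<nu> \<longleftrightarrow> section_along S M \<phi> \<nu> \<and>
     (\<forall>p. \<forall>c\<in>charts_at (atlas S) p. \<forall>d\<in>charts_at (atlas M) (\<phi> p).
        (\<forall>y. ip (metric M d (\<phi> p)) (\<nu> d p) (differential \<phi> c d p y) = 0) \<and>
        \<bar>ip (metric M d (\<phi> p)) (\<nu> d p) (\<nu> d p)\<bar> = 1)"


section \<open>Extrinsic geometry of a hypersurface\<close>

definition tangential_part ::
    "('p, 'n::finite) semi_riem \<Rightarrow> ('q \<Rightarrow> 'p) \<Rightarrow> ('q, 'm::finite) chart \<Rightarrow> ('p, 'n) chart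
      \<Rightarrow> 'q \<Rightarrow> real^'n \<Rightarrow> real^'m" where
  "tangential_part M \<phi> c d p w =
     (THE y. \<forall>z. ip (metric M d (\<phi> p)) (w - differential \<phi> c d p y) (differential \<phi> c d p z) = 0)"

definition normal_part ::
    "('p, 'n::finite) semi_riem \<Rightarrow> ('q \<Rightarrow> 'p) \<Rightarrow> ('q, 'm::finite) chart \<Rightarrow> ('p, 'n) chart
      \<Rightarrow> 'q \<Rightarrow> real^'n \<Rightarrow> real^'n" where
  "normal_part M \<phi> c d p w = w - differential \<phi> c d p (tangential_part M \<phi> c d p w)"

text \<open>
  The scalar \<open>h(y,z)\<close> with \<open>- (\<nabla>\<^sub>y Z)\<^sup>\<bottom> = h(y,z) \<nu>\<close>, where \<open>z\<close> is extended to the tangent field \<open>Z\<close>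
  with constant components in \<open>c\<close>.
\<close>

definition second_fund ::
    "('p, 'n::finite) semi_riem \<Rightarrow> ('q \<Rightarrow> 'p) \<Rightarrow> ('q, 'p, 'n) vector_along
      \<Rightarrow> ('q, 'm::finite) chart \<Rightarrow> ('p, 'n) chart \<Rightarrow> 'q \<Rightarrow> real^'m \<Rightarrow> real^'m \<Rightarrow> real" where
  "second_fund M \<phi> \<nu> c d p y z =
     (THE t. - normal_part M \<phi> c d p
                 (pullback_deriv M \<phi> c d p y (\<lambda>d' q. differential \<phi> c d' q z))
             = t *\<^sub>R \<nu> d p)"

definition shape_matrix ::
    "('q, 'm::finite) semi_riem \<Rightarrow> ('p, 'n::finite) semi_riem \<Rightarrow> ('q \<Rightarrow> 'p)
      \<Rightarrow> ('q, 'p, 'n) vector_along \<Rightarrow> ('q, 'm) chart \<Rightarrow> ('p, 'n) chart \<Rightarrow> 'q \<Rightarrow> real^'m^'m" where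
  "shape_matrix S M \<phi> \<nu> c d p =
     (THE B. \<forall>y z. ip (metric S c p) (B *v y) z = second_fund M \<phi> \<nu> c d p y z)"

text \<open>\<open>elem_sym k B\<close> is the coefficient of \<open>t\<^sup>k\<close> in \<open>det (I + t B)\<close>.\<close>

definition elem_sym :: "nat \<Rightarrow> real^'m^'m \<Rightarrow> real" where
  "elem_sym k B =
     coeff (det ((\<chi> i j. [: (mat 1 :: real^'m^'m) $ i $ j, B $ i $ j :]) :: real poly^'m^'m)) k"

primrec newton :: "nat \<Rightarrow> real^'m^'m \<Rightarrow> real^'m^'m" where
  "newton 0 B = mat 1"
| "newton (Suc k) B = elem_sym (Suc k) B *\<^sub>R mat 1 - B ** newton k B"

definition gradient ::
    "('q, 'm::finite) semi_riem \<Rightarrow> ('q, 'm) chart \<Rightarrow> 'q \<Rightarrow> ('q \<Rightarrow> real) \<Rightarrow> real^'m" where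
  "gradient S c p f =
     (THE v. \<forall>z. ip (metric S c p) v z = frechet_derivative (f \<circ> chart_inv c) (at (coords c p)) z)"


section \<open>Scalar functions on the hypersurface\<close>

text \<open>
  These scalars do not depend on the charts in which they are evaluated, so an arbitrary chart
  is chosen at each point.
\<close>

definition chart_at :: "('p, 'n::finite) semi_riem \<Rightarrow> 'p \<Rightarrow> ('p, 'n) chart" where
  "chart_at M p = (SOME c. c \<in> charts_at (atlas M) p)"

definition along_inner ::
    "('p, 'n::finite) semi_riem \<Rightarrow> ('q \<Rightarrow> 'p) \<Rightarrow> ('q, 'p, 'n) vector_along
      \<Rightarrow> ('q, 'p, 'n) vector_along \<Rightarrow> 'q \<Rightarrow> real" where
  "along_inner M \<phi> X Y p =
     (let d = chart_at M (\<phi> p) in ip (metric M d (\<phi> p)) (X d p) (Y d p))"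

definition mean_curv ::
    "('q, 'm::finite) semi_riem \<Rightarrow> ('p, 'n::finite) semi_riem \<Rightarrow> ('q \<Rightarrow> 'p)
      \<Rightarrow> ('q, 'p, 'n) vector_along \<Rightarrow> nat \<Rightarrow> 'q \<Rightarrow> real" where
  "mean_curv S M \<phi> \<nu> k p =
     elem_sym k (shape_matrix S M \<phi> \<nu> (chart_at S p) (chart_at M (\<phi> p)) p)"

definition norm_mean_curv ::
    "('q, 'm::finite) semi_riem \<Rightarrow> ('p, 'n::finite) semi_riem \<Rightarrow> ('q \<Rightarrow> 'p)
      \<Rightarrow> ('q, 'p, 'n) vector_along \<Rightarrow> nat \<Rightarrow> 'q \<Rightarrow> real" where
  "norm_mean_curv S M \<phi> \<nu> k p = mean_curv S M \<phi> \<nu> k p / real (CARD('m) choose k)"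

text \<open>The function \<open>\<langle>T\<^sub>k(\<nabla>f), X\<^sup>T\<rangle>\<close>.\<close>

definition newton_grad_inner ::
    "('q, 'm::finite) semi_riem \<Rightarrow> ('p, 'n::finite) semi_riem \<Rightarrow> ('q \<Rightarrow> 'p)
      \<Rightarrow> ('q, 'p, 'n) vector_along \<Rightarrow> nat \<Rightarrow> ('q \<Rightarrow> real) \<Rightarrow> ('q, 'p, 'n) vector_along
      \<Rightarrow> 'q \<Rightarrow> real" where
  "newton_grad_inner S M \<phi> \<nu> k f X p =
     (let c = chart_at S p; d = chart_at M (\<phi> p) in
        ip (metric S c p)
           (newton k (shape_matrix S M \<phi> \<nu> c d p) *v gradient S c p f)
           (tangential_part M \<phi> c d p (X d p)))"


section \<open>The volume measure\<close>

text \<open>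
  The unique Borel measure with density \<open>\<surd>\<bar>det g\<bar>\<close> in every chart.  On an oriented manifold,
  integrating a function against it is the same as integrating its product with the positive
  volume form.
\<close>

definition volume_measure :: "('q::topological_space, 'm::finite) semi_riem \<Rightarrow> 'q measure" where
  "volume_measure S = (SOME \<mu>. sets \<mu> = sets borel \<and>
     (\<forall>c\<in>atlas S. \<forall>B\<in>sets borel. B \<subseteq> cdom c \<longrightarrow>
        emeasure \<mu> B
        = (\<integral>\<^sup>+ x. ennreal (sqrt \<bar>det (local_metric S c x)\<bar>) * indicator (coords c ` B) x \<partial>lborel)))"

end

(*
  Let Y be the tangential part of X.  The Weingarten formula turns the conformality of X along Sigma
  into the statement that (nabla Y) - alpha I + (nu.X) S is skew-adjoint, hence trace-orthogonal to the
  self-adjoint T_k; since tr T_k = (n-1-k) H_k and tr (T_k S) = (k+1) H_{k+1}, this computes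
  tr (T_k nabla Y).  In constant curvature the Codazzi equation makes T_k divergence-free, so
  div (f T_k Y) = <T_k grad f, Y> + f tr (T_k nabla Y), and the formula is the vanishing of the integral
  of this divergence.  Both sides are linear in f, so a C^1 partition of unity reduces the last step to
  functions f supported in one chart domain that the immersion maps into one chart domain of M, where
  the integral of a partial derivative of a compactly supported function vanishes.
*)

theory Submission
  imports Defs
begin

section \<open>Differentiability classes\<close>

text \<open>The metric may be indefinite. The shape operator then need not be diagonalizable, so the
  identities for \<open>elem_sym\<close> and \<open>newton\<close> come from the polynomial det(I +
  tB) instead of from eigenvalues. Degenerate planes have no sectional curvature, so the curvature
  tensor is recovered on them by a limit. The sign e = nu.nu enters through X = X^T + e (nu.X) nu
  and through nabla_Y nu = e S Y, and cancels in the term (nu.X) S. The notions of the statement are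
  \<open>THE\<close> and \<open>SOME\<close> terms in charts. They are identified with explicit
  formulas on open subsets of Euclidean space, where the tensor calculus is done. The volume measure
  is such a choice too, so its existence has to be proved, by a change of variables on overlaps of
  charts. The factor \<alpha> comes without regularity; its continuity follows because (n-1)
  \<alpha> is the trace of the tangential part of nabla X. The constant (n-1-k) binom(n-1,k) equals
  (k+1) binom(n-1,k+1), so it turns the terms in H_k and H_{k+1} into \<sigma>_k and
  \<sigma>_{k+1}.\<close>

abbreviation dd :: "('a::real_normed_vector \<Rightarrow> 'b::real_normed_vector) \<Rightarrow> 'a \<Rightarrow> 'a \<Rightarrow> 'b" where
  "dd f x \<equiv> frechet_derivative f (at x)"

lemma dd_eqI: "(f has_derivative f') (at x) \<Longrightarrow> dd f x = f'"
  by (rule frechet_derivative_at[symmetric])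

lemma dd_cong:
  assumes "open S" "x \<in> S" "\<And>y. y \<in> S \<Longrightarrow> f y = g y"
  shows "dd f x = dd g x"
proof -
  have "(f has_derivative f') (at x) \<longleftrightarrow> (g has_derivative f') (at x)" for f'
    using has_derivative_transform_within_open[OF _ assms(1,2), of f f' UNIV g]
      has_derivative_transform_within_open[OF _ assms(1,2), of g f' UNIV f] assms(3) by auto
  then show ?thesis
    by (simp add: frechet_derivative_def)
qed

lemma Ck_on_cong:
  assumes "open S" "\<And>x. x \<in> S \<Longrightarrow> f x = g x"
  shows "Ck_on k f S \<longleftrightarrow> Ck_on k g S"
  using assms(2)
proof (induction k arbitrary: f g)
  case 0
  then show ?case by (simp cong: continuous_on_cong)
next
  case (Suc k)
  have "f differentiable_on S \<longleftrightarrow> g differentiable_on S"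
  proof -
    have "f differentiable (at x) \<longleftrightarrow> g differentiable (at x)" if "x \<in> S" for x
      unfolding differentiable_def
      using has_derivative_transform_within_open[OF _ assms(1) that, of f _ UNIV g]
        has_derivative_transform_within_open[OF _ assms(1) that, of g _ UNIV f] Suc.prems by fastforce
    then show ?thesis
      by (simp add: assms(1) differentiable_on_eq_differentiable_at)
  qed
  moreover have "Ck_on k (\<lambda>x. dd f x v) S \<longleftrightarrow> Ck_on k (\<lambda>x. dd g x v) S" for v
    by (rule Suc.IH) (simp add: dd_cong[OF assms(1) _ Suc.prems])
  ultimately show ?case by simp
qed

lemma Ck_on_has_derivative:
  assumes "Ck_on (Suc k) f S" "open S" "x \<in> S"
  shows "(f has_derivative dd f x) (at x)"
  using assms by (simp add: differentiable_on_eq_differentiable_at frechet_derivative_works[symmetric])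

lemma Ck_on_Suc_dd: "Ck_on (Suc k) f S \<Longrightarrow> Ck_on k (\<lambda>x. dd f x v) S"
  by simp

text \<open>\<open>Ck_on\<close> speaks of \<open>frechet_derivative\<close>, the calculus rules of
  \<open>has_derivative\<close>. With this bridge a closure property is an induction on
  \<open>k\<close> whose step is the corresponding derivative rule.\<close>

lemma Ck_on_SucI:
  assumes "open S" "\<And>x. x \<in> S \<Longrightarrow> (f has_derivative f' x) (at x)" "\<And>v. Ck_on k (\<lambda>x. f' x v) S"
  shows "Ck_on (Suc k) f S"
proof -
  have "f differentiable_on S"
    using assms(1,2) by (auto simp: differentiable_on_eq_differentiable_at differentiable_def)
  moreover have "Ck_on k (\<lambda>x. dd f x v) S" for v
    using assms(3)[of v] Ck_on_cong[OF assms(1), of "\<lambda>x. dd f x v" "\<lambda>x. f' x v"]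
    by (simp add: dd_eqI[OF assms(2)])
  ultimately show ?thesis by simp
qed

lemma Ck_on_SucD: "Ck_on (Suc k) f S \<Longrightarrow> Ck_on k f S"
proof (induction k arbitrary: f)
  case 0
  then show ?case by (simp add: differentiable_imp_continuous_on)
next
  case (Suc k)
  have "Ck_on k (\<lambda>x. dd f x v) S" for v
    using Suc.prems by (intro Suc.IH) simp
  then show ?case using Suc.prems by (subst Ck_on.simps) simp
qed

lemma Ck_on_le: "Ck_on k f S \<Longrightarrow> j \<le> k \<Longrightarrow> Ck_on j f S"
proof (induction k)
  case (Suc k)
  show ?case
  proof (cases "j = Suc k")
    case False
    with Suc.prems(2) have "j \<le> k" by simp
    then show ?thesis by (rule Suc.IH[OF Ck_on_SucD[OF Suc.prems(1)]])
  qed (use Suc in simp)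
qed simp

lemma Ck_on_continuous: "Ck_on k f S \<Longrightarrow> continuous_on S f"
  using Ck_on_le[of k f S 0] by simp

lemma Ck_on_subset: "Ck_on k f S \<Longrightarrow> T \<subseteq> S \<Longrightarrow> Ck_on k f T"
proof (induction k arbitrary: f)
  case 0
  then show ?case unfolding Ck_on.simps by (rule continuous_on_subset)
next
  case (Suc k)
  then show ?case unfolding Ck_on.simps by (blast intro: differentiable_on_subset)
qed

text \<open>For extension by zero: regularity on an open set and on the complement of a compact
  support glue together.\<close>

lemma Ck_on_Un:
  assumes "open S" "open T"
  shows "Ck_on k f S \<Longrightarrow> Ck_on k f T \<Longrightarrow> Ck_on k f (S \<union> T)"
proof (induction k arbitrary: f)
  case 0
  then show ?case using assms by (simp add: continuous_on_open_Un)
next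
  case (Suc k)
  have "f differentiable_on S \<union> T"
    using Suc.prems assms by (auto simp: differentiable_on_eq_differentiable_at open_Un)
  with Suc show ?case by simp
qed

lemma Ck_on_const: "Ck_on k (\<lambda>_. c) S"
  by (induction k arbitrary: c) auto

lemma Ck_on_linear:
  assumes "bounded_linear f"
  shows "Ck_on k f S"
proof (cases k)
  case 0
  then show ?thesis using assms by (simp add: linear_continuous_on)
next
  case (Suc j)
  have "dd f x = f" for x
    by (rule dd_eqI[OF bounded_linear_imp_has_derivative[OF assms]])
  moreover have "f differentiable_on S"
    by (rule bounded_linear_imp_differentiable_on[OF assms])
  ultimately show ?thesis by (simp add: Suc Ck_on_const)
qed

lemma Ck_on_ident: "Ck_on k (\<lambda>x. x) S"
  by (rule Ck_on_linear) (rule bounded_linear_ident)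

lemma Ck_on_add:
  assumes "open S"
  shows "Ck_on k f S \<Longrightarrow> Ck_on k g S \<Longrightarrow> Ck_on k (\<lambda>x. f x + g x) S"
proof (induction k arbitrary: f g)
  case 0
  then show ?case by (simp add: continuous_on_add)
next
  case (Suc k)
  show ?case
  proof (rule Ck_on_SucI[OF assms])
    show "((\<lambda>x. f x + g x) has_derivative (\<lambda>v. dd f x v + dd g x v)) (at x)" if "x \<in> S" for x
      using Suc.prems assms that by (intro has_derivative_add Ck_on_has_derivative)
    show "Ck_on k (\<lambda>x. dd f x v + dd g x v) S" for v
      by (intro Suc.IH Ck_on_Suc_dd Suc.prems)
  qed
qed

lemma Ck_on_bilinear:
  assumes "open S" "bounded_bilinear b"
  shows "Ck_on k f S \<Longrightarrow> Ck_on k g S \<Longrightarrow> Ck_on k (\<lambda>x. b (f x) (g x)) S"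
proof (induction k arbitrary: f g)
  case 0
  then show ?case by (simp add: bounded_bilinear.continuous_on[OF assms(2)])
next
  case (Suc k)
  show ?case
  proof (rule Ck_on_SucI[OF assms(1)])
    show "((\<lambda>x. b (f x) (g x)) has_derivative (\<lambda>v. b (f x) (dd g x v) + b (dd f x v) (g x))) (at x)"
      if "x \<in> S" for x
      using Suc.prems assms that by (intro bounded_bilinear.FDERIV Ck_on_has_derivative)
    show "Ck_on k (\<lambda>x. b (f x) (dd g x v) + b (dd f x v) (g x)) S" for v
      by (intro Ck_on_add assms Suc.IH Ck_on_Suc_dd Suc.prems Suc.prems[THEN Ck_on_SucD])
  qed
qed

lemma Ck_on_linear_compose:
  assumes "open S" "bounded_linear L"
  shows "Ck_on k f S \<Longrightarrow> Ck_on k (\<lambda>x. L (f x)) S"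
proof (induction k arbitrary: f)
  case 0
  then show ?case unfolding Ck_on.simps by (rule bounded_linear.continuous_on[OF assms(2)])
next
  case (Suc k)
  show ?case
  proof (rule Ck_on_SucI[OF assms(1)])
    show "((\<lambda>x. L (f x)) has_derivative (\<lambda>v. L (dd f x v))) (at x)" if "x \<in> S" for x
      by (rule bounded_linear.has_derivative[OF assms(2) Ck_on_has_derivative[OF Suc.prems assms(1) that]])
    show "Ck_on k (\<lambda>x. L (dd f x v)) S" for v
      by (intro Suc.IH Ck_on_Suc_dd Suc.prems)
  qed
qed

lemma Ck_on_sum:
  "open S \<Longrightarrow> (\<And>i. i \<in> I \<Longrightarrow> Ck_on k (f i) S) \<Longrightarrow> Ck_on k (\<lambda>x. \<Sum>i\<in>I. f i x) S"
  by (induction I rule: infinite_finite_induct) (simp_all add: Ck_on_const Ck_on_add del: Ck_on.simps)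

lemma Ck_on_mult:
  fixes f g :: "'a::real_normed_vector \<Rightarrow> 'b::real_normed_algebra"
  shows "open S \<Longrightarrow> Ck_on k f S \<Longrightarrow> Ck_on k g S \<Longrightarrow> Ck_on k (\<lambda>x. f x * g x) S"
  by (rule Ck_on_bilinear[OF _ bounded_bilinear_mult])

lemma Ck_on_scaleR:
  "open S \<Longrightarrow> Ck_on k f S \<Longrightarrow> Ck_on k g S \<Longrightarrow> Ck_on k (\<lambda>x. f x *\<^sub>R g x) S"
  by (rule Ck_on_bilinear[OF _ bounded_bilinear_scaleR])

lemma Ck_on_inner:
  "open S \<Longrightarrow> Ck_on k f S \<Longrightarrow> Ck_on k g S \<Longrightarrow> Ck_on k (\<lambda>x. f x \<bullet> g x) S"
  by (rule Ck_on_bilinear[OF _ bounded_bilinear_inner])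

lemma Ck_on_minus: "open S \<Longrightarrow> Ck_on k f S \<Longrightarrow> Ck_on k (\<lambda>x. - f x) S"
  by (rule Ck_on_linear_compose[OF _ bounded_linear_minus[OF bounded_linear_ident]])

lemma Ck_on_diff:
  assumes "open S" "Ck_on k f S" "Ck_on k g S"
  shows "Ck_on k (\<lambda>x. f x - g x) S"
  using Ck_on_add[OF assms(1,2) Ck_on_minus[OF assms(1,3)]] by simp

lemma Ck_on_prod:
  fixes f :: "'i \<Rightarrow> 'a::real_normed_vector \<Rightarrow> real"
  shows "open S \<Longrightarrow> (\<And>i. i \<in> I \<Longrightarrow> Ck_on k (f i) S) \<Longrightarrow> Ck_on k (\<lambda>x. \<Prod>i\<in>I. f i x) S"
  by (induction I rule: infinite_finite_induct) (simp_all add: Ck_on_const Ck_on_mult del: Ck_on.simps)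

lemma Ck_on_inverse:
  fixes f :: "'a::real_normed_vector \<Rightarrow> real"
  assumes "open S" "\<And>x. x \<in> S \<Longrightarrow> f x \<noteq> 0"
  shows "Ck_on k f S \<Longrightarrow> Ck_on k (\<lambda>x. inverse (f x)) S"
proof (induction k)
  case 0
  then show ?case using assms by (simp add: continuous_on_inverse)
next
  case (Suc k)
  show ?case
  proof (rule Ck_on_SucI[OF assms(1)])
    show "((\<lambda>x. inverse (f x)) has_derivative (\<lambda>v. - (inverse (f x) * dd f x v * inverse (f x)))) (at x)"
      if "x \<in> S" for x
      using Suc.prems assms that by (intro Deriv.has_derivative_inverse Ck_on_has_derivative) auto
    show "Ck_on k (\<lambda>x. - (inverse (f x) * dd f x v * inverse (f x))) S" for v
      by (intro Ck_on_minus Ck_on_mult assms Suc.IH Ck_on_Suc_dd Suc.prems Suc.prems[THEN Ck_on_SucD])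
  qed
qed

lemma Ck_on_divide:
  fixes f :: "'a::real_normed_vector \<Rightarrow> real"
  assumes "open S" "Ck_on k f S" "Ck_on k g S" "\<And>x. x \<in> S \<Longrightarrow> g x \<noteq> 0"
  shows "Ck_on k (\<lambda>x. f x / g x) S"
  unfolding divide_inverse by (intro Ck_on_mult Ck_on_inverse assms)

lemma Ck_on_Basis:
  fixes f :: "'a::real_normed_vector \<Rightarrow> 'b::euclidean_space"
  assumes "open S" "\<And>b. b \<in> Basis \<Longrightarrow> Ck_on k (\<lambda>x. f x \<bullet> b) S"
  shows "Ck_on k f S"
proof -
  have "Ck_on k (\<lambda>x. \<Sum>b\<in>Basis. (f x \<bullet> b) *\<^sub>R b) S"
    by (intro Ck_on_sum Ck_on_scaleR assms Ck_on_const)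
  then show ?thesis by (simp add: euclidean_representation)
qed

lemma Ck_on_vec:
  fixes f :: "'a::real_normed_vector \<Rightarrow> real^'n"
  assumes "open S" "\<And>i. Ck_on k (\<lambda>x. f x $ i) S"
  shows "Ck_on k f S"
proof (rule Ck_on_Basis[OF assms(1)])
  fix b :: "real^'n" assume "b \<in> Basis"
  then show "Ck_on k (\<lambda>x. f x \<bullet> b) S"
    using assms(2) by (auto simp: Basis_vec_def inner_axis simp del: Ck_on.simps)
qed

lemma Ck_on_mat:
  fixes f :: "'a::real_normed_vector \<Rightarrow> real^'n^'m"
  assumes "open S" "\<And>i j. Ck_on k (\<lambda>x. f x $ i $ j) S"
  shows "Ck_on k f S"
proof (rule Ck_on_Basis[OF assms(1)])
  fix b :: "real^'n^'m" assume "b \<in> Basis"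
  then show "Ck_on k (\<lambda>x. f x \<bullet> b) S"
    using assms(2) by (auto simp: Basis_vec_def inner_axis simp del: Ck_on.simps)
qed

lemma Ck_on_nth: "open S \<Longrightarrow> Ck_on k f S \<Longrightarrow> Ck_on k (\<lambda>x. f x $ i) S"
  by (rule Ck_on_linear_compose[OF _ bounded_linear_vec_nth])

text \<open>In the chain rule the direction \<open>dd g x v\<close> moves with \<open>x\<close>,
  whereas \<open>Ck_on\<close> controls derivatives in fixed directions. Expanding it in
  \<open>Basis\<close> gives a sum of products to which the induction hypothesis applies.\<close>

lemma Ck_on_compose:
  fixes f :: "'b::euclidean_space \<Rightarrow> 'c::real_normed_vector" and g :: "'a::real_normed_vector \<Rightarrow> 'b"
  assumes "open S" "open T" "g ` S \<subseteq> T"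
  shows "Ck_on k g S \<Longrightarrow> Ck_on k f T \<Longrightarrow> Ck_on k (\<lambda>x. f (g x)) S"
proof (induction k arbitrary: f)
  case 0
  then show ?case using assms(3) continuous_on_compose2[of T f S g] by simp
next
  case (Suc k)
  have df: "(f has_derivative dd f y) (at y)" if "y \<in> T" for y
    by (rule Ck_on_has_derivative[OF Suc.prems(2) assms(2) that])
  show ?case
  proof (rule Ck_on_SucI[OF assms(1)])
    show "((\<lambda>x. f (g x)) has_derivative (\<lambda>v. \<Sum>b\<in>Basis. (dd g x v \<bullet> b) *\<^sub>R dd f (g x) b)) (at x)"
      if "x \<in> S" for x
    proof -
      have gx: "g x \<in> T" using assms(3) that by blast
      have lin: "linear (dd f (g x))"
        by (rule has_derivative_linear[OF df[OF gx]])
      have *: "((\<lambda>x. f (g x)) has_derivative (\<lambda>v. dd f (g x) (dd g x v))) (at x)"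
        by (rule has_derivative_compose[OF Ck_on_has_derivative[OF Suc.prems(1) assms(1) that] df[OF gx]])
      have "dd f (g x) w = (\<Sum>b\<in>Basis. (w \<bullet> b) *\<^sub>R dd f (g x) b)" for w
      proof -
        have "dd f (g x) w = dd f (g x) (\<Sum>b\<in>Basis. (w \<bullet> b) *\<^sub>R b)"
          by (simp only: euclidean_representation)
        also have "\<dots> = (\<Sum>b\<in>Basis. (w \<bullet> b) *\<^sub>R dd f (g x) b)"
          by (simp only: linear_sum[OF lin] linear_scale[OF lin])
        finally show ?thesis .
      qed
      then show ?thesis by (intro has_derivative_eq_rhs[OF *] ext)
    qed
    have "Ck_on k (\<lambda>x. dd f (g x) b) S" for b
      by (rule Suc.IH[of "\<lambda>y. dd f y b", OF Ck_on_SucD[OF Suc.prems(1)] Ck_on_Suc_dd[OF Suc.prems(2)]])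
    then show "Ck_on k (\<lambda>x. \<Sum>b\<in>Basis. (dd g x v \<bullet> b) *\<^sub>R dd f (g x) b) S" for v
      by (intro Ck_on_sum Ck_on_scaleR Ck_on_inner Ck_on_const assms(1) Ck_on_Suc_dd[OF Suc.prems(1)])
  qed
qed

lemma Ck_on_dd:
  fixes f :: "'a::euclidean_space \<Rightarrow> 'c::real_normed_vector"
  assumes "open S" "Ck_on (Suc k) f S" "Ck_on k w S"
  shows "Ck_on k (\<lambda>x. dd f x (w x)) S"
proof -
  have "dd f x (w x) = (\<Sum>b\<in>Basis. (w x \<bullet> b) *\<^sub>R dd f x b)" if "x \<in> S" for x
  proof -
    have lin: "linear (dd f x)"
      by (rule has_derivative_linear[OF Ck_on_has_derivative[OF assms(2,1) that]])
    have "dd f x (w x) = dd f x (\<Sum>b\<in>Basis. (w x \<bullet> b) *\<^sub>R b)"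
      by (simp add: euclidean_representation)
    also have "\<dots> = (\<Sum>b\<in>Basis. (w x \<bullet> b) *\<^sub>R dd f x b)"
      by (simp add: linear_sum[OF lin] linear_scale[OF lin])
    finally show ?thesis .
  qed
  moreover have "Ck_on k (\<lambda>x. \<Sum>b\<in>Basis. (w x \<bullet> b) *\<^sub>R dd f x b) S"
    by (intro Ck_on_sum Ck_on_scaleR Ck_on_inner Ck_on_const Ck_on_Suc_dd assms)
  ultimately show ?thesis
    by (subst Ck_on_cong[OF assms(1)])
qed

lemma Ck_on_sqrt:
  fixes f :: "'a::real_normed_vector \<Rightarrow> real"
  assumes "open S" "\<And>x. x \<in> S \<Longrightarrow> 0 < f x"
  shows "Ck_on k f S \<Longrightarrow> Ck_on k (\<lambda>x. sqrt (f x)) S"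
proof (induction k)
  case 0
  then show ?case by (simp add: continuous_on_real_sqrt)
next
  case (Suc k)
  show ?case
  proof (rule Ck_on_SucI[OF assms(1)])
    show "((\<lambda>x. sqrt (f x)) has_derivative (\<lambda>v. dd f x v * (inverse (sqrt (f x)) / 2))) (at x)"
      if "x \<in> S" for x
    proof -
      have "(sqrt has_real_derivative inverse (sqrt (f x)) / 2) (at (f x))"
        by (rule DERIV_real_sqrt[OF assms(2)[OF that]])
      then have "(sqrt has_derivative (*) (inverse (sqrt (f x)) / 2)) (at (f x))"
        by (simp only: has_field_derivative_def)
      then have "(sqrt has_derivative (\<lambda>v. v * (inverse (sqrt (f x)) / 2))) (at (f x))"
        by (rule has_derivative_eq_rhs[OF _ ext]) (simp add: mult.commute)
      from has_derivative_compose[OF Ck_on_has_derivative[OF Suc.prems assms(1) that] this]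
      show ?thesis .
    qed
    have sq: "Ck_on k (\<lambda>x. sqrt (f x)) S"
      by (rule Suc.IH[OF Ck_on_SucD[OF Suc.prems]])
    have "Ck_on k (\<lambda>x. inverse (sqrt (f x))) S"
      by (rule Ck_on_inverse[OF assms(1) _ sq]) (use assms(2) in force)
    then show "Ck_on k (\<lambda>x. dd f x v * (inverse (sqrt (f x)) / 2)) S" for v
      by (intro Ck_on_mult Ck_on_divide Ck_on_const Ck_on_Suc_dd[OF Suc.prems] assms(1)) simp_all
  qed
qed

lemma Ck_on_matrix_vector:
  fixes A :: "'a::real_normed_vector \<Rightarrow> real^'n^'m"
  assumes "open S" "Ck_on k A S" "Ck_on k v S"
  shows "Ck_on k (\<lambda>x. A x *v v x) S"
proof (rule Ck_on_vec[OF assms(1)])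
  show "Ck_on k (\<lambda>x. (A x *v v x) $ i) S" for i
    unfolding matrix_vector_mult_def vec_lambda_beta by (intro Ck_on_sum Ck_on_mult Ck_on_nth assms)
qed

lemma Ck_on_matrix_matrix:
  fixes A :: "'a::real_normed_vector \<Rightarrow> real^'n^'m" and B :: "'a \<Rightarrow> real^'l^'n"
  assumes "open S" "Ck_on k A S" "Ck_on k B S"
  shows "Ck_on k (\<lambda>x. A x ** B x) S"
proof (rule Ck_on_mat[OF assms(1)])
  show "Ck_on k (\<lambda>x. (A x ** B x) $ i $ j) S" for i j
    unfolding matrix_matrix_mult_def vec_lambda_beta by (intro Ck_on_sum Ck_on_mult Ck_on_nth assms)
qed

lemma Ck_on_det:
  fixes A :: "'a::real_normed_vector \<Rightarrow> real^'n^'n"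
  assumes "open S" "Ck_on k A S"
  shows "Ck_on k (\<lambda>x. det (A x)) S"
  unfolding det_def by (intro Ck_on_sum Ck_on_mult Ck_on_prod Ck_on_nth Ck_on_const assms)

section \<open>Symmetry of second derivatives\<close>

lemma Ck_on_line_derivative:
  fixes f :: "'a::real_normed_vector \<Rightarrow> real"
  assumes "open S" "Ck_on (Suc k) f S" "y + s *\<^sub>R u \<in> S"
  shows "((\<lambda>s. f (y + s *\<^sub>R u)) has_real_derivative dd f (y + s *\<^sub>R u) u) (at s)"
proof -
  have d: "(f has_derivative dd f (y + s *\<^sub>R u)) (at (y + s *\<^sub>R u))"
    by (rule Ck_on_has_derivative[OF assms(2,1,3)])
  have "((\<lambda>s. y + s *\<^sub>R u) has_derivative (\<lambda>h. h *\<^sub>R u)) (at s)"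
    by (auto intro!: derivative_eq_intros)
  from has_derivative_compose[OF this d]
  have *: "((\<lambda>s. f (y + s *\<^sub>R u)) has_derivative (\<lambda>h. dd f (y + s *\<^sub>R u) (h *\<^sub>R u))) (at s)" .
  have "(\<lambda>h. dd f (y + s *\<^sub>R u) (h *\<^sub>R u)) = (*) (dd f (y + s *\<^sub>R u) u)"
    using linear_scale[OF has_derivative_linear[OF d]] by (simp add: fun_eq_iff)
  with * show ?thesis
    by (simp only: has_field_derivative_def)
qed

text \<open>The mean value theorem is applied twice: along \<open>u\<close> to the difference in
  direction \<open>v\<close>, and along \<open>v\<close> to the derivative in direction
  \<open>u\<close>.\<close>

lemma second_difference_mean_value:
  fixes f :: "'a::real_normed_vector \<Rightarrow> real"
  assumes S: "open S" and f: "Ck_on (Suc (Suc k)) f S" and t: "0 < t"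
    and sub: "\<And>a b. 0 \<le> a \<Longrightarrow> a \<le> t \<Longrightarrow> 0 \<le> b \<Longrightarrow> b \<le> t \<Longrightarrow> x + a *\<^sub>R u + b *\<^sub>R v \<in> S"
  obtains a b where "0 \<le> a" "a \<le> t" "0 \<le> b" "b \<le> t"
    "f (x + t *\<^sub>R u + t *\<^sub>R v) - f (x + t *\<^sub>R u) - f (x + t *\<^sub>R v) + f x
       = t * t * dd (\<lambda>z. dd f z u) (x + a *\<^sub>R u + b *\<^sub>R v) v"
proof -
  define \<Phi> where "\<Phi> a = f ((x + t *\<^sub>R v) + a *\<^sub>R u) - f (x + a *\<^sub>R u)" for a
  have "(\<Phi> has_real_derivative (dd f ((x + t *\<^sub>R v) + a *\<^sub>R u) u - dd f (x + a *\<^sub>R u) u)) (at a)"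
    if "0 \<le> a" "a \<le> t" for a
    unfolding \<Phi>_def
    using sub[of a t] sub[of a 0] that t
    by (intro DERIV_diff Ck_on_line_derivative[OF S f]) (simp_all add: algebra_simps)
  from MVT2[OF t this] obtain a where a: "0 < a" "a < t"
    and 1: "\<Phi> t - \<Phi> 0 = t * (dd f ((x + t *\<^sub>R v) + a *\<^sub>R u) u - dd f (x + a *\<^sub>R u) u)"
    by auto
  have "((\<lambda>b. dd f ((x + a *\<^sub>R u) + b *\<^sub>R v) u) has_real_derivative
      dd (\<lambda>z. dd f z u) (x + a *\<^sub>R u + b *\<^sub>R v) v) (at b)" if "0 \<le> b" "b \<le> t" for b
    using sub[of a b] that a
    by (intro Ck_on_line_derivative[OF S Ck_on_Suc_dd[OF f]]) simp
  from MVT2[OF t this] obtain b where b: "0 < b" "b < t"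
    and 2: "dd f ((x + a *\<^sub>R u) + t *\<^sub>R v) u - dd f ((x + a *\<^sub>R u) + 0 *\<^sub>R v) u
      = t * dd (\<lambda>z. dd f z u) (x + a *\<^sub>R u + b *\<^sub>R v) v"
    by auto
  have "f (x + t *\<^sub>R u + t *\<^sub>R v) - f (x + t *\<^sub>R u) - f (x + t *\<^sub>R v) + f x = \<Phi> t - \<Phi> 0"
    by (simp add: \<Phi>_def algebra_simps)
  also have "\<dots> = t * t * dd (\<lambda>z. dd f z u) (x + a *\<^sub>R u + b *\<^sub>R v) v"
    using 1 2 by (simp add: algebra_simps)
  finally show ?thesis
    by (rule that[of a b, rotated 4]) (use a b in auto)
qed

text \<open>One second difference equals t^2 times either mixed derivative, each at some point of a
  parallelogram close to \<open>x\<close>. Both derivatives are continuous, so they cannot differ at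
  \<open>x\<close>.\<close>

lemma second_derivative_symmetric_real:
  fixes f :: "'a::real_normed_vector \<Rightarrow> real"
  assumes S: "open S" and f: "Ck_on (Suc (Suc k)) f S" and x: "x \<in> S"
  shows "dd (\<lambda>z. dd f z u) x v = dd (\<lambda>z. dd f z v) x u"
proof (rule ccontr)
  define A where "A y = dd (\<lambda>z. dd f z u) y v" for y
  define B where "B y = dd (\<lambda>z. dd f z v) y u" for y
  assume "\<not> ?thesis"
  then have ne: "A x \<noteq> B x" by (simp add: A_def B_def)
  \<comment> \<open>Half the gap: a value within \<open>e\<close> of \<open>A x\<close> cannot also
    lie within \<open>e\<close> of \<open>B x\<close>.\<close>
  define e where "e = \<bar>A x - B x\<bar> / 2"
  have e: "e > 0" using ne by (simp add: e_def)
  have "continuous_on S A" "continuous_on S B"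
    unfolding A_def B_def by (rule Ck_on_continuous[OF Ck_on_Suc_dd[OF Ck_on_Suc_dd[OF f]]])+
  then have "isCont A x" "isCont B x"
    using S x continuous_on_eq_continuous_at by blast+
  then have "\<exists>d>0. \<forall>y. dist y x < d \<longrightarrow> dist (A y) (A x) < e"
    "\<exists>d>0. \<forall>y. dist y x < d \<longrightarrow> dist (B y) (B x) < e"
    using e by (auto simp: continuous_at_eps_delta dist_norm)
  then obtain d1 d2 where d1: "d1 > 0" "\<And>y. dist y x < d1 \<Longrightarrow> dist (A y) (A x) < e"
    and d2: "d2 > 0" "\<And>y. dist y x < d2 \<Longrightarrow> dist (B y) (B x) < e" by blast
  obtain d3 where d3: "d3 > 0" "ball x d3 \<subseteq> S" using S x open_contains_ball by blast
  define d where "d = min d1 (min d2 d3)"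
  have d: "d > 0" using d1 d2 d3 by (simp add: d_def)
  \<comment> \<open>Keeps the whole parallelogram within distance \<open>d\<close> of
    \<open>x\<close>; the summand 1 makes the denominator positive even if \<open>u\<close> and
    \<open>v\<close> vanish.\<close>
  define t where "t = d / (norm u + norm v + 1)"
  have n: "norm u + norm v + 1 > 0" by (simp add: add_nonneg_pos)
  have t: "t > 0" using d n by (simp add: t_def)
  have near: "dist (x + a *\<^sub>R u + b *\<^sub>R v) x < d" if "0 \<le> a" "a \<le> t" "0 \<le> b" "b \<le> t" for a b
  proof -
    have "dist (x + a *\<^sub>R u + b *\<^sub>R v) x \<le> a * norm u + b * norm v"
      using norm_triangle_ineq[of "a *\<^sub>R u" "b *\<^sub>R v"] that by (simp add: dist_norm)
    also have "\<dots> \<le> t * norm u + t * norm v"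
      using that by (intro add_mono mult_right_mono) auto
    also have "\<dots> < t * (norm u + norm v + 1)"
      using t by (simp add: algebra_simps)
    also have "\<dots> = d" using n by (simp add: t_def)
    finally show ?thesis .
  qed
  have sub: "x + a *\<^sub>R u + b *\<^sub>R v \<in> S" if "0 \<le> a" "a \<le> t" "0 \<le> b" "b \<le> t" for a b
    using near[OF that] d3 by (auto simp: d_def dist_commute)
  have sub': "x + a *\<^sub>R v + b *\<^sub>R u \<in> S" if "0 \<le> a" "a \<le> t" "0 \<le> b" "b \<le> t" for a b
    using sub[of b a] that by (simp add: algebra_simps)
  obtain a b where ab: "0 \<le> a" "a \<le> t" "0 \<le> b" "b \<le> t"
    "f (x + t *\<^sub>R u + t *\<^sub>R v) - f (x + t *\<^sub>R u) - f (x + t *\<^sub>R v) + f x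
       = t * t * A (x + a *\<^sub>R u + b *\<^sub>R v)"
    unfolding A_def by (rule second_difference_mean_value[OF S f t sub])
  obtain a' b' where ab': "0 \<le> a'" "a' \<le> t" "0 \<le> b'" "b' \<le> t"
    "f (x + t *\<^sub>R v + t *\<^sub>R u) - f (x + t *\<^sub>R v) - f (x + t *\<^sub>R u) + f x
       = t * t * B (x + a' *\<^sub>R v + b' *\<^sub>R u)"
    unfolding B_def by (rule second_difference_mean_value[OF S f t sub'])
  have eq: "x + a' *\<^sub>R v + b' *\<^sub>R u = x + b' *\<^sub>R u + a' *\<^sub>R v"
    by (simp add: algebra_simps)
  have eq2: "x + t *\<^sub>R v + t *\<^sub>R u = x + t *\<^sub>R u + t *\<^sub>R v"
    by (simp add: algebra_simps)
  have "t * t * A (x + a *\<^sub>R u + b *\<^sub>R v) = t * t * B (x + b' *\<^sub>R u + a' *\<^sub>R v)"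
    using ab(5) ab'(5) unfolding eq eq2 by linarith
  then have "A (x + a *\<^sub>R u + b *\<^sub>R v) = B (x + b' *\<^sub>R u + a' *\<^sub>R v)"
    using t by simp
  moreover have "dist (A (x + a *\<^sub>R u + b *\<^sub>R v)) (A x) < e"
    using near[OF ab(1-4)] by (intro d1) (simp add: d_def)
  moreover have "dist (B (x + b' *\<^sub>R u + a' *\<^sub>R v)) (B x) < e"
    using near[OF ab'(3,4,1,2)] by (intro d2) (simp add: d_def)
  ultimately show False
    unfolding e_def dist_real_def by (simp add: field_simps abs_if split: if_splits)
qed

lemma second_derivative_symmetric:
  fixes f :: "'a::real_normed_vector \<Rightarrow> 'b::euclidean_space"
  assumes S: "open S" and f: "Ck_on (Suc (Suc k)) f S" and x: "x \<in> S"
  shows "dd (\<lambda>z. dd f z u) x v = dd (\<lambda>z. dd f z v) x u"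
proof (rule euclidean_eqI)
  fix b :: 'b
  have fb: "Ck_on (Suc (Suc k)) (\<lambda>z. f z \<bullet> b) S"
    by (rule Ck_on_inner[OF S f Ck_on_const])
  have 1: "dd (\<lambda>z. f z \<bullet> b) y w = dd f y w \<bullet> b" if "y \<in> S" for y w
    by (rule fun_cong[OF dd_eqI, THEN trans])
      (use has_derivative_inner_left[OF Ck_on_has_derivative[OF f S that]] in auto)
  have 2: "dd (\<lambda>z. dd (\<lambda>z. f z \<bullet> b) z w) x w' = dd (\<lambda>z. dd f z w) x w' \<bullet> b" for w w'
  proof -
    have "dd (\<lambda>z. dd (\<lambda>z. f z \<bullet> b) z w) x = dd (\<lambda>z. dd f z w \<bullet> b) x"
      by (rule dd_cong[OF S x]) (rule 1)
    also have "\<dots> = (\<lambda>w'. dd (\<lambda>z. dd f z w) x w' \<bullet> b)"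
      by (rule dd_eqI) (rule has_derivative_inner_left[OF Ck_on_has_derivative[OF Ck_on_Suc_dd[OF f] S x]])
    finally show ?thesis by simp
  qed
  show "dd (\<lambda>z. dd f z u) x v \<bullet> b = dd (\<lambda>z. dd f z v) x u \<bullet> b"
    using second_derivative_symmetric_real[OF S fb x, of u v] unfolding 2 .
qed

text \<open>By translation invariance of \<open>lborel\<close> every difference quotient of
  \<open>W\<close> has integral zero. The quotients converge to the derivative and are dominated by
  a constant on a compact set, so the integral passes to the limit.\<close>

lemma integral_directional_derivative_zero:
  fixes W :: "'a::euclidean_space \<Rightarrow> real"
  assumes W: "Ck_on 1 W UNIV" and K: "compact K" and zero: "\<And>x. x \<notin> K \<Longrightarrow> W x = 0"
  shows "integrable lborel (\<lambda>x. dd W x v)" "(\<integral>x. dd W x v \<partial>lborel) = 0"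
proof -
  define D where "D x = dd W x v" for x
  have W': "Ck_on (Suc 0) W UNIV" using W by simp
  have contD: "continuous_on UNIV D"
    unfolding D_def by (rule Ck_on_continuous[OF Ck_on_Suc_dd[OF W']])
  have contW: "continuous_on UNIV W" by (rule Ck_on_continuous[OF W])
  have Dzero: "D x = 0" if "x \<notin> K" for x
  proof -
    have "dd W x = dd (\<lambda>_. 0) x"
      by (rule dd_cong[of "- K"]) (use that zero K in \<open>auto simp: compact_imp_closed open_Compl\<close>)
    then show ?thesis by (simp add: D_def)
  qed
  have "bounded (D ` K)"
    by (intro compact_imp_bounded compact_continuous_image continuous_on_subset[OF contD] K) auto
  then obtain B0 where B0: "\<And>x. x \<in> K \<Longrightarrow> \<bar>D x\<bar> \<le> B0"
    by (auto simp: bounded_iff)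
  define B where "B = max B0 0"
  have B: "\<bar>D x\<bar> \<le> B" for x
    using B0[of x] Dzero[of x] by (cases "x \<in> K") (auto simp: B_def)
  \<comment> \<open>The points \<open>x\<close> for which \<open>x + s *\<^sub>R v\<close> lies in
    \<open>K\<close> for some \<open>s\<close> between 0 and 1; elsewhere all quotients
    \<open>q n\<close> vanish.\<close>
  define K' where "K' = (\<lambda>(k, s). k - s *\<^sub>R v) ` (K \<times> {0..1::real})"
  have K': "compact K'"
    unfolding K'_def by (intro compact_continuous_image compact_Times K compact_Icc)
      (auto simp: case_prod_unfold intro!: continuous_intros)
  have inK': "x \<in> K'" if "x + s *\<^sub>R v \<in> K" "0 \<le> s" "s \<le> 1" for x s
    unfolding K'_def by (rule image_eqI[of _ _ "(x + s *\<^sub>R v, s)"]) (use that in auto)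
  define t where "t n = 1 / real (Suc n)" for n
  have t: "0 < t n" "t n \<le> 1" for n by (auto simp: t_def)
  define q where "q n x = (W (x + t n *\<^sub>R v) - W x) / t n" for n x
  \<comment> \<open>A quotient is a value of the derivative on the segment; this yields both the
    bound by \<open>B\<close> and the vanishing off \<open>K'\<close>.\<close>
  have quot: "\<exists>s. 0 \<le> s \<and> s \<le> 1 \<and> q n x = D (x + s *\<^sub>R v)" for n x
  proof -
    have "((\<lambda>s. W (x + s *\<^sub>R v)) has_real_derivative D (x + s *\<^sub>R v)) (at s)" for s
      unfolding D_def by (rule Ck_on_line_derivative[OF open_UNIV W']) simp
    from MVT2[OF t(1)[of n] this] obtain s where "0 < s" "s < t n"
      "W (x + t n *\<^sub>R v) - W (x + 0 *\<^sub>R v) = (t n - 0) * D (x + s *\<^sub>R v)" by blast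
    then show ?thesis using t[of n] by (intro exI[of _ s]) (auto simp: q_def)
  qed
  have bound: "norm (q n x) \<le> indicator K' x *\<^sub>R B" for n x
  proof (cases "x \<in> K'")
    case True
    then show ?thesis using quot[of n x] B by auto
  next
    case False
    then show ?thesis using quot[of n x] Dzero inK' by fastforce
  qed
  have lim: "(\<lambda>n. q n x) \<longlonglongrightarrow> D x" for x
  proof -
    have "((\<lambda>s. W (x + s *\<^sub>R v)) has_real_derivative D x) (at 0)"
      using Ck_on_line_derivative[OF open_UNIV W', of x 0 v] by (simp add: D_def)
    then have "((\<lambda>h. (W (x + h *\<^sub>R v) - W x) / h) \<longlongrightarrow> D x) (at 0)"
      by (simp add: has_field_derivative_iff)
    moreover have "filterlim t (at 0) sequentially"
      unfolding filterlim_at t_def using LIMSEQ_inverse_real_of_nat by (auto simp: inverse_eq_divide)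
    ultimately show ?thesis unfolding q_def by (rule filterlim_compose)
  qed
  have intW: "integrable lborel W"
  proof -
    have "integrable lborel (\<lambda>x. indicator K x *\<^sub>R W x)"
      by (intro borel_integrable_compact K continuous_on_subset[OF contW]) auto
    also have "(\<lambda>x. indicator K x *\<^sub>R W x) = W"
      using zero by (auto simp: fun_eq_iff indicator_def)
    finally show ?thesis .
  qed
  have measW: "W \<in> borel_measurable borel" "D \<in> borel_measurable borel"
    using contW contD by (auto intro: borel_measurable_continuous_onI)
  have shift: "integrable lborel (\<lambda>x. W (x + c))" "(\<integral>x. W (x + c) \<partial>lborel) = (\<integral>x. W x \<partial>lborel)" for c
  proof -
    have "integrable (distr lborel borel ((+) c)) W" by (simp add: lborel_distr_plus intW)
    then show "integrable lborel (\<lambda>x. W (x + c))"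
      by (subst (asm) integrable_distr_eq) (use measW in \<open>auto simp: add.commute\<close>)
    have "(\<integral>x. W x \<partial>lborel) = (\<integral>x. W x \<partial>distr lborel borel ((+) c))" by (simp add: lborel_distr_plus)
    also have "\<dots> = (\<integral>x. W (c + x) \<partial>lborel)"
      by (rule integral_distr) (use measW in auto)
    finally show "(\<integral>x. W (x + c) \<partial>lborel) = (\<integral>x. W x \<partial>lborel)" by (simp add: add.commute)
  qed
  have int0: "(\<integral>x. q n x \<partial>lborel) = 0" for n
    unfolding q_def using shift intW by simp
  have ind: "integrable lborel (\<lambda>x. indicator K' x *\<^sub>R B)"
    by (intro borel_integrable_compact K' continuous_on_const)
  have measq: "q n \<in> borel_measurable lborel" for n
    unfolding q_def using measW by measurable
  have measD: "D \<in> borel_measurable lborel" using measW by simp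
  have "integrable lborel D"
    by (rule integrable_dominated_convergence[where s = q, OF measD measq ind]) (use lim bound in auto)
  then show "integrable lborel (\<lambda>x. dd W x v)" by (simp add: D_def[abs_def])
  have "(\<lambda>n. \<integral>x. q n x \<partial>lborel) \<longlonglongrightarrow> (\<integral>x. D x \<partial>lborel)"
    by (rule integral_dominated_convergence[OF measD measq ind]) (use lim bound in auto)
  then have "(\<integral>x. D x \<partial>lborel) = 0"
    unfolding int0 by (simp add: LIMSEQ_const_iff)
  then show "(\<integral>x. dd W x v \<partial>lborel) = 0" by (simp add: D_def)
qed

section \<open>Elementary symmetric functions and Newton transformations\<close>

lemma matrix_ring_simps:
  fixes A A' :: "real^'n^'m" and B B' :: "real^'l^'n"
  shows "(A + A') ** B = A ** B + A' ** B" "A ** (B + B') = A ** B + A ** B'"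
    "(A - A') ** B = A ** B - A' ** B" "A ** (B - B') = A ** B - A ** B'"
    "(c *\<^sub>R A) ** B = c *\<^sub>R (A ** B)" "A ** (c *\<^sub>R B) = c *\<^sub>R (A ** B)"
  by (simp_all add: matrix_matrix_mult_def vec_eq_iff sum.distrib sum_subtractf sum_distrib_left algebra_simps)

lemma degree_det_linear_le:
  fixes A B :: "real^'m^'m"
  shows "degree (det (\<chi> i j. [:A$i$j, B$i$j:])) \<le> CARD('m)"
proof -
  have "degree (\<Prod>i\<in>UNIV. [:A$i$(p i), B$i$(p i):]) \<le> (\<Sum>i\<in>(UNIV::'m set). 1)" for p
    by (rule order_trans[OF degree_prod_sum_le]) (auto intro!: sum_mono simp del: sum_constant)
  then have d: "degree (\<Prod>i\<in>(UNIV::'m set). [:A$i$(p i), B$i$(p i):]) \<le> CARD('m)" for p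
    by simp
  have "degree (of_int (sign p) * (\<Prod>i\<in>(UNIV::'m set). [:A$i$(p i), B$i$(p i):])) \<le> CARD('m)" for p
    using degree_mult_le[of "of_int (sign p)" "\<Prod>i\<in>(UNIV::'m set). [:A$i$(p i), B$i$(p i):]"] d[of p]
    by (simp add: sign_def)
  then show ?thesis
    unfolding det_def by (intro degree_sum_le) (auto simp: finite_permutations)
qed

lemma poly_det_linear:
  fixes A B :: "real^'m^'m"
  shows "poly (det (\<chi> i j. [:A$i$j, B$i$j:])) t = det (A + t *\<^sub>R B)"
  unfolding det_def by (simp add: poly_sum poly_prod sign_def mult.commute)

lemma elem_sym_eq_0: "CARD('m) < k \<Longrightarrow> elem_sym k (B :: real^'m^'m) = 0"
  unfolding elem_sym_def
  by (intro coeff_eq_0 order_le_less_trans[OF degree_det_linear_le])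

lemma det_eq_sum_elem_sym:
  fixes B :: "real^'m^'m"
  assumes "CARD('m) \<le> n"
  shows "det (mat 1 + t *\<^sub>R B) = (\<Sum>k\<le>n. elem_sym k B * t ^ k)"
proof -
  have "det (mat 1 + t *\<^sub>R B) = poly (det (\<chi> i j. [:(mat 1 :: real^'m^'m)$i$j, B$i$j:])) t"
    by (simp add: poly_det_linear)
  also have "\<dots> = (\<Sum>k\<le>degree (det (\<chi> i j. [:(mat 1 :: real^'m^'m)$i$j, B$i$j:])). elem_sym k B * t ^ k)"
    unfolding elem_sym_def by (rule poly_altdef)
  also have "\<dots> = (\<Sum>k\<le>n. elem_sym k B * t ^ k)"
    using degree_det_linear_le[of "mat 1" B] assms
    by (intro sum.mono_neutral_left) (auto simp: elem_sym_def coeff_eq_0)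
  finally show ?thesis .
qed

lemma coeff_0_1_prod:
  "finite I \<Longrightarrow> coeff (\<Prod>i\<in>I. [:1, b i:]) 0 = 1 \<and> coeff (\<Prod>i\<in>I. [:1, b i:]) 1 = (\<Sum>i\<in>I. b i :: real)"
  by (induction I rule: finite_induct) (simp_all add: coeff_pCons mult_pCons_left)

lemma elem_sym_0 [simp]: "elem_sym 0 (B :: real^'m^'m) = 1"
proof -
  have "elem_sym 0 B = poly (det (\<chi> i j. [:(mat 1 :: real^'m^'m)$i$j, B$i$j:])) 0"
    by (simp add: elem_sym_def poly_0_coeff_0)
  then show ?thesis by (simp only: poly_det_linear) simp
qed

text \<open>A permutation other than the identity moves some \<open>a\<close>, hence also
  \<open>p a\<close>. Its Leibniz term has two off-diagonal factors divisible by the variable and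
  contributes nothing in degree 1.\<close>

lemma elem_sym_1: "elem_sym (Suc 0) (B :: real^'m^'m) = trace B"
proof -
  let ?M = "\<chi> i j. [:(mat 1 :: real^'m^'m)$i$j, B$i$j:]"
  let ?P = "\<lambda>p. of_int (sign p) * (\<Prod>i\<in>(UNIV::'m set). ?M $ i $ p i)"
  have other: "coeff (?P p) 1 = 0" if p: "p permutes (UNIV::'m set)" "p \<noteq> id" for p
  proof -
    obtain a where a: "p a \<noteq> a" using p(2) by (auto simp: fun_eq_iff)
    have pb: "p (p a) \<noteq> p a" using a p(1) by (metis permutes_inj injD)
    have "(\<Prod>i\<in>(UNIV::'m set). ?M $ i $ p i)
        = ?M $ a $ p a * (?M $ p a $ p (p a) * (\<Prod>i\<in>UNIV - {a} - {p a}. ?M $ i $ p i))"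
      using a by (simp add: prod.remove[of UNIV a] prod.remove[of "UNIV - {a}" "p a"])
    also have "\<dots> = [:0, B$a$p a:] * ([:0, B$p a$p (p a):] * (\<Prod>i\<in>UNIV - {a} - {p a}. ?M $ i $ p i))"
      using a pb by (simp add: mat_def)
    finally have "coeff (\<Prod>i\<in>(UNIV::'m set). ?M $ i $ p i) 1 = 0"
      by (simp add: coeff_pCons)
    then show ?thesis by (simp add: sign_def)
  qed
  have "elem_sym 1 B = (\<Sum>p\<in>{p. p permutes (UNIV::'m set)}. coeff (?P p) 1)"
    by (simp add: elem_sym_def det_def coeff_sum)
  also have "\<dots> = (\<Sum>p\<in>{id}. coeff (?P p) 1)"
    by (rule sum.mono_neutral_right) (use other in \<open>auto simp: finite_permutations permutes_id simp del: One_nat_def\<close>)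
  also have "\<dots> = coeff (\<Prod>i\<in>(UNIV::'m set). [:1, B$i$i:]) 1"
    by (simp add: mat_def)
  also have "\<dots> = trace B"
    using coeff_0_1_prod[of "UNIV :: 'm set" "\<lambda>i. B$i$i"] by (simp add: trace_def)
  finally show ?thesis by simp
qed

text \<open>The hypothesis is an intertwining relation because that is what a change of charts
  supplies, with \<open>J\<close> the Jacobian. Multiplying by \<open>det J\<close> compares the
  polynomials det(I + tB) at every \<open>t\<close>.\<close>

lemma elem_sym_conjugate:
  fixes J B B' :: "real^'m^'m"
  assumes "invertible J" "J ** B = B' ** J"
  shows "elem_sym k B = elem_sym k B'"
proof -
  let ?p = "\<lambda>B. det (\<chi> i j. [:(mat 1 :: real^'m^'m)$i$j, B$i$j:])"
  have "poly (?p B) t = poly (?p B') t" for t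
  proof -
    have "det J * det (mat 1 + t *\<^sub>R B) = det (J ** (mat 1 + t *\<^sub>R B))" by (simp add: det_mul)
    also have "J ** (mat 1 + t *\<^sub>R B) = (mat 1 + t *\<^sub>R B') ** J"
      using assms(2) by (simp add: matrix_ring_simps)
    also have "det \<dots> = det J * det (mat 1 + t *\<^sub>R B')" by (simp add: det_mul)
    finally show ?thesis
      using assms(1) by (simp add: poly_det_linear invertible_det_nz)
  qed
  then have "?p B = ?p B'" using poly_eq_poly_eq_iff by blast
  then show ?thesis by (simp add: elem_sym_def)
qed

lemma newton_conjugate:
  fixes J B B' :: "real^'m^'m"
  assumes "invertible J" "J ** B = B' ** J"
  shows "J ** newton k B = newton k B' ** J"
proof (induction k)
  case (Suc k)
  have "J ** (B ** newton k B) = B' ** (newton k B' ** J)"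
    by (metis Suc assms(2) matrix_mul_assoc)
  then show ?case
    using elem_sym_conjugate[OF assms]
    by (simp add: matrix_ring_simps matrix_mul_assoc)
qed simp

lemma newton_commute: "B ** newton k B = newton k B ** B"
proof (induction k)
  case (Suc k)
  then show ?case
    by (simp add: matrix_ring_simps matrix_mul_assoc)
qed simp

lemma Ck_on_elem_sym:
  fixes B :: "'a::real_normed_vector \<Rightarrow> real^'m^'m"
  assumes S: "open S" and B: "Ck_on n B S"
  shows "Ck_on n (\<lambda>x. elem_sym k (B x)) S"
proof -
  \<comment> \<open>The induction runs over the factors with \<open>k\<close> arbitrary, since one
    more linear factor involves the coefficients of index \<open>k\<close> and \<open>k - 1\<close>
    of the old product.\<close>
  have prod: "Ck_on n (\<lambda>x. coeff (\<Prod>i\<in>I. [:a i, b i x:]) k) S"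
    if "finite I" "\<And>i. Ck_on n (b i) S" for I :: "'m set" and a :: "'m \<Rightarrow> real" and b k
    using that(1)
  proof (induction I arbitrary: k rule: finite_induct)
    case empty
    show ?case by (simp only: prod.empty) (rule Ck_on_const)
  next
    case (insert i I)
    have "coeff (\<Prod>i\<in>insert i I. [:a i, b i x:]) k
        = a i * coeff (\<Prod>i\<in>I. [:a i, b i x:]) k
          + b i x * (case k of 0 \<Rightarrow> 0 | Suc l \<Rightarrow> coeff (\<Prod>i\<in>I. [:a i, b i x:]) l)" for x
      using insert.hyps by (simp add: mult_pCons_left coeff_pCons split: nat.split)
    moreover have "Ck_on n (\<lambda>x. case k of 0 \<Rightarrow> 0 | Suc l \<Rightarrow> coeff (\<Prod>i\<in>I. [:a i, b i x:]) l) S"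
      using insert.IH by (cases k) (simp_all add: Ck_on_const del: Ck_on.simps)
    ultimately show ?case
      using insert.IH by (simp only:) (intro Ck_on_add Ck_on_mult S Ck_on_const that(2))
  qed
  have eq: "elem_sym k M = (\<Sum>p\<in>{p. p permutes (UNIV::'m set)}.
      of_int (sign p) * coeff (\<Prod>i\<in>(UNIV::'m set). [:(mat 1 :: real^'m^'m)$i$p i, M$i$p i:]) k)" for M :: "real^'m^'m"
  proof -
    have "coeff (of_int (sign p) * q) k = of_int (sign p) * coeff q k" for p :: "'m \<Rightarrow> 'm" and q :: "real poly"
      by (simp add: sign_def)
    then show ?thesis by (simp add: elem_sym_def det_def coeff_sum)
  qed
  show ?thesis
    unfolding eq by (intro Ck_on_sum Ck_on_mult S Ck_on_const prod finite Ck_on_nth B)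
qed

section \<open>Differentials of the determinant and of the elementary symmetric functions\<close>

lemma trace_scaleR: "trace (c *\<^sub>R A) = c * trace (A :: real^'m^'m)"
  by (simp add: trace_def sum_distrib_left)

text \<open>Jacobi's formula. In the direction \<open>A ** C\<close> the factor \<open>A\<close>
  splits off, leaving the linear coefficient of det(I + sC). This form covers singular
  \<open>A\<close>, which \<open>mat 1 + t *\<^sub>R B\<close> may be.\<close>

lemma det_directional_derivative:
  fixes A C :: "real^'m^'m"
  shows "((\<lambda>s. det (A + s *\<^sub>R (A ** C))) has_real_derivative det A * trace C) (at 0)"
proof -
  let ?n = "CARD('m)"
  have "A + s *\<^sub>R (A ** C) = A ** (mat 1 + s *\<^sub>R C)" for s
    by (simp add: matrix_ring_simps)
  then have eq: "det (A + s *\<^sub>R (A ** C)) = det A * (\<Sum>k\<le>?n. elem_sym k C * s ^ k)" for s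
    by (simp add: det_mul det_eq_sum_elem_sym[OF order_refl])
  have "((\<lambda>s. \<Sum>k\<le>?n. elem_sym k C * s ^ k) has_real_derivative
      (\<Sum>k\<le>?n. elem_sym k C * (real k * 0 ^ (k - 1)))) (at 0)"
    by (intro DERIV_sum DERIV_cmult) (auto intro!: derivative_eq_intros)
  also have "(\<Sum>k\<le>?n. elem_sym k C * (real k * 0 ^ (k - 1))) = (\<Sum>k\<in>{1}. elem_sym k C * (real k * 0 ^ (k - 1)))"
    by (rule sum.mono_neutral_right) (auto simp: Suc_le_eq)
  finally have "((\<lambda>s. \<Sum>k\<le>?n. elem_sym k C * s ^ k) has_real_derivative trace C) (at 0)"
    by (simp add: elem_sym_1)
  from DERIV_cmult[OF this, of "det A"] show ?thesis by (simp add: eq)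
qed

lemma Ck_on_has_derivative_UNIV: "Ck_on (Suc k) f UNIV \<Longrightarrow> (f has_derivative dd f x) (at x)"
  by (rule Ck_on_has_derivative) auto

lemma dd_det:
  fixes A C :: "real^'m^'m"
  shows "dd det A (A ** C) = det A * trace C"
proof -
  have "Ck_on (Suc 0) (det :: real^'m^'m \<Rightarrow> real) UNIV"
    using Ck_on_det[OF open_UNIV Ck_on_ident[of "Suc 0" UNIV]] by (simp del: Ck_on.simps)
  from Ck_on_line_derivative[OF open_UNIV this, of A 0 "A ** C"]
  have "((\<lambda>s. det (A + s *\<^sub>R (A ** C))) has_real_derivative dd det A (A ** C)) (at 0)" by simp
  then show ?thesis
    using det_directional_derivative DERIV_unique by blast
qed

text \<open>Differentiating \<open>det ((I + t B) (I + s t C))\<close> at \<open>s = 0\<close> and comparing coefficients of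
  powers of \<open>t\<close> yields a recursion for the differential of \<open>elem_sym\<close>.\<close>

lemma dd_elem_sym:
  fixes B C :: "real^'m^'m"
  shows "dd (elem_sym (Suc k)) B C = trace (newton k B ** C)"
proof -
  have sm: "Ck_on (Suc 0) (elem_sym j :: real^'m^'m \<Rightarrow> real) UNIV" for j
    by (rule Ck_on_elem_sym[OF open_UNIV Ck_on_ident])
  define D where "D j C = dd (elem_sym j) B C" for j and C :: "real^'m^'m"
  have lin: "linear (D j)" for j
    unfolding D_def[abs_def] by (rule has_derivative_linear[OF Ck_on_has_derivative_UNIV[OF sm]])
  have D0: "D 0 C = 0" for C
  proof -
    have "elem_sym 0 = (\<lambda>_ :: real^'m^'m. 1 :: real)" by auto
    then show ?thesis by (simp add: D_def)
  qed
  \<comment> \<open>One above the dimension, so that the coefficient of degree \<open>Suc j\<close>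
    is still present for \<open>j = CARD('m)\<close>.\<close>
  let ?n = "Suc CARD('m)"
  have rec: "D (Suc j) C + D j (B ** C) = elem_sym j B * trace C" for j C
  proof -
    have poly_id: "(\<Sum>i\<le>?n. (D i C + t * D i (B ** C)) * t ^ i) = (\<Sum>i\<le>?n. elem_sym i B * t ^ i) * (t * trace C)"
      for t :: real
    proof -
      let ?A = "mat 1 + t *\<^sub>R B"
      let ?C = "C + t *\<^sub>R (B ** C)"
      have AC: "?A ** (t *\<^sub>R C) = t *\<^sub>R ?C"
        by (simp add: matrix_ring_simps scaleR_add_right)
      have "?A + s *\<^sub>R (?A ** (t *\<^sub>R C)) = mat 1 + t *\<^sub>R (B + s *\<^sub>R ?C)" for s
        unfolding AC by (simp add: scaleR_add_right mult.commute)
      then have "det (?A + s *\<^sub>R (?A ** (t *\<^sub>R C))) = (\<Sum>i\<le>?n. elem_sym i (B + s *\<^sub>R ?C) * t ^ i)" for s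
        by (simp only: det_eq_sum_elem_sym[OF le_SucI[OF order_refl]])
      moreover have "((\<lambda>s. \<Sum>i\<le>?n. elem_sym i (B + s *\<^sub>R ?C) * t ^ i) has_real_derivative
          (\<Sum>i\<le>?n. D i ?C * t ^ i)) (at 0)"
        using Ck_on_line_derivative[OF open_UNIV sm, of B 0 ?C]
        by (intro DERIV_sum DERIV_cmult_right) (simp add: D_def)
      ultimately have "(\<Sum>i\<le>?n. D i ?C * t ^ i) = det ?A * trace (t *\<^sub>R C)"
        using det_directional_derivative[of ?A "t *\<^sub>R C"] DERIV_unique by force
      then show ?thesis
        by (simp only: linear_add[OF lin] linear_scale[OF lin] trace_scaleR det_eq_sum_elem_sym[OF le_SucI[OF order_refl]] real_scaleR_def)
    qed
    show ?thesis
    proof (cases "j \<le> CARD('m)")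
      case True
      define p where "p = (\<Sum>i\<le>?n. monom (D i C) i + monom (D i (B ** C)) (Suc i))"
      define r where "r = (\<Sum>i\<le>?n. monom (elem_sym i B * trace C) (Suc i))"
      have "poly p t = poly r t" for t
        using poly_id[of t]
        unfolding p_def r_def poly_sum poly_add poly_monom sum_distrib_right
        by (simp only: algebra_simps power_Suc)
      then have "p = r" using poly_eq_poly_eq_iff by blast
      then have "coeff p (Suc j) = coeff r (Suc j)" by simp
      then show ?thesis using True
        by (simp add: p_def r_def coeff_sum sum.distrib sum.delta if_distrib cong: if_cong)
    next
      case False
      have "D i C = 0" if "CARD('m) < i" for i C
      proof -
        have "elem_sym i = (\<lambda>_ :: real^'m^'m. 0 :: real)" using that by (auto simp: elem_sym_eq_0)
        then show ?thesis by (simp add: D_def)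
      qed
      then show ?thesis using False by (simp add: elem_sym_eq_0)
    qed
  qed
  \<comment> \<open>Since \<open>newton k B\<close> commutes with \<open>B\<close>, these traces
    satisfy the recursion \<open>rec\<close>.\<close>
  have "D (Suc k) C = trace (newton k B ** C)" for C
  proof (induction k arbitrary: C)
    case 0
    then show ?case using rec[of 0 C] D0 by simp
  next
    case (Suc k)
    have "trace (newton (Suc k) B ** C) = elem_sym (Suc k) B * trace C - trace (newton k B ** (B ** C))"
      by (simp add: matrix_ring_simps trace_sub trace_scaleR newton_commute matrix_mul_assoc)
    then show ?case using rec[of "Suc k" C] Suc[of "B ** C"] by simp
  qed
  then show ?thesis by (simp add: D_def)
qed

lemma elem_sym_scaleR: "elem_sym k (s *\<^sub>R B) = s ^ k * elem_sym k (B :: real^'m^'m)"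
proof -
  let ?p = "\<lambda>B. det (\<chi> i j. [:(mat 1 :: real^'m^'m)$i$j, B$i$j:])"
  have "?p (s *\<^sub>R B) = pcompose (?p B) [:0, s:]"
  proof (rule poly_eq_poly_eq_iff[THEN iffD1], rule ext)
    fix t
    have "poly (pcompose (?p B) [:0, s:]) t = poly (?p B) (s * t)" by (simp add: poly_pcompose mult.commute)
    also have "\<dots> = det (mat 1 + (s * t) *\<^sub>R B)" by (simp only: poly_det_linear)
    also have "\<dots> = poly (?p (s *\<^sub>R B)) t" by (simp only: poly_det_linear scaleR_scaleR mult.commute)
    finally show "poly (?p (s *\<^sub>R B)) t = poly (pcompose (?p B) [:0, s:]) t" by simp
  qed
  then show ?thesis by (simp add: elem_sym_def coeff_pcompose_linear)
qed

text \<open>Euler's relation for the homogeneous function \<open>elem_sym (Suc k)\<close>: both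
  sides are the derivative of its value on \<open>s *\<^sub>R B\<close> at s = 1.\<close>

lemma trace_newton_mult: "trace (newton k B ** B) = real (Suc k) * elem_sym (Suc k) (B :: real^'m^'m)"
proof -
  have "Ck_on (Suc 0) (elem_sym (Suc k) :: real^'m^'m \<Rightarrow> real) UNIV"
    by (rule Ck_on_elem_sym[OF open_UNIV Ck_on_ident])
  from Ck_on_line_derivative[OF open_UNIV this, of 0 1 B]
  have "((\<lambda>s. elem_sym (Suc k) (s *\<^sub>R B)) has_real_derivative trace (newton k B ** B)) (at 1)"
    by (simp add: dd_elem_sym)
  moreover have "((\<lambda>s. elem_sym (Suc k) (s *\<^sub>R B)) has_real_derivative real (Suc k) * elem_sym (Suc k) B) (at 1)"
    unfolding elem_sym_scaleR by (auto intro!: derivative_eq_intros)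
  ultimately show ?thesis using DERIV_unique by blast
qed

text \<open>The trace of the recursion of \<open>newton\<close>, whose subtracted term is known from
  \<open>trace_newton_mult\<close>.\<close>

lemma trace_newton: "trace (newton k B) = (real CARD('m) - real k) * elem_sym k (B :: real^'m^'m)"
proof (cases k)
  case 0
  then show ?thesis by (simp add: trace_def mat_def)
next
  case (Suc j)
  then show ?thesis
    using trace_newton_mult[of j B]
    by (simp add: trace_sub trace_scaleR newton_commute algebra_simps) (simp add: trace_def mat_def)
qed

section \<open>The Levi-Civita connection in coordinates\<close>

lemma bilinear_ip: "bilinear (ip Q)"
  unfolding bilinear_def ip_def
  by (auto intro!: linearI simp: algebra_simps matrix_vector_mult_scaleR)

lemmas ip_linear_simps =
  bilinear_ladd[OF bilinear_ip] bilinear_radd[OF bilinear_ip]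
  bilinear_lsub[OF bilinear_ip] bilinear_rsub[OF bilinear_ip]
  bilinear_lmul[OF bilinear_ip] bilinear_rmul[OF bilinear_ip]
  bilinear_lneg[OF bilinear_ip] bilinear_rneg[OF bilinear_ip]
  bilinear_lzero[OF bilinear_ip] bilinear_rzero[OF bilinear_ip]

lemma inner_transpose_matrix:
  fixes A :: "real^'n^'m"
  shows "u \<bullet> (transpose A *v w) = (A *v u) \<bullet> w"
proof -
  have "(w v* A) \<bullet> u = w \<bullet> (A *v u)" by (rule dot_lmul_matrix)
  then show ?thesis by (simp add: inner_commute[of u] inner_commute[of w])
qed

lemma ip_transpose: "ip (transpose Q) u v = ip Q v u"
  unfolding ip_def inner_transpose_matrix by (rule inner_commute)

lemma ip_commute: "transpose Q = Q \<Longrightarrow> ip Q u v = ip Q v u"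
  using ip_transpose[of Q u v] by simp

lemma ip_congruence: "ip (transpose J ** Q ** J) u v = ip Q (J *v u) (J *v v)"
  unfolding ip_def matrix_vector_mul_assoc[symmetric] inner_transpose_matrix ..

lemma ip_add_form: "ip (Q + R) u v = ip Q u v + ip R u v"
  by (simp add: ip_def algebra_simps matrix_vector_mult_add_rdistrib)

lemma ip_nondegenerate:
  assumes "invertible Q" "transpose Q = Q" "\<And>w. ip Q u w = 0"
  shows "u = 0"
proof -
  have "Q *v u = 0"
    using assms(3)[of "Q *v u"] ip_commute[OF assms(2), of u "Q *v u"] by (simp add: ip_def)
  then show ?thesis
    using assms(1) by (metis invertible_def matrix_left_invertible_ker)
qed

lemma ip_eq_iff:
  assumes "invertible Q" "transpose Q = Q" "\<And>w. ip Q u w = ip Q v w"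
  shows "u = v"
  using ip_nondegenerate[OF assms(1,2), of "u - v"] assms(3) by (simp add: ip_linear_simps)

lemma invertible_solve:
  fixes Q :: "real^'n^'n"
  assumes "invertible Q"
  shows "Q *v (matrix_inv Q *v b) = b"
proof -
  have "Q ** matrix_inv Q = mat 1"
    using assms unfolding invertible_def matrix_inv_def by (metis (mono_tags, lifting) someI_ex)
  then show ?thesis by (simp add: matrix_vector_mul_assoc)
qed

text \<open>Raises an index: the vector that represents the functional in the form \<open>Q\<close>,
  see \<open>ip_raise\<close>. Written with a matrix, it depends smoothly on parameters by
  \<open>Ck_on_solve\<close>.\<close>

definition raise :: "real^'n^'n \<Rightarrow> (real^'n \<Rightarrow> real) \<Rightarrow> real^'n" where
  "raise Q \<phi> = matrix_inv Q *v (\<chi> i. \<phi> (axis i 1))"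

lemma linear_functional_vec:
  fixes \<phi> :: "real^'n \<Rightarrow> 'b::real_vector"
  assumes "linear \<phi>"
  shows "\<phi> w = (\<Sum>i\<in>UNIV. (w $ i) *\<^sub>R \<phi> (axis i 1))"
proof -
  have "\<phi> w = \<phi> (\<Sum>i\<in>UNIV. (w $ i) *\<^sub>R axis i 1)"
    using basis_expansion[of w] by (simp add: scalar_mult_eq_scaleR)
  then show ?thesis
    by (simp add: linear_sum[OF assms] linear_scale[OF assms])
qed

lemma ip_raise:
  assumes "invertible Q" "transpose Q = Q" "linear \<phi>"
  shows "ip Q (raise Q \<phi>) w = \<phi> w"
proof -
  have "ip Q (raise Q \<phi>) w = w \<bullet> (\<chi> i. \<phi> (axis i 1))"
    by (subst ip_commute[OF assms(2)]) (simp only: raise_def ip_def invertible_solve[OF assms(1)])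
  also have "\<dots> = (\<Sum>i\<in>UNIV. (w $ i) *\<^sub>R \<phi> (axis i 1))"
    by (simp add: inner_vec_def)
  also have "\<dots> = \<phi> w" by (rule linear_functional_vec[OF assms(3), symmetric])
  finally show ?thesis .
qed

text \<open>Cramer's rule writes the solution with quotients of determinants, whose regularity is
  known.\<close>

lemma Ck_on_solve:
  fixes Q :: "'a::real_normed_vector \<Rightarrow> real^'n^'n"
  assumes S: "open S" and Q: "Ck_on k Q S" and b: "Ck_on k b S" and inv: "\<And>x. x \<in> S \<Longrightarrow> invertible (Q x)"
  shows "Ck_on k (\<lambda>x. matrix_inv (Q x) *v b x) S"
proof -
  have "matrix_inv (Q x) *v b x = (\<chi> l. det (\<chi> i j. if j = l then b x $ i else Q x $ i $ j) / det (Q x))"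
    if "x \<in> S" for x
    using inv[OF that] cramer[of "Q x" "matrix_inv (Q x) *v b x" "b x"] invertible_solve[OF inv[OF that]]
    by (simp add: invertible_det_nz)
  moreover have "Ck_on k (\<lambda>x. \<chi> l. det (\<chi> i j. if j = l then b x $ i else Q x $ i $ j) / det (Q x)) S"
  proof (rule Ck_on_vec[OF S])
    fix l
    have "Ck_on k (\<lambda>x. \<chi> i j. if j = l then b x $ i else Q x $ i $ j) S"
    proof (rule Ck_on_mat[OF S])
      show "Ck_on k (\<lambda>x. (\<chi> i j. if j = l then b x $ i else Q x $ i $ j) $ i $ j) S" for i j
        using Ck_on_nth[OF S Ck_on_nth[OF S Q], of i j] Ck_on_nth[OF S b, of i]
        by (cases "j = l") (simp_all del: Ck_on.simps)
    qed
    then show "Ck_on k (\<lambda>x. (\<chi> l. det (\<chi> i j. if j = l then b x $ i else Q x $ i $ j) / det (Q x)) $ l) S"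
      unfolding vec_lambda_beta
      by (intro Ck_on_divide Ck_on_det S Q) (assumption | rule invertible_det_nz[THEN iffD1, OF inv])+
  qed
  ultimately show ?thesis by (subst Ck_on_cong[OF S])
qed

lemma bounded_bilinear_matrix_vector: "bounded_bilinear ((*v) :: real^'n^'m \<Rightarrow> real^'n \<Rightarrow> real^'m)"
proof -
  have "bilinear ((*v) :: real^'n^'m \<Rightarrow> real^'n \<Rightarrow> real^'m)"
    unfolding bilinear_def
    by (auto intro!: linearI simp: matrix_vector_mult_scaleR algebra_simps matrix_vector_mult_add_rdistrib scaleR_matrix_vector_assoc)
  then show ?thesis by (simp add: bilinear_conv_bounded_bilinear)
qed

lemma Ck_on_ip:
  assumes "open S" "Ck_on k Q S" "Ck_on k u S" "Ck_on k v S"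
  shows "Ck_on k (\<lambda>x. ip (Q x) (u x) (v x)) S"
  unfolding ip_def by (intro Ck_on_inner Ck_on_matrix_vector assms)

lemma has_derivative_ip:
  assumes "(Q has_derivative Q') (at x)" "(u has_derivative u') (at x)" "(v has_derivative v') (at x)"
  shows "((\<lambda>x. ip (Q x) (u x) (v x)) has_derivative
    (\<lambda>h. ip (Q' h) (u x) (v x) + ip (Q x) (u' h) (v x) + ip (Q x) (u x) (v' h))) (at x)"
  unfolding ip_def
  by (rule has_derivative_eq_rhs[OF has_derivative_inner[OF assms(2)
        bounded_bilinear.FDERIV[OF bounded_bilinear_matrix_vector assms(1,3)]]])
    (simp add: fun_eq_iff algebra_simps)

text \<open>A product rule for a bilinear map that itself depends on the point, as Christoffel maps
  do. Differentiability is given only for frozen arguments, hence the expansion in the standard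
  basis.\<close>

lemma has_derivative_bilinear_family:
  fixes B :: "real^'n \<Rightarrow> real^'n \<Rightarrow> real^'n \<Rightarrow> real^'n" and F :: "'a::real_normed_vector \<Rightarrow> real^'n"
  assumes V: "open V" and bil: "\<And>y. y \<in> V \<Longrightarrow> bilinear (B y)"
    and dB: "\<And>u v. ((\<lambda>y. B y u v) has_derivative dd (\<lambda>y. B y u v) (F x)) (at (F x))"
    and S: "open S" "x \<in> S" "F ` S \<subseteq> V"
    and F: "(F has_derivative F') (at x)" and a: "(a has_derivative a') (at x)" and b: "(b has_derivative b') (at x)"
  shows "((\<lambda>y. B (F y) (a y) (b y)) has_derivative
     (\<lambda>h. dd (\<lambda>y. B y (a x) (b x)) (F x) (F' h) + B (F x) (a' h) (b x) + B (F x) (a x) (b' h))) (at x)"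
proof -
  let ?e = "\<lambda>i. axis i 1 :: real^'n"
  have Fx: "F x \<in> V" using S by auto
  have expand: "B y u v = (\<Sum>i\<in>UNIV. \<Sum>j\<in>UNIV. (u $ i * v $ j) *\<^sub>R B y (?e i) (?e j))" if "y \<in> V" for y u v
  proof -
    have l: "linear (\<lambda>u. B y u v)" and r: "linear (B y u)" for u v
      using bil[OF that] by (auto simp: bilinear_def)
    have "B y u v = (\<Sum>i\<in>UNIV. (u $ i) *\<^sub>R B y (?e i) v)"
      by (rule linear_functional_vec[OF l])
    also have "\<dots> = (\<Sum>i\<in>UNIV. (u $ i) *\<^sub>R (\<Sum>j\<in>UNIV. (v $ j) *\<^sub>R B y (?e i) (?e j)))"
      by (intro sum.cong refl arg_cong[where f = "(*\<^sub>R) _"] linear_functional_vec[OF r])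
    finally show ?thesis by (simp add: scaleR_sum_right)
  qed
  have dexp: "dd (\<lambda>y. B y u v) (F x) h
      = (\<Sum>i\<in>UNIV. \<Sum>j\<in>UNIV. (u $ i * v $ j) *\<^sub>R dd (\<lambda>y. B y (?e i) (?e j)) (F x) h)" for u v h
  proof -
    have "dd (\<lambda>y. B y u v) (F x) = dd (\<lambda>y. \<Sum>i\<in>UNIV. \<Sum>j\<in>UNIV. (u $ i * v $ j) *\<^sub>R B y (?e i) (?e j)) (F x)"
      by (rule dd_cong[OF V Fx]) (rule expand)
    also have "\<dots> = (\<lambda>h. \<Sum>i\<in>UNIV. \<Sum>j\<in>UNIV. (u $ i * v $ j) *\<^sub>R dd (\<lambda>y. B y (?e i) (?e j)) (F x) h)"
      by (rule dd_eqI) (intro has_derivative_sum has_derivative_scaleR_right dB)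
    finally show ?thesis by simp
  qed
  have BF: "((\<lambda>y. B (F y) (?e i) (?e j)) has_derivative (\<lambda>h. dd (\<lambda>y. B y (?e i) (?e j)) (F x) (F' h))) (at x)" for i j
    by (rule has_derivative_compose[OF F dB])
  have comp: "((\<lambda>y. a y $ i) has_derivative (\<lambda>h. a' h $ i)) (at x)" "((\<lambda>y. b y $ i) has_derivative (\<lambda>h. b' h $ i)) (at x)" for i
    using bounded_linear.has_derivative[OF bounded_linear_vec_nth a] bounded_linear.has_derivative[OF bounded_linear_vec_nth b] by auto
  have "((\<lambda>y. \<Sum>i\<in>UNIV. \<Sum>j\<in>UNIV. (a y $ i * b y $ j) *\<^sub>R B (F y) (?e i) (?e j)) has_derivative
      (\<lambda>h. \<Sum>i\<in>UNIV. \<Sum>j\<in>UNIV. (a x $ i * b x $ j) *\<^sub>R dd (\<lambda>y. B y (?e i) (?e j)) (F x) (F' h)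
         + (a x $ i * b' h $ j + a' h $ i * b x $ j) *\<^sub>R B (F x) (?e i) (?e j))) (at x)"
    by (intro has_derivative_sum has_derivative_scaleR has_derivative_mult comp BF)
  moreover have "(\<Sum>i\<in>UNIV. \<Sum>j\<in>UNIV. (a x $ i * b x $ j) *\<^sub>R dd (\<lambda>y. B y (?e i) (?e j)) (F x) (F' h)
         + (a x $ i * b' h $ j + a' h $ i * b x $ j) *\<^sub>R B (F x) (?e i) (?e j))
      = dd (\<lambda>y. B y (a x) (b x)) (F x) (F' h) + B (F x) (a' h) (b x) + B (F x) (a x) (b' h)" for h
    unfolding dexp[of "a x"] expand[OF Fx, of "a' h"] expand[OF Fx, of "a x"]
    by (simp add: sum.distrib scaleR_add_left)
  ultimately have "((\<lambda>y. \<Sum>i\<in>UNIV. \<Sum>j\<in>UNIV. (a y $ i * b y $ j) *\<^sub>R B (F y) (?e i) (?e j)) has_derivative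
      (\<lambda>h. dd (\<lambda>y. B y (a x) (b x)) (F x) (F' h) + B (F x) (a' h) (b x) + B (F x) (a x) (b' h))) (at x)"
    by (rule has_derivative_eq_rhs[OF _ ext])
  then show ?thesis
    by (rule has_derivative_transform_within_open[OF _ S(1,2)]) (use expand S(3) in auto)
qed

text \<open>Differentiates a derivative whose base point and direction both move. It serves for
  tangent fields along the immersion and for the transformation law of the normal.\<close>

lemma has_derivative_dd_apply:
  fixes \<tau> :: "real^'n \<Rightarrow> 'b::real_normed_vector" and F :: "'a::real_normed_vector \<Rightarrow> real^'n"
  assumes W: "open W" and \<tau>: "Ck_on (Suc (Suc k)) \<tau> W"
    and S: "open S" "x \<in> S" "F ` S \<subseteq> W"
    and F: "(F has_derivative F') (at x)" and a: "(a has_derivative a') (at x)"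
  shows "((\<lambda>y. dd \<tau> (F y) (a y)) has_derivative
    (\<lambda>h. dd (\<lambda>z. dd \<tau> z (a x)) (F x) (F' h) + dd \<tau> (F x) (a' h))) (at x)"
proof -
  let ?e = "\<lambda>i. axis i 1 :: real^'n"
  have Fx: "F x \<in> W" using S by auto
  have lin: "linear (dd \<tau> z)" if "z \<in> W" for z
    by (rule has_derivative_linear[OF Ck_on_has_derivative[OF \<tau> W that]])
  have dd2: "((\<lambda>z. dd \<tau> z v) has_derivative dd (\<lambda>z. dd \<tau> z v) (F x)) (at (F x))" for v
    by (rule Ck_on_has_derivative[OF Ck_on_Suc_dd[OF \<tau>] W Fx])
  have expand: "dd \<tau> z v = (\<Sum>i\<in>UNIV. (v $ i) *\<^sub>R dd \<tau> z (?e i))" if "z \<in> W" for z v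
    by (rule linear_functional_vec[OF lin[OF that]])
  have expand2: "dd (\<lambda>z. dd \<tau> z v) (F x) h = (\<Sum>i\<in>UNIV. (v $ i) *\<^sub>R dd (\<lambda>z. dd \<tau> z (?e i)) (F x) h)" for v h
  proof -
    have "dd (\<lambda>z. dd \<tau> z v) (F x) = dd (\<lambda>z. \<Sum>i\<in>UNIV. (v $ i) *\<^sub>R dd \<tau> z (?e i)) (F x)"
      by (rule dd_cong[OF W Fx]) (rule expand)
    also have "\<dots> = (\<lambda>h. \<Sum>i\<in>UNIV. (v $ i) *\<^sub>R dd (\<lambda>z. dd \<tau> z (?e i)) (F x) h)"
      by (rule dd_eqI) (intro has_derivative_sum has_derivative_scaleR_right dd2)
    finally show ?thesis by simp
  qed
  have ai: "((\<lambda>y. a y $ i) has_derivative (\<lambda>h. a' h $ i)) (at x)" for i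
    by (rule bounded_linear.has_derivative[OF bounded_linear_vec_nth a])
  have "((\<lambda>y. \<Sum>i\<in>UNIV. (a y $ i) *\<^sub>R dd \<tau> (F y) (?e i)) has_derivative
     (\<lambda>h. \<Sum>i\<in>UNIV. (a x $ i) *\<^sub>R dd (\<lambda>z. dd \<tau> z (?e i)) (F x) (F' h) + (a' h $ i) *\<^sub>R dd \<tau> (F x) (?e i))) (at x)"
    by (intro has_derivative_sum has_derivative_scaleR ai has_derivative_compose[OF F dd2])
  moreover have "(\<Sum>i\<in>UNIV. (a x $ i) *\<^sub>R dd (\<lambda>z. dd \<tau> z (?e i)) (F x) (F' h) + (a' h $ i) *\<^sub>R dd \<tau> (F x) (?e i))
     = dd (\<lambda>z. dd \<tau> z (a x)) (F x) (F' h) + dd \<tau> (F x) (a' h)" for h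
    unfolding expand2[of "a x"] expand[OF Fx, of "a' h"] by (rule sum.distrib)
  ultimately have "((\<lambda>y. \<Sum>i\<in>UNIV. (a y $ i) *\<^sub>R dd \<tau> (F y) (?e i)) has_derivative
     (\<lambda>h. dd (\<lambda>z. dd \<tau> z (a x)) (F x) (F' h) + dd \<tau> (F x) (a' h))) (at x)"
    by (rule has_derivative_eq_rhs[OF _ ext])
  then show ?thesis
    by (rule has_derivative_transform_within_open[OF _ S(1,2)]) (use expand S(3) in auto)
qed

section \<open>Metrics on open sets: Koszul formula and Christoffel maps\<close>

locale metric_field =
  fixes V :: "(real^'n) set" and G :: "real^'n \<Rightarrow> real^'n^'n"
  assumes open_V: "open V"
    and smooth_G: "\<And>k. Ck_on k G V"
    and sym_G: "\<And>x. x \<in> V \<Longrightarrow> transpose (G x) = G x"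
    and inv_G: "\<And>x. x \<in> V \<Longrightarrow> invertible (G x)"
begin

lemma G_has_derivative: "x \<in> V \<Longrightarrow> (G has_derivative dd G x) (at x)"
  by (rule Ck_on_has_derivative[OF smooth_G open_V])

lemma dd_G_linear: "x \<in> V \<Longrightarrow> linear (dd G x)"
  by (rule has_derivative_linear[OF G_has_derivative])

lemma dd_ip_const: "x \<in> V \<Longrightarrow> dd (\<lambda>y. ip (G y) v w) x u = ip (dd G x u) v w"
  using dd_eqI[OF has_derivative_ip[OF G_has_derivative has_derivative_const has_derivative_const], of x v w]
  by (simp add: ip_linear_simps)

lemma dd_G_sym:
  assumes "x \<in> V"
  shows "ip (dd G x u) v w = ip (dd G x u) w v"
proof -
  have "dd (\<lambda>y. ip (G y) v w) x = dd (\<lambda>y. ip (G y) w v) x"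
    by (rule dd_cong[OF open_V assms]) (rule ip_commute[OF sym_G])
  then show ?thesis using dd_ip_const[OF assms] by metis
qed

text \<open>The Koszul formula on constant fields, where the bracket terms vanish; the connection is
  obtained by raising its last slot.\<close>

definition koszul :: "real^'n \<Rightarrow> real^'n \<Rightarrow> real^'n \<Rightarrow> real^'n \<Rightarrow> real" where
  "koszul x u v w = (ip (dd G x u) v w + ip (dd G x v) u w - ip (dd G x w) u v) / 2"

lemma form_linear_simps:
  assumes "x \<in> V"
  shows "ip (dd G x (a + b)) u v = ip (dd G x a) u v + ip (dd G x b) u v"
    "ip (dd G x (c *\<^sub>R a)) u v = c * ip (dd G x a) u v"
  using linear_add[OF dd_G_linear[OF assms]] linear_scale[OF dd_G_linear[OF assms]]
  by (simp_all add: ip_def matrix_vector_mult_add_rdistrib inner_add_right scaleR_matrix_vector_assoc[symmetric])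

text \<open>Unfolds the \<open>THE\<close> of \<open>levi_civita\<close>. Existence comes from
  raising the Koszul form; for uniqueness, symmetry and compatibility determine all pairings with
  \<open>w\<close>, and the form is nondegenerate.\<close>

lemma levi_civita_properties:
  assumes x: "x \<in> V"
  shows "ip (G x) (levi_civita G x u v) w = koszul x u v w"
    and "levi_civita G x u v = raise (G x) (koszul x u v)"
    and "bilinear (levi_civita G x)"
    and "levi_civita G x u v = levi_civita G x v u"
    and "ip (dd G x u) v w = ip (G x) (levi_civita G x u v) w + ip (G x) v (levi_civita G x u w)"
proof -
  define \<Gamma> where "\<Gamma> u v = raise (G x) (koszul x u v)" for u v
  have lin: "linear (koszul x u v)" for u v
    unfolding koszul_def[abs_def]
    by (rule linearI) (simp_all add: form_linear_simps[OF x] ip_linear_simps algebra_simps add_divide_distrib diff_divide_distrib)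
  have k: "ip (G x) (\<Gamma> u v) w = koszul x u v w" for u v w
    unfolding \<Gamma>_def by (rule ip_raise[OF inv_G[OF x] sym_G[OF x] lin])
  note eqI = ip_eq_iff[OF inv_G[OF x] sym_G[OF x]]
  have bil: "bilinear \<Gamma>"
    unfolding bilinear_def
    by (intro conjI allI linearI; rule eqI;
        simp add: k koszul_def form_linear_simps[OF x] ip_linear_simps algebra_simps add_divide_distrib diff_divide_distrib)
  have sym: "\<Gamma> u v = \<Gamma> v u" for u v
    by (rule eqI) (simp add: k koszul_def dd_G_sym[OF x, of _ u v])
  have compat: "ip (dd G x u) v w = ip (G x) (\<Gamma> u v) w + ip (G x) v (\<Gamma> u w)" for u v w
    unfolding ip_commute[OF sym_G[OF x], of v] k
    by (simp add: koszul_def dd_G_sym[OF x, of _ w] field_simps)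
  have eq: "levi_civita G x = \<Gamma>"
    unfolding levi_civita_def
  proof (rule the_equality)
    show "bilinear \<Gamma> \<and> (\<forall>u v. \<Gamma> u v = \<Gamma> v u) \<and> (\<forall>u v w. dd (\<lambda>y. ip (G y) v w) x u = ip (G x) (\<Gamma> u v) w + ip (G x) v (\<Gamma> u w))"
      using bil sym compat dd_ip_const[OF x] by auto
  next
    fix \<Gamma>' assume a: "bilinear \<Gamma>' \<and> (\<forall>u v. \<Gamma>' u v = \<Gamma>' v u) \<and> (\<forall>u v w. dd (\<lambda>y. ip (G y) v w) x u = ip (G x) (\<Gamma>' u v) w + ip (G x) v (\<Gamma>' u w))"
    then have s: "\<Gamma>' u v = \<Gamma>' v u" and c: "ip (dd G x u) v w = ip (G x) (\<Gamma>' u v) w + ip (G x) v (\<Gamma>' u w)" for u v w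
      using dd_ip_const[OF x] by auto
    show "\<Gamma>' = \<Gamma>"
    proof (intro ext eqI)
      fix u v w
      \<comment> \<open>The compatibility relation in directions \<open>u\<close> and
        \<open>v\<close>, minus that in direction \<open>w\<close>: by symmetry all terms cancel
        except two equal ones.\<close>
      have "2 * ip (G x) (\<Gamma>' u v) w = ip (dd G x u) v w + ip (dd G x v) u w - ip (dd G x w) u v"
        unfolding c s[of v u] s[of w u] s[of w v]
        by (simp add: ip_commute[OF sym_G[OF x], of v] ip_commute[OF sym_G[OF x], of u])
      then show "ip (G x) (\<Gamma>' u v) w = ip (G x) (\<Gamma> u v) w"
        by (simp add: k koszul_def)
    qed
  qed
  show "ip (G x) (levi_civita G x u v) w = koszul x u v w"
    and "levi_civita G x u v = raise (G x) (koszul x u v)"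
    and "bilinear (levi_civita G x)"
    and "levi_civita G x u v = levi_civita G x v u"
    and "ip (dd G x u) v w = ip (G x) (levi_civita G x u v) w + ip (G x) v (levi_civita G x u w)"
    unfolding eq using k bil sym compat by (auto simp: \<Gamma>_def)
qed

lemmas levi_civita_bilinear = levi_civita_properties(3)
lemmas levi_civita_sym = levi_civita_properties(4)
lemmas levi_civita_metric = levi_civita_properties(5)

lemmas levi_civita_add = bilinear_ladd[OF levi_civita_bilinear] bilinear_radd[OF levi_civita_bilinear]
lemmas levi_civita_scaleR = bilinear_lmul[OF levi_civita_bilinear] bilinear_rmul[OF levi_civita_bilinear]

text \<open>The uniqueness argument in a form that recognizes the connection from a candidate, such
  as one pulled back through a change of charts.\<close>

lemma levi_civitaI:
  assumes x: "x \<in> V" and sym: "\<And>u v. \<Gamma> u v = \<Gamma> v u"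
    and c: "\<And>u v w. ip (dd G x u) v w = ip (G x) (\<Gamma> u v) w + ip (G x) v (\<Gamma> u w)"
  shows "levi_civita G x u v = \<Gamma> u v"
proof (rule ip_eq_iff[OF inv_G[OF x] sym_G[OF x]])
  fix w
  have "2 * ip (G x) (\<Gamma> u v) w = ip (dd G x u) v w + ip (dd G x v) u w - ip (dd G x w) u v"
    unfolding c sym[of v u] sym[of w u] sym[of w v]
    by (simp add: ip_commute[OF sym_G[OF x], of v] ip_commute[OF sym_G[OF x], of u])
  then show "ip (G x) (levi_civita G x u v) w = ip (G x) (\<Gamma> u v) w"
    by (simp add: levi_civita_properties(1)[OF x] koszul_def)
qed

lemma smooth_levi_civita: "Ck_on k (\<lambda>x. levi_civita G x u v) V"
proof -
  have dG: "Ck_on k (\<lambda>x. dd G x u) V" for u by (rule Ck_on_Suc_dd[OF smooth_G])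
  have "Ck_on k (\<lambda>x. matrix_inv (G x) *v (\<chi> i. koszul x u v (axis i 1))) V"
  proof (rule Ck_on_solve[OF open_V smooth_G _ inv_G])
    show "Ck_on k (\<lambda>x. \<chi> i. koszul x u v (axis i 1)) V"
    proof (rule Ck_on_vec[OF open_V])
      show "Ck_on k (\<lambda>x. (\<chi> i. koszul x u v (axis i 1)) $ i) V" for i
        unfolding koszul_def vec_lambda_beta
        by (intro Ck_on_divide Ck_on_diff Ck_on_add Ck_on_ip Ck_on_const dG open_V) simp
    qed
  qed
  then show ?thesis
    by (subst Ck_on_cong[OF open_V]) (auto simp: levi_civita_properties(2) raise_def)
qed

lemma levi_civita_has_derivative:
  "x \<in> V \<Longrightarrow> ((\<lambda>y. levi_civita G y u v) has_derivative dd (\<lambda>y. levi_civita G y u v) x) (at x)"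
  by (rule Ck_on_has_derivative[OF smooth_levi_civita open_V])

lemma curvature_eq:
  "curvature G x u v w = dd (\<lambda>y. levi_civita G y v w) x u + levi_civita G x u (levi_civita G x v w)
     - (dd (\<lambda>y. levi_civita G y u w) x v + levi_civita G x v (levi_civita G x u w))"
  by (simp add: curvature_def cov_deriv_def[abs_def])

end

text \<open>The source dimension is free: \<open>F\<close> is the immersion, but also the identity
  in \<open>curvature_metric_skew\<close> and a transition map in
  \<open>levi_civita_transform\<close>.\<close>

locale metric_map = metric_field V G for V :: "(real^'n) set" and G +
  fixes U :: "(real^'m) set" and F :: "real^'m \<Rightarrow> real^'n"
  assumes open_U: "open U" and smooth_F: "\<And>k. Ck_on k F U" and F_into: "F ` U \<subseteq> V"
begin

lemma F_in: "x \<in> U \<Longrightarrow> F x \<in> V" using F_into by auto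

lemma F_has_derivative: "x \<in> U \<Longrightarrow> (F has_derivative dd F x) (at x)"
  by (rule Ck_on_has_derivative[OF smooth_F open_U])

lemma dd_F_has_derivative: "x \<in> U \<Longrightarrow> ((\<lambda>y. dd F y v) has_derivative dd (\<lambda>y. dd F y v) x) (at x)"
  by (rule Ck_on_has_derivative[OF Ck_on_Suc_dd[OF smooth_F] open_U])

text \<open>The pulled-back Levi-Civita connection.\<close>

definition P :: "(real^'m \<Rightarrow> real^'n) \<Rightarrow> real^'m \<Rightarrow> real^'m \<Rightarrow> real^'n" where
  "P W x u = dd W x u + levi_civita G (F x) (dd F x u) (W x)"

lemma smooth_GF: "Ck_on k (\<lambda>x. G (F x)) U"
  by (rule Ck_on_compose[OF open_U open_V F_into smooth_F smooth_G])

lemma Ck_on_levi_civita_F: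
  assumes "Ck_on k a U" "Ck_on k b U"
  shows "Ck_on k (\<lambda>x. levi_civita G (F x) (a x) (b x)) U"
proof -
  let ?e = "\<lambda>i. axis i 1 :: real^'n"
  have "levi_civita G (F x) (a x) (b x) = (\<Sum>i\<in>UNIV. (a x $ i) *\<^sub>R (\<Sum>j\<in>UNIV. (b x $ j) *\<^sub>R levi_civita G (F x) (?e i) (?e j)))"
    if "x \<in> U" for x
  proof -
    have l: "linear (\<lambda>u. levi_civita G (F x) u v)" and r: "linear (levi_civita G (F x) u)" for u v
      using levi_civita_bilinear[OF F_in[OF that]] by (auto simp: bilinear_def)
    have "levi_civita G (F x) (a x) (b x) = (\<Sum>i\<in>UNIV. (a x $ i) *\<^sub>R levi_civita G (F x) (?e i) (b x))"
      by (rule linear_functional_vec[OF l])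
    also have "\<dots> = (\<Sum>i\<in>UNIV. (a x $ i) *\<^sub>R (\<Sum>j\<in>UNIV. (b x $ j) *\<^sub>R levi_civita G (F x) (?e i) (?e j)))"
      by (intro sum.cong refl arg_cong[where f = "(*\<^sub>R) _"] linear_functional_vec[OF r])
    finally show ?thesis .
  qed
  moreover have "Ck_on k (\<lambda>x. \<Sum>i\<in>UNIV. (a x $ i) *\<^sub>R (\<Sum>j\<in>UNIV. (b x $ j) *\<^sub>R levi_civita G (F x) (?e i) (?e j))) U"
    by (intro Ck_on_sum Ck_on_scaleR Ck_on_nth open_U assms
        Ck_on_compose[OF open_U open_V F_into smooth_F smooth_levi_civita])
  ultimately show ?thesis by (subst Ck_on_cong[OF open_U])
qed

lemma Ck_on_P: "Ck_on (Suc k) W U \<Longrightarrow> Ck_on k (\<lambda>x. P W x u) U"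
  unfolding P_def by (intro Ck_on_add open_U Ck_on_Suc_dd Ck_on_levi_civita_F smooth_F) (assumption, erule Ck_on_SucD)

lemma dd_ip_P:
  assumes x: "x \<in> U" and W: "(W has_derivative dd W x) (at x)" and Z: "(Z has_derivative dd Z x) (at x)"
  shows "dd (\<lambda>x. ip (G (F x)) (W x) (Z x)) x u = ip (G (F x)) (P W x u) (Z x) + ip (G (F x)) (W x) (P Z x u)"
proof -
  have "((\<lambda>x. G (F x)) has_derivative (\<lambda>h. dd G (F x) (dd F x h))) (at x)"
    by (rule has_derivative_compose[OF F_has_derivative[OF x] G_has_derivative[OF F_in[OF x]]])
  from dd_eqI[OF has_derivative_ip[OF this W Z]] show ?thesis
    by (simp add: P_def ip_linear_simps levi_civita_metric[OF F_in[OF x]])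
qed

lemma P_dd_F_sym: "x \<in> U \<Longrightarrow> P (\<lambda>y. dd F y v) x u = P (\<lambda>y. dd F y u) x v"
  unfolding P_def
  by (simp add: second_derivative_symmetric[OF open_U smooth_F] levi_civita_sym[OF F_in])

text \<open>Antisymmetrizing in \<open>u\<close> and \<open>v\<close> kills the second derivatives
  of \<open>W\<close> and \<open>F\<close> and the terms with one derivative of \<open>W\<close>;
  what remains is \<open>curvature_eq\<close> at the pushed-forward vectors.\<close>

lemma P_commutator:
  assumes x: "x \<in> U" and W: "Ck_on (Suc (Suc 0)) W U"
  shows "P (\<lambda>y. P W y v) x u - P (\<lambda>y. P W y u) x v = curvature G (F x) (dd F x u) (dd F x v) (W x)"
proof -
  let ?L = "levi_civita G (F x)"
  have dW: "(W has_derivative dd W x) (at x)" "((\<lambda>y. dd W y v) has_derivative dd (\<lambda>y. dd W y v) x) (at x)" for v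
    using Ck_on_has_derivative[OF W open_U x] Ck_on_has_derivative[OF Ck_on_Suc_dd[OF W] open_U x] by auto
  have d: "dd (\<lambda>y. P W y v) x u = dd (\<lambda>y. dd W y v) x u
      + (dd (\<lambda>y. levi_civita G y (dd F x v) (W x)) (F x) (dd F x u)
         + ?L (dd (\<lambda>y. dd F y v) x u) (W x) + ?L (dd F x v) (dd W x u))" for u v
    unfolding P_def
    by (rule fun_cong[OF dd_eqI, THEN trans],
        rule has_derivative_add[OF dW(2) has_derivative_bilinear_family[OF open_V levi_civita_bilinear
           levi_civita_has_derivative[OF F_in[OF x]] open_U x F_into F_has_derivative[OF x] dd_F_has_derivative[OF x] dW(1)]])
      auto
  show ?thesis
    unfolding P_def[of "\<lambda>y. P W y v"] P_def[of "\<lambda>y. P W y u"] d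
    by (simp add: curvature_eq P_def levi_civita_add[OF F_in[OF x]]
        second_derivative_symmetric[OF open_U smooth_F x, of u v] second_derivative_symmetric[OF open_U W x, of u v])
qed

end

section \<open>Curvature\<close>

text \<open>Four instances of the Bianchi identity give the pair symmetry. With it, polarizing
  \<open>sect\<close> in the outer slots and then in the inner ones makes the form alternate in its
  first three slots, and Bianchi becomes 3A = 0.\<close>

lemma curvature_form_zero:
  fixes A :: "'v::ab_group_add \<Rightarrow> 'v \<Rightarrow> 'v \<Rightarrow> 'v \<Rightarrow> real"
  assumes add1: "\<And>a b v w z. A (a + b) v w z = A a v w z + A b v w z"
    and add2: "\<And>u a b w z. A u (a + b) w z = A u a w z + A u b w z"
    and add3: "\<And>u v a b z. A u v (a + b) z = A u v a z + A u v b z"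
    and add4: "\<And>u v w a b. A u v w (a + b) = A u v w a + A u v w b"
    and skew1: "\<And>u v w z. A u v w z = - A v u w z"
    and skew2: "\<And>u v w z. A u v w z = - A u v z w"
    and bianchi: "\<And>u v w z. A u v w z + A v w u z + A w u v z = 0"
    and sect: "\<And>u v. A u v v u = 0"
  shows "A u v w z = 0"
proof -
  have pair: "A u v w z = A w z u v" for u v w z
    using bianchi[of u v w z] bianchi[of v w z u] bianchi[of w z u v] bianchi[of z u v w]
      skew1[of u v w z] skew1[of v w u z] skew1[of w u v z] skew1[of z u v w] skew1[of u v z w] skew1[of w z u v]
      skew1[of v w z u] skew1[of w z v u] skew1[of z v w u] skew1[of z u w v] skew1[of u w z v] skew1[of u w v z]
      skew2[of u v w z] skew2[of v w u z] skew2[of w u v z] skew2[of z u v w] skew2[of w z u v] skew2[of z v w u]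
      skew2[of u w z v] skew2[of z v u w] skew1[of z v u w]
    by linarith
  have 1: "A u v v z = 0" for u v z
  proof -
    have "A u v v z + A z v v u = 0"
      using add1[of u z v v "u + z"] add4[of u v v u z] add4[of z v v u z]
        sect[of u v] sect[of z v] sect[of "u + z" v] by linarith
    moreover have "A z v v u = A u v v z"
      using pair[of z v v u] skew1[of v u z v] skew2[of u v z v] by linarith
    ultimately show ?thesis by simp
  qed
  have 2: "A u v w z = - A u w v z" for u v w z
    using 1[of u "v + w" z] add2[of u v w "v + w" z] add3[of u v v w z] add3[of u w v w z] 1[of u v z] 1[of u w z]
    by linarith
  show ?thesis
    using bianchi[of u v w z] skew1[of v w u z] 2[of v w u z] skew1[of v u w z] 2[of w u v z] skew1[of w v u z] 2[of u w v z] skew1[of w u v z]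
    by linarith
qed

text \<open>If all areas vanish, polarization gives
  \<open>ip Q u u * ip Q v w = ip Q u v * ip Q u w\<close>. A non-null \<open>u\<close> has a
  nonzero orthogonal \<open>v\<close>, as the dimension is at least 2, and \<open>v\<close> would be
  orthogonal to everything. If all vectors are null, vanishing area makes \<open>Q\<close>
  zero.\<close>

lemma plane_area_nonzero_exists:
  fixes Q :: "real^'n^'n"
  assumes inv: "invertible Q" and sym: "transpose Q = Q" and card: "2 \<le> CARD('n)"
  shows "\<exists>u v. plane_area Q u v \<noteq> 0"
proof (rule ccontr)
  assume "\<not> ?thesis"
  then have area: "ip Q u u * ip Q v v = (ip Q u v)\<^sup>2" for u v
    by (simp add: plane_area_def)
  have pol: "ip Q u u * ip Q v w = ip Q u v * ip Q u w" for u v w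
    using area[of u "v + w"] area[of u v] area[of u w]
    by (simp add: ip_linear_simps ip_commute[OF sym, of w v] power2_eq_square algebra_simps)
  have "ip Q u u = 0" for u
  proof (rule ccontr)
    assume u: "ip Q u u \<noteq> 0"
    have "dim {v. v \<bullet> (Q *v u) = 0} \<ge> CARD('n) - 1"
      using dim_hyperplane[of "Q *v u"] by (cases "Q *v u = 0") (auto simp: inner_commute)
    moreover have "dim {v. v \<bullet> (Q *v u) = 0} = 0" if "{v. v \<bullet> (Q *v u) = 0} \<subseteq> {0}"
      using that by (simp only: dim_eq_0)
    ultimately have "\<not> {v. v \<bullet> (Q *v u) = 0} \<subseteq> {0}"
      using card by force
    then obtain v where v: "v \<noteq> 0" "v \<bullet> (Q *v u) = 0" by auto
    then have "ip Q u v = 0" by (simp add: ip_commute[OF sym, of u]) (simp add: ip_def)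
    then have "ip Q v w = 0" for w using pol[of u v w] u by simp
    then show False using ip_nondegenerate[OF inv sym] v by blast
  qed
  then have "ip Q u v = 0" for u v using area[of u v] by simp
  then have "axis undefined 1 = (0 :: real^'n)"
    using ip_nondegenerate[OF inv sym] by blast
  then show False by (simp add: axis_eq_0_iff)
qed

text \<open>Along the line the area is a quartic polynomial in \<open>t\<close> with leading
  coefficient \<open>plane_area Q u0 v0\<close>, so it has finitely many zeros.\<close>

lemma plane_area_zeros_isolated:
  fixes Q :: "real^'n^'n"
  assumes "plane_area Q u0 v0 \<noteq> 0"
  shows "\<forall>\<^sub>F t in at 0. plane_area Q (u + t *\<^sub>R u0) (v + t *\<^sub>R v0) \<noteq> 0"
proof -
  let ?i = "ip Q"
  define A where "A = [:?i u u, ?i u u0 + ?i u0 u, ?i u0 u0:]"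
  define B where "B = [:?i v v, ?i v v0 + ?i v0 v, ?i v0 v0:]"
  define C where "C = [:?i u v, ?i u v0 + ?i u0 v, ?i u0 v0:]"
  have p: "poly (A * B - C * C) t = plane_area Q (u + t *\<^sub>R u0) (v + t *\<^sub>R v0)" for t
  proof -
    have "poly A t = ?i (u + t *\<^sub>R u0) (u + t *\<^sub>R u0)" "poly B t = ?i (v + t *\<^sub>R v0) (v + t *\<^sub>R v0)"
      "poly C t = ?i (u + t *\<^sub>R u0) (v + t *\<^sub>R v0)"
      by (simp_all add: A_def B_def C_def ip_linear_simps algebra_simps)
    then show ?thesis by (simp add: plane_area_def power2_eq_square)
  qed
  have "coeff (A * B - C * C) 4 = plane_area Q u0 v0"
    by (simp add: A_def B_def C_def coeff_mult plane_area_def power2_eq_square numeral_eq_Suc)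
  then have "A * B - C * C \<noteq> 0" using assms by force
  then have "finite {t. poly (A * B - C * C) t = 0}" by (rule poly_roots_finite)
  then have "\<not> 0 islimpt {t. poly (A * B - C * C) t = 0}" by (rule islimpt_finite)
  then show ?thesis by (simp only: islimpt_iff_eventually mem_Collect_eq not_not p)
qed

context metric_field
begin

lemma dd_levi_civita_linear:
  assumes x: "x \<in> V"
  shows "dd (\<lambda>y. levi_civita G y (a + b) w) x u = dd (\<lambda>y. levi_civita G y a w) x u + dd (\<lambda>y. levi_civita G y b w) x u"
    and "dd (\<lambda>y. levi_civita G y w (a + b)) x u = dd (\<lambda>y. levi_civita G y w a) x u + dd (\<lambda>y. levi_civita G y w b) x u"
    and "dd (\<lambda>y. levi_civita G y (c *\<^sub>R a) w) x u = c *\<^sub>R dd (\<lambda>y. levi_civita G y a w) x u"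
    and "dd (\<lambda>y. levi_civita G y w (c *\<^sub>R a)) x u = c *\<^sub>R dd (\<lambda>y. levi_civita G y w a) x u"
    and "dd (\<lambda>y. levi_civita G y w z) x (a + b) = dd (\<lambda>y. levi_civita G y w z) x a + dd (\<lambda>y. levi_civita G y w z) x b"
    and "dd (\<lambda>y. levi_civita G y w z) x (c *\<^sub>R a) = c *\<^sub>R dd (\<lambda>y. levi_civita G y w z) x a"
proof -
  note d = levi_civita_has_derivative[OF x]
  have "dd (\<lambda>y. levi_civita G y (a + b) w) x = dd (\<lambda>y. levi_civita G y a w + levi_civita G y b w) x"
    by (rule dd_cong[OF open_V x]) (rule levi_civita_add)
  then show "dd (\<lambda>y. levi_civita G y (a + b) w) x u = dd (\<lambda>y. levi_civita G y a w) x u + dd (\<lambda>y. levi_civita G y b w) x u"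
    using dd_eqI[OF has_derivative_add[OF d d]] by simp
  have "dd (\<lambda>y. levi_civita G y w (a + b)) x = dd (\<lambda>y. levi_civita G y w a + levi_civita G y w b) x"
    by (rule dd_cong[OF open_V x]) (rule levi_civita_add)
  then show "dd (\<lambda>y. levi_civita G y w (a + b)) x u = dd (\<lambda>y. levi_civita G y w a) x u + dd (\<lambda>y. levi_civita G y w b) x u"
    using dd_eqI[OF has_derivative_add[OF d d]] by simp
  have "dd (\<lambda>y. levi_civita G y (c *\<^sub>R a) w) x = dd (\<lambda>y. c *\<^sub>R levi_civita G y a w) x"
    by (rule dd_cong[OF open_V x]) (rule levi_civita_scaleR)
  then show "dd (\<lambda>y. levi_civita G y (c *\<^sub>R a) w) x u = c *\<^sub>R dd (\<lambda>y. levi_civita G y a w) x u"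
    using dd_eqI[OF has_derivative_scaleR_right[OF d]] by simp
  have "dd (\<lambda>y. levi_civita G y w (c *\<^sub>R a)) x = dd (\<lambda>y. c *\<^sub>R levi_civita G y w a) x"
    by (rule dd_cong[OF open_V x]) (rule levi_civita_scaleR)
  then show "dd (\<lambda>y. levi_civita G y w (c *\<^sub>R a)) x u = c *\<^sub>R dd (\<lambda>y. levi_civita G y w a) x u"
    using dd_eqI[OF has_derivative_scaleR_right[OF d]] by simp
  show "dd (\<lambda>y. levi_civita G y w z) x (a + b) = dd (\<lambda>y. levi_civita G y w z) x a + dd (\<lambda>y. levi_civita G y w z) x b"
    and "dd (\<lambda>y. levi_civita G y w z) x (c *\<^sub>R a) = c *\<^sub>R dd (\<lambda>y. levi_civita G y w z) x a"
    by (rule linear_add[OF has_derivative_linear[OF d]], rule linear_scale[OF has_derivative_linear[OF d]])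
qed

lemma dd_levi_civita_sym:
  "x \<in> V \<Longrightarrow> dd (\<lambda>y. levi_civita G y v w) x = dd (\<lambda>y. levi_civita G y w v) x"
  by (rule dd_cong[OF open_V]) (auto intro: levi_civita_sym)

lemma curvature_linear_simps:
  assumes "x \<in> V"
  shows "curvature G x (a + b) v w = curvature G x a v w + curvature G x b v w"
    and "curvature G x u (a + b) w = curvature G x u a w + curvature G x u b w"
    and "curvature G x u v (a + b) = curvature G x u v a + curvature G x u v b"
    and "curvature G x (c *\<^sub>R a) v w = c *\<^sub>R curvature G x a v w"
    and "curvature G x u (c *\<^sub>R a) w = c *\<^sub>R curvature G x u a w"
    and "curvature G x u v (c *\<^sub>R a) = c *\<^sub>R curvature G x u v a"
  by (simp_all add: curvature_eq dd_levi_civita_linear[OF assms] levi_civita_add[OF assms]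
      levi_civita_scaleR[OF assms] scaleR_add_right scaleR_diff_right)

lemma curvature_antisym: "curvature G x u v w = - curvature G x v u w"
  by (simp add: curvature_eq)

lemma curvature_bianchi:
  assumes x: "x \<in> V"
  shows "curvature G x u v w + curvature G x v w u + curvature G x w u v = 0"
  by (simp add: curvature_eq dd_levi_civita_sym[OF x, of v w] dd_levi_civita_sym[OF x, of w u]
      dd_levi_civita_sym[OF x, of u v] levi_civita_sym[OF x, of v w] levi_civita_sym[OF x, of w u]
      levi_civita_sym[OF x, of u v])

text \<open>The second derivatives of \<open>ip (G y) w w\<close> commute, which says that R(u,v)w
  is orthogonal to \<open>w\<close>; the claim is the polarization. The identity as a
  \<open>metric_map\<close> makes \<open>P\<close> the covariant derivative on \<open>V\<close>
  itself.\<close>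

lemma curvature_metric_skew:
  assumes x: "x \<in> V"
  shows "ip (G x) (curvature G x u v w) z = - ip (G x) (curvature G x u v z) w"
proof -
  interpret I: metric_map V G V "\<lambda>x. x"
    by unfold_locales (auto simp: open_V Ck_on_ident simp del: Ck_on.simps)
  have ddid: "dd (\<lambda>x. x) y = (\<lambda>h. h)" for y :: "real^'n" by (rule dd_eqI[OF has_derivative_ident])
  have quad: "ip (G x) (curvature G x u v w) w = 0" for w
  proof -
    let ?f = "\<lambda>y. ip (G y) w w"
    have Pd: "Ck_on k (\<lambda>y. I.P (\<lambda>_. w) y v) V" for k v by (rule I.Ck_on_P[OF Ck_on_const])
    have c: "((\<lambda>_. w) has_derivative dd (\<lambda>_. w) y) (at y)" for y :: "real^'n"
      by simp
    have pd: "((\<lambda>y. I.P (\<lambda>_. w) y v) has_derivative dd (\<lambda>y. I.P (\<lambda>_. w) y v) x) (at x)" for v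
      by (rule Ck_on_has_derivative[OF Pd open_V x])
    have 1: "dd ?f y v = 2 * ip (G y) (I.P (\<lambda>_. w) y v) w" if "y \<in> V" for y v
      using I.dd_ip_P[OF that c c, of v] by (simp add: ip_commute[OF sym_G[OF that], of w])
    have 2: "dd (\<lambda>y. dd ?f y v) x u = 2 * (ip (G x) (I.P (\<lambda>y. I.P (\<lambda>_. w) y v) x u) w
        + ip (G x) (I.P (\<lambda>_. w) x v) (I.P (\<lambda>_. w) x u))" for u v
    proof -
      have d: "((\<lambda>y. ip (G y) (I.P (\<lambda>_. w) y v) w) has_derivative dd (\<lambda>y. ip (G y) (I.P (\<lambda>_. w) y v) w) x) (at x)"
        by (rule Ck_on_has_derivative[OF Ck_on_ip[OF open_V smooth_G Pd Ck_on_const] open_V x])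
      have "dd (\<lambda>y. dd ?f y v) x = dd (\<lambda>y. 2 * ip (G y) (I.P (\<lambda>_. w) y v) w) x"
        by (rule dd_cong[OF open_V x]) (rule 1)
      then show ?thesis
        using dd_eqI[OF has_derivative_mult_right[OF d, of 2]] I.dd_ip_P[OF x pd c, of v u] by simp
    qed
    have "dd (\<lambda>y. dd ?f y v) x u = dd (\<lambda>y. dd ?f y u) x v"
      by (rule second_derivative_symmetric[OF open_V Ck_on_ip[OF open_V smooth_G Ck_on_const Ck_on_const] x])
    then have "ip (G x) (I.P (\<lambda>y. I.P (\<lambda>_. w) y v) x u - I.P (\<lambda>y. I.P (\<lambda>_. w) y u) x v) w = 0"
      by (simp add: 2 ip_linear_simps ip_commute[OF sym_G[OF x], of "I.P (\<lambda>_. w) x u"])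
    then show ?thesis
      using I.P_commutator[OF x Ck_on_const[of _ w], where u = u and v = v] by (simp add: ddid)
  qed
  have "ip (G x) (curvature G x u v (w + z)) (w + z) = 0" by (rule quad)
  then show ?thesis
    by (simp add: curvature_linear_simps[OF x] ip_linear_simps quad)
qed

text \<open>The hypothesis is silent about degenerate planes. These are limits of nondegenerate
  ones, and the defect \<open>A\<close> from the model tensor is continuous along the approach, so
  \<open>A\<close> vanishes on all planes and \<open>curvature_form_zero\<close> applies.\<close>

lemma constant_curvature_tensor:
  assumes x: "x \<in> V" and card: "2 \<le> CARD('n)"
    and sec: "\<And>u v. plane_area (G x) u v \<noteq> 0 \<Longrightarrow> sectional_curvature G x u v = \<kappa>"
  shows "curvature G x u v w = \<kappa> *\<^sub>R (ip (G x) v w *\<^sub>R u - ip (G x) u w *\<^sub>R v)"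
proof -
  let ?i = "ip (G x)"
  define A where "A u v w z = ?i (curvature G x u v w) z - \<kappa> * (?i v w * ?i u z - ?i u w * ?i v z)" for u v w z
  note comm = ip_commute[OF sym_G[OF x]]
  have sect0: "A u v v u = 0" if "plane_area (G x) u v \<noteq> 0" for u v
  proof -
    have "?i (curvature G x u v v) u = \<kappa> * plane_area (G x) u v"
      using sec[OF that] that by (simp add: sectional_curvature_def divide_eq_eq)
    then show ?thesis
      by (simp add: A_def plane_area_def power2_eq_square comm[of v u])
  qed
  have sect: "A u v v u = 0" for u v
  proof -
    obtain u0 v0 where uv: "plane_area (G x) u0 v0 \<noteq> 0"
      using plane_area_nonzero_exists[OF inv_G[OF x] sym_G[OF x] card] by blast
    \<comment> \<open>Moving \<open>u\<close> and \<open>v\<close> in the directions of a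
      nondegenerate pair leaves the zero set of the area for all small nonzero
      \<open>t\<close>.\<close>
    define q where "q t = A (u + t *\<^sub>R u0) (v + t *\<^sub>R v0) (v + t *\<^sub>R v0) (u + t *\<^sub>R u0)" for t
    have lin: "isCont (\<lambda>t. a + t *\<^sub>R b) 0" for a b :: "real^'n"
      by (intro isCont_add isCont_scaleR continuous_const continuous_ident)
    have ip: "isCont (\<lambda>t. ?i (a t) (b t)) 0" if "isCont a 0" "isCont b 0" for a b :: "real \<Rightarrow> real^'n"
      unfolding ip_def
      by (rule isCont_inner[OF that(1) isCont_o2[OF that(2) linear_continuous_at[OF matrix_vector_mul_bounded_linear]]])
    have R1: "isCont (\<lambda>t. curvature G x a b (v + t *\<^sub>R v0)) 0" for a b
      unfolding curvature_linear_simps(3,6)[OF x] by (rule lin)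
    have R2: "isCont (\<lambda>t. curvature G x a (v + t *\<^sub>R v0) (v + t *\<^sub>R v0)) 0" for a
      unfolding curvature_linear_simps(2,5)[OF x] by (intro isCont_add isCont_scaleR continuous_ident R1)
    have "isCont (\<lambda>t. curvature G x (u + t *\<^sub>R u0) (v + t *\<^sub>R v0) (v + t *\<^sub>R v0)) 0"
      unfolding curvature_linear_simps(1,4)[OF x] by (intro isCont_add isCont_scaleR continuous_ident R2)
    then have "isCont q 0"
      unfolding q_def[abs_def] A_def by (intro isCont_diff isCont_mult continuous_const ip lin)
    then have "(q \<longlongrightarrow> q 0) (at 0)" by (simp add: isCont_def)
    moreover have "\<forall>\<^sub>F t in at 0. q t = 0"
      using plane_area_zeros_isolated[OF uv, of u v] by (rule eventually_mono) (unfold q_def, rule sect0)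
    then have "(q \<longlongrightarrow> 0) (at 0)" by (rule tendsto_eventually)
    ultimately have "q 0 = 0" by (rule tendsto_unique[OF at_neq_bot])
    then show ?thesis by (simp add: q_def)
  qed
  have zero: "A u v w z = 0" for z
  proof (rule curvature_form_zero[of A])
    show "A u v w z = - A v u w z" for u v w z
      using curvature_antisym[of x u v w] by (simp add: A_def ip_linear_simps algebra_simps)
    show "A u v w z = - A u v z w" for u v w z
      using curvature_metric_skew[OF x, of u v w z] by (simp add: A_def algebra_simps)
    show "A u v w z + A v w u z + A w u v z = 0" for u v w z
    proof -
      have "?i (curvature G x u v w) z + ?i (curvature G x v w u) z + ?i (curvature G x w u v) z = 0"
        using arg_cong[OF curvature_bianchi[OF x, of u v w], of "\<lambda>y. ?i y z"] by (simp add: ip_linear_simps)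
      then show ?thesis by (simp add: A_def comm[of w v] comm[of w u] comm[of v u] algebra_simps)
    qed
    show "A u v v u = 0" for u v by (rule sect)
    show "A (a + b) v w z = A a v w z + A b v w z" "A v (a + b) w z = A v a w z + A v b w z"
      "A v w (a + b) z = A v w a z + A v w b z" "A v w z (a + b) = A v w z a + A v w z b" for a b v w z
      by (simp_all add: A_def curvature_linear_simps[OF x] ip_linear_simps distrib_left distrib_right right_diff_distrib)
  qed
  show ?thesis
  proof (rule ip_eq_iff[OF inv_G[OF x] sym_G[OF x]])
    fix z
    show "?i (curvature G x u v w) z = ?i (\<kappa> *\<^sub>R (?i v w *\<^sub>R u - ?i u w *\<^sub>R v)) z"
      using zero[of z] by (simp add: A_def ip_linear_simps)
  qed
qed

end

section \<open>Hypersurfaces in coordinates\<close>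

lemma trace_transpose: "trace (transpose A) = trace (A :: real^'n^'n)"
  by (simp add: trace_def transpose_def)

lemma trace_column_sum: "trace (A :: real^'n^'n) = (\<Sum>i\<in>UNIV. (A *v axis i 1) $ i)"
  by (simp add: trace_def matrix_vector_mult_basis column_def)

lemma matrix_eq_ipI:
  fixes A B :: "real^'n^'n"
  assumes "\<And>y z. ip A y z = ip B y z"
  shows "A = B"
proof -
  have "A *v z = B *v z" for z
    using assms[of _ z] unfolding ip_def by (metis vector_eq_rdot inner_commute)
  then show ?thesis by (simp add: matrix_eq)
qed

lemma ip_matrix_left: "ip (transpose A ** Q) y z = ip Q (A *v y) z"
  unfolding ip_def matrix_vector_mul_assoc[symmetric] inner_transpose_matrix ..

lemma ip_matrix_right: "ip (Q ** A) y z = ip Q y (A *v z)"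
  unfolding ip_def matrix_vector_mul_assoc[symmetric] ..

lemma newton_self_adjoint:
  fixes Q B :: "real^'m^'m"
  assumes "transpose B ** Q = Q ** B"
  shows "transpose (newton k B) ** Q = Q ** newton k B"
proof (induction k)
  case (Suc k)
  have "transpose (B ** newton k B) ** Q = transpose (newton k B) ** (transpose B ** Q)"
    by (simp add: matrix_transpose_mul matrix_mul_assoc)
  also have "\<dots> = (transpose (newton k B) ** Q) ** B"
    by (simp add: assms matrix_mul_assoc)
  also have "\<dots> = Q ** (B ** newton k B)"
    by (simp add: Suc newton_commute matrix_mul_assoc)
  finally have *: "transpose (B ** newton k B) ** Q = Q ** (B ** newton k B)" .
  have "transpose (newton (Suc k) B) = elem_sym (Suc k) B *\<^sub>R mat 1 - transpose (B ** newton k B)"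
    by (simp add: transpose_def vec_eq_iff mat_def)
  then show ?case
    using * by (simp add: matrix_ring_simps)
qed (simp add: transpose_mat)

text \<open>The \<open>Q\<close>-adjoint of \<open>T ** B\<close> is minus \<open>B ** T\<close>,
  and an adjoint is conjugate to the transpose, so the trace equals its own negative.\<close>

lemma trace_self_adjoint_skew:
  fixes Q T B :: "real^'m^'m"
  assumes Q: "invertible Q" and T: "transpose T ** Q = Q ** T" and B: "transpose B ** Q = - (Q ** B)"
  shows "trace (T ** B) = 0"
proof -
  obtain R where R: "Q ** R = mat 1" "R ** Q = mat 1"
    using Q by (auto simp: invertible_def)
  have "transpose (T ** B) ** Q = transpose B ** (transpose T ** Q)"
    by (simp add: matrix_transpose_mul matrix_mul_assoc)
  also have "\<dots> = (transpose B ** Q) ** T"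
    by (simp add: T matrix_mul_assoc)
  also have "\<dots> = - (Q ** (B ** T))"
    using matrix_ring_simps(5)[of "-1" "Q ** B" T] by (simp add: B matrix_mul_assoc)
  finally have "transpose (T ** B) ** Q ** R = - (Q ** (B ** T)) ** R" by simp
  then have "transpose (T ** B) = - (Q ** (B ** T)) ** R"
    by (simp add: matrix_mul_assoc[symmetric] R)
  also have "\<dots> = - (Q ** (B ** T ** R))"
    using matrix_ring_simps(5)[of "-1" "Q ** (B ** T)" R] by (simp add: matrix_mul_assoc)
  finally have "trace (transpose (T ** B)) = - trace (Q ** (B ** T ** R))"
    using trace_scaleR[of "-1" "Q ** (B ** T ** R)"] by simp
  also have "trace (Q ** (B ** T ** R)) = trace (B ** T)"
    by (subst trace_mul_sym) (simp add: matrix_mul_assoc[symmetric] R)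
  also have "trace (B ** T) = trace (T ** B)" by (rule trace_mul_sym)
  finally show ?thesis by (simp add: trace_transpose)
qed

lemma bounded_bilinear_matrix_matrix: "bounded_bilinear ((**) :: real^'n^'m \<Rightarrow> real^'l^'n \<Rightarrow> real^'l^'m)"
proof -
  have "bilinear ((**) :: real^'n^'m \<Rightarrow> real^'l^'n \<Rightarrow> real^'l^'m)"
    unfolding bilinear_def by (auto intro!: linearI simp: matrix_ring_simps)
  then show ?thesis by (simp add: bilinear_conv_bounded_bilinear)
qed

lemma matrix_linear_works: "linear \<phi> \<Longrightarrow> matrix \<phi> *v v = \<phi> (v :: real^'n)"
  by (simp add: matrix_works linear_matrix_vector_mul_eq)

section \<open>Gauss, Weingarten and Codazzi equations on a coordinate patch\<close>

locale hypersurface_patch = metric_map V G U F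
  for V :: "(real^'n) set" and G and U :: "(real^'m) set" and F +
  fixes g :: "real^'m \<Rightarrow> real^'m^'m" and N :: "real^'m \<Rightarrow> real^'n" and \<kappa> :: real
  assumes card: "CARD('m) + 1 = CARD('n)"
    and isometric: "\<And>x y z. x \<in> U \<Longrightarrow> ip (G (F x)) (dd F x y) (dd F x z) = ip (g x) y z"
    and smooth_g: "\<And>k. Ck_on k g U"
    and sym_g: "\<And>x. x \<in> U \<Longrightarrow> transpose (g x) = g x"
    and inv_g: "\<And>x. x \<in> U \<Longrightarrow> invertible (g x)"
    and smooth_N: "\<And>k. Ck_on k N U"
    and N_orth: "\<And>x y. x \<in> U \<Longrightarrow> ip (G (F x)) (N x) (dd F x y) = 0"
    and N_unit: "\<And>x. x \<in> U \<Longrightarrow> \<bar>ip (G (F x)) (N x) (N x)\<bar> = 1"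
    and curv: "\<And>z u v w. z \<in> V \<Longrightarrow> curvature G z u v w = \<kappa> *\<^sub>R (ip (G z) v w *\<^sub>R u - ip (G z) u w *\<^sub>R v)"
begin

abbreviation GF :: "real^'m \<Rightarrow> real^'n \<Rightarrow> real^'n \<Rightarrow> real" where
  "GF x \<equiv> ip (G (F x))"

text \<open>The sign of the normal, 1 or -1, kept as a function whose derivative vanishes by
  \<open>dd_\<epsilon>\<close>.\<close>

definition \<epsilon> :: "real^'m \<Rightarrow> real" where
  "\<epsilon> x = GF x (N x) (N x)"

text \<open>The orthogonal projection in source components, obtained by raising an index instead of
  by \<open>THE\<close>, so that its smoothness follows from \<open>Ck_on_solve\<close>.\<close>

definition tang :: "real^'m \<Rightarrow> real^'n \<Rightarrow> real^'m" where
  "tang x w = raise (g x) (\<lambda>z. GF x w (dd F x z))"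

lemma GF_commute: "x \<in> U \<Longrightarrow> GF x u v = GF x v u"
  by (rule ip_commute[OF sym_G[OF F_in]])

lemma dd_F_linear: "x \<in> U \<Longrightarrow> linear (dd F x)"
  by (rule has_derivative_linear[OF F_has_derivative])

lemmas dd_F_simps = linear_add[OF dd_F_linear] linear_diff[OF dd_F_linear] linear_scale[OF dd_F_linear] linear_0[OF dd_F_linear]

lemma \<epsilon>_squared: "x \<in> U \<Longrightarrow> \<epsilon> x * \<epsilon> x = 1"
  using N_unit[of x] by (auto simp: \<epsilon>_def abs_if split: if_splits)

lemma \<epsilon>_nonzero: "x \<in> U \<Longrightarrow> \<epsilon> x \<noteq> 0"
  using \<epsilon>_squared[of x] by auto

lemma smooth_\<epsilon>: "Ck_on k \<epsilon> U"
  unfolding \<epsilon>_def by (rule Ck_on_ip[OF open_U smooth_GF smooth_N smooth_N])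

lemma dd_\<epsilon>: 
  assumes x: "x \<in> U"
  shows "dd \<epsilon> x u = 0"
proof -
  note d = Ck_on_has_derivative[OF smooth_\<epsilon> open_U x]
  have "dd (\<lambda>y. \<epsilon> y * \<epsilon> y) x = dd (\<lambda>_. 1) x"
    by (rule dd_cong[OF open_U x]) (rule \<epsilon>_squared)
  then have "dd (\<lambda>y. \<epsilon> y * \<epsilon> y) x u = 0" by simp
  then have "2 * \<epsilon> x * dd \<epsilon> x u = 0"
    unfolding dd_eqI[OF has_derivative_mult[OF d d]] by simp
  then show ?thesis using \<epsilon>_nonzero[OF x] by simp
qed

lemma ip_tang:
  assumes x: "x \<in> U"
  shows "ip (g x) (tang x w) z = GF x w (dd F x z)"
  unfolding tang_def
  by (rule ip_raise[OF inv_g[OF x] sym_g[OF x]])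
    (rule linearI; simp add: dd_F_simps[OF x] ip_linear_simps)

lemma tang_eqI: "x \<in> U \<Longrightarrow> (\<And>z. ip (g x) y z = GF x w (dd F x z)) \<Longrightarrow> tang x w = y"
  by (rule ip_eq_iff[OF inv_g sym_g]) (auto simp: ip_tang)

lemma dd_F_eqD: 
  assumes "x \<in> U" "dd F x a - s *\<^sub>R N x = dd F x b - t *\<^sub>R N x"
  shows "a = b"
proof (rule ip_eq_iff[OF inv_g[OF assms(1)] sym_g[OF assms(1)]])
  fix z
  have "GF x (dd F x a - s *\<^sub>R N x) (dd F x z) = GF x (dd F x b - t *\<^sub>R N x) (dd F x z)"
    using assms(2) by simp
  then show "ip (g x) a z = ip (g x) b z"
    by (simp add: ip_linear_simps N_orth[OF assms(1)] isometric[OF assms(1)])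
qed

text \<open>The map \<open>L\<close> is injective: pairing with \<open>N x\<close> detects the
  normal coefficient, and \<open>g\<close> is nondegenerate. Codimension one makes the dimensions of
  its domain and codomain agree.\<close>

lemma tangent_normal_span:
  assumes x: "x \<in> U"
  shows "\<exists>y t. w = dd F x y + t *\<^sub>R N x"
proof -
  define L where "L = (\<lambda>(y, t). dd F x y + t *\<^sub>R N x)"
  have lin: "linear L"
    unfolding L_def by (rule linearI) (auto simp: dd_F_simps[OF x] algebra_simps)
  have ker: "y = 0 \<and> t = 0" if "dd F x y + t *\<^sub>R N x = 0" for y t
  proof -
    have "GF x (N x) (dd F x y + t *\<^sub>R N x) = 0" using that by (simp add: ip_linear_simps)
    then have "t * \<epsilon> x = 0" by (simp add: ip_linear_simps N_orth[OF x] \<epsilon>_def)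
    then have t: "t = 0" using \<epsilon>_nonzero[OF x] by simp
    then have "dd F x y - 0 *\<^sub>R N x = dd F x 0 - 0 *\<^sub>R N x" using that by (simp add: dd_F_simps[OF x])
    then show ?thesis using dd_F_eqD[OF x] t by blast
  qed
  then have inj: "inj L"
    unfolding linear_injective_0[OF lin] by (auto simp: L_def zero_prod_def dest: ker)
  have "dim (L ` UNIV) = dim (UNIV :: ((real^'m) \<times> real) set)"
    by (rule dim_image_eq[OF lin]) (use inj in \<open>auto intro: inj_on_subset\<close>)
  also have "\<dots> = DIM(real^'n)" using card by simp
  finally have "span (range L) = UNIV" using dim_eq_full[of "range L"] by simp
  moreover have "subspace (range L)" by (rule linear_subspace_image[OF lin subspace_UNIV])
  ultimately have "w \<in> range L" by (metis UNIV_I span_eq_iff)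
  then show ?thesis by (auto simp: L_def)
qed

text \<open>The factor \<epsilon> appears because \<open>N x\<close> pairs with itself to
  \<epsilon>, which is its own inverse.\<close>

lemma decompose:
  assumes x: "x \<in> U"
  shows "w = dd F x (tang x w) + (\<epsilon> x * GF x w (N x)) *\<^sub>R N x"
proof -
  obtain y t where w: "w = dd F x y + t *\<^sub>R N x" using tangent_normal_span[OF x] by blast
  have "tang x w = y"
    by (rule tang_eqI[OF x]) (simp add: w ip_linear_simps N_orth[OF x] isometric[OF x])
  moreover have "GF x w (N x) = t * \<epsilon> x"
    by (simp add: w ip_linear_simps \<epsilon>_def GF_commute[OF x, of "dd F x y"] N_orth[OF x])
  ultimately show ?thesis using w \<epsilon>_squared[OF x] by (simp add: mult.left_commute)
qed

lemma Ck_on_dd_F: "Ck_on k (\<lambda>x. dd F x v) U"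
  by (rule Ck_on_Suc_dd[OF smooth_F])

lemma Ck_on_tang:
  assumes "Ck_on k w U"
  shows "Ck_on k (\<lambda>x. tang x (w x)) U"
  unfolding tang_def raise_def
proof (rule Ck_on_solve[OF open_U smooth_g _ inv_g])
  show "Ck_on k (\<lambda>x. \<chi> i. GF x (w x) (dd F x (axis i 1))) U"
  proof (rule Ck_on_vec[OF open_U])
    show "Ck_on k (\<lambda>x. (\<chi> i. GF x (w x) (dd F x (axis i 1))) $ i) U" for i
      unfolding vec_lambda_beta by (rule Ck_on_ip[OF open_U smooth_GF assms Ck_on_dd_F])
  qed
qed

text \<open>Christoffel map of the induced connection; \<open>\<Gamma>_sym\<close> and
  \<open>dd_g\<close> characterize it as the Levi-Civita connection of \<open>g\<close>.\<close>

definition \<Gamma> :: "real^'m \<Rightarrow> real^'m \<Rightarrow> real^'m \<Rightarrow> real^'m" where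
  "\<Gamma> x u v = tang x (P (\<lambda>y. dd F y v) x u)"

text \<open>Pairing h N, which is minus the normal part of the derivative, with \<open>N\<close>
  gives h \<epsilon>; multiplying by \<epsilon> isolates h.\<close>

definition h :: "real^'m \<Rightarrow> real^'m \<Rightarrow> real^'m \<Rightarrow> real" where
  "h x u v = - \<epsilon> x * GF x (P (\<lambda>y. dd F y v) x u) (N x)"

lemma gauss: "x \<in> U \<Longrightarrow> P (\<lambda>y. dd F y v) x u = dd F x (\<Gamma> x u v) - h x u v *\<^sub>R N x"
  unfolding \<Gamma>_def h_def using decompose[of x "P (\<lambda>y. dd F y v) x u"] by simp

lemma \<Gamma>_sym: "x \<in> U \<Longrightarrow> \<Gamma> x u v = \<Gamma> x v u"
  by (simp add: \<Gamma>_def P_dd_F_sym[of x u v])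

lemma h_sym: "x \<in> U \<Longrightarrow> h x u v = h x v u"
  by (simp add: h_def P_dd_F_sym[of x u v])

lemma P_linear:
  assumes x: "x \<in> U" and W: "(W has_derivative dd W x) (at x)"
  shows "linear (P W x)"
  unfolding P_def
  by (rule linearI; simp add: linear_add[OF has_derivative_linear[OF W]] linear_scale[OF has_derivative_linear[OF W]]
      dd_F_simps[OF x] levi_civita_add[OF F_in[OF x]] levi_civita_scaleR[OF F_in[OF x]] scaleR_add_right)

lemma \<Gamma>_linear: "x \<in> U \<Longrightarrow> linear (\<lambda>u. \<Gamma> x u v)" "x \<in> U \<Longrightarrow> linear (\<Gamma> x u)"
proof -
  assume x: "x \<in> U"
  show *: "linear (\<lambda>u. \<Gamma> x u v)" for v
  proof (rule linearI; rule ip_eq_iff[OF inv_g[OF x] sym_g[OF x]])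
    note lin = P_linear[OF x dd_F_has_derivative[OF x], of v]
    show "ip (g x) (\<Gamma> x (a + b) v) w = ip (g x) (\<Gamma> x a v + \<Gamma> x b v) w" for a b w
      by (simp add: \<Gamma>_def ip_tang[OF x] ip_linear_simps linear_add[OF lin])
    show "ip (g x) (\<Gamma> x (r *\<^sub>R b) v) w = ip (g x) (r *\<^sub>R \<Gamma> x b v) w" for r b w
      by (simp add: \<Gamma>_def ip_tang[OF x] ip_linear_simps linear_scale[OF lin])
  qed
  have "\<Gamma> x u = (\<lambda>v. \<Gamma> x v u)" using \<Gamma>_sym[OF x] by blast
  with * show "linear (\<Gamma> x u)" by simp
qed

lemma dd_g:
  assumes x: "x \<in> U"
  shows "ip (dd g x u) v w = ip (g x) (\<Gamma> x u v) w + ip (g x) v (\<Gamma> x u w)"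
proof -
  have dg: "(g has_derivative dd g x) (at x)" by (rule Ck_on_has_derivative[OF smooth_g open_U x])
  have "ip (dd g x u) v w = dd (\<lambda>y. ip (g y) v w) x u"
    using dd_eqI[OF has_derivative_ip[OF dg has_derivative_const has_derivative_const], of v w]
    by (simp add: ip_linear_simps)
  also have "dd (\<lambda>y. ip (g y) v w) x = dd (\<lambda>y. GF y (dd F y v) (dd F y w)) x"
    by (rule dd_cong[OF open_U x]) (simp add: isometric)
  also have "dd (\<lambda>y. GF y (dd F y v) (dd F y w)) x u
      = GF x (P (\<lambda>y. dd F y v) x u) (dd F x w) + GF x (dd F x v) (P (\<lambda>y. dd F y w) x u)"
    by (rule dd_ip_P[OF x dd_F_has_derivative[OF x] dd_F_has_derivative[OF x]])
  finally show ?thesis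
    by (simp add: \<Gamma>_def ip_tang[OF x] ip_commute[OF sym_g[OF x], of v] GF_commute[OF x, of "dd F x v"])
qed

text \<open>The shape operator through the derivative of the normal instead of through
  \<open>h\<close>, so that smoothness and the Codazzi equation can be read off;
  \<open>ip_shp\<close> reconciles the two.\<close>

definition shp :: "real^'m \<Rightarrow> real^'m \<Rightarrow> real^'m" where
  "shp x y = \<epsilon> x *\<^sub>R tang x (P N x y)"

lemma N_has_derivative: "x \<in> U \<Longrightarrow> (N has_derivative dd N x) (at x)"
  by (rule Ck_on_has_derivative[OF smooth_N open_U])

lemma shp_linear:
  assumes x: "x \<in> U"
  shows "linear (shp x)"
proof (rule linearI; rule ip_eq_iff[OF inv_g[OF x] sym_g[OF x]])
  note lin = P_linear[OF x N_has_derivative[OF x]]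
  show "ip (g x) (shp x (a + b)) w = ip (g x) (shp x a + shp x b) w" for a b w
    by (simp add: shp_def ip_tang[OF x] ip_linear_simps linear_add[OF lin] algebra_simps)
  show "ip (g x) (shp x (r *\<^sub>R b)) w = ip (g x) (r *\<^sub>R shp x b) w" for r b w
    by (simp add: shp_def ip_tang[OF x] ip_linear_simps linear_scale[OF lin])
qed

text \<open>Differentiating the orthogonality of \<open>N\<close> and \<open>dd F y z\<close> moves
  the derivative from the tangent field to the normal; the change of sign absorbs the minus in
  \<open>h\<close>.\<close>

lemma ip_shp:
  assumes x: "x \<in> U"
  shows "ip (g x) (shp x y) z = h x y z"
proof -
  have "dd (\<lambda>y. GF y (N y) (dd F y z)) x = dd (\<lambda>_. 0) x"
    by (rule dd_cong[OF open_U x]) (rule N_orth)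
  then have "GF x (P N x y) (dd F x z) = - GF x (N x) (P (\<lambda>y. dd F y z) x y)"
    using dd_ip_P[OF x N_has_derivative[OF x] dd_F_has_derivative[OF x], of z y] by simp
  then show ?thesis
    by (simp add: shp_def ip_linear_simps ip_tang[OF x] h_def GF_commute[OF x, of "N x"])
qed

text \<open>The pairing of \<open>N\<close> with itself has zero derivative, so
  \<open>P N x u\<close> has no normal part; dividing by \<epsilon> is the same as multiplying by
  it.\<close>

lemma weingarten:
  assumes x: "x \<in> U"
  shows "P N x u = dd F x (\<epsilon> x *\<^sub>R shp x u)"
proof -
  have "2 * GF x (P N x u) (N x) = 0"
    using dd_ip_P[OF x N_has_derivative[OF x] N_has_derivative[OF x], of u] dd_\<epsilon>[OF x, of u]
    by (simp add: \<epsilon>_def[abs_def] GF_commute[OF x, of "N x"])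
  moreover have "\<epsilon> x *\<^sub>R shp x u = tang x (P N x u)"
    using \<epsilon>_squared[OF x] by (simp add: shp_def)
  ultimately show ?thesis using decompose[OF x, of "P N x u"] by simp
qed

lemma P_cong: "x \<in> U \<Longrightarrow> (\<And>y. y \<in> U \<Longrightarrow> W y = Z y) \<Longrightarrow> P W x u = P Z x u"
  unfolding P_def using dd_cong[OF open_U, of x W Z] by simp

lemma P_dd_F_field:
  assumes x: "x \<in> U" and Y: "(Y has_derivative dd Y x) (at x)"
  shows "P (\<lambda>y. dd F y (Y y)) x u = dd F x (dd Y x u + \<Gamma> x u (Y x)) - h x u (Y x) *\<^sub>R N x"
proof -
  have "((\<lambda>y. dd F y (Y y)) has_derivative (\<lambda>u. dd (\<lambda>z. dd F z (Y x)) x u + dd F x (dd Y x u))) (at x)"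
    by (rule has_derivative_dd_apply[OF open_U smooth_F open_U x _ has_derivative_ident Y]) simp
  from dd_eqI[OF this] have "P (\<lambda>y. dd F y (Y y)) x u = P (\<lambda>y. dd F y (Y x)) x u + dd F x (dd Y x u)"
    by (simp add: P_def)
  then show ?thesis by (simp add: gauss[OF x] dd_F_simps[OF x])
qed

lemma Ck_on_P_N: "Ck_on k (\<lambda>x. P N x u) U"
  by (rule Ck_on_P[OF smooth_N])

lemma smooth_shp: "Ck_on k (\<lambda>x. shp x u) U"
  unfolding shp_def by (intro Ck_on_scaleR open_U smooth_\<epsilon> Ck_on_tang Ck_on_P_N)

text \<open>In constant curvature R(u,v)N is a combination of \<open>u\<close> and \<open>v\<close>
  whose coefficients are pairings of \<open>N\<close> with tangent vectors, hence zero. So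
  \<open>P_commutator\<close> on \<open>N\<close> vanishes, and by Weingarten its tangential part is
  \<epsilon> times the difference of the two sides.\<close>

lemma codazzi:
  assumes x: "x \<in> U"
  shows "dd (\<lambda>y. shp y v) x u + \<Gamma> x u (shp x v) = dd (\<lambda>y. shp y u) x v + \<Gamma> x v (shp x u)"
proof -
  have sd: "((\<lambda>y. shp y v) has_derivative dd (\<lambda>y. shp y v) x) (at x)" for v
    by (rule Ck_on_has_derivative[OF smooth_shp open_U x])
  note ed = Ck_on_has_derivative[OF smooth_\<epsilon> open_U x]
  have 1: "P (\<lambda>y. P N y v) x u = dd F x (\<epsilon> x *\<^sub>R (dd (\<lambda>y. shp y v) x u + \<Gamma> x u (shp x v)))
      - h x u (\<epsilon> x *\<^sub>R shp x v) *\<^sub>R N x" for u v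
  proof -
    have d: "dd (\<lambda>y. \<epsilon> y *\<^sub>R shp y v) x = (\<lambda>u. \<epsilon> x *\<^sub>R dd (\<lambda>y. shp y v) x u)"
      using dd_eqI[OF has_derivative_scaleR[OF ed sd, of v]] by (simp add: dd_\<epsilon>[OF x])
    have D: "((\<lambda>y. \<epsilon> y *\<^sub>R shp y v) has_derivative dd (\<lambda>y. \<epsilon> y *\<^sub>R shp y v) x) (at x)"
      by (rule Ck_on_has_derivative[OF Ck_on_scaleR[OF open_U smooth_\<epsilon> smooth_shp] open_U x])
    have "P (\<lambda>y. P N y v) x u = P (\<lambda>y. dd F y (\<epsilon> y *\<^sub>R shp y v)) x u"
      by (rule P_cong[OF x]) (rule weingarten)
    also have "\<dots> = dd F x (dd (\<lambda>y. \<epsilon> y *\<^sub>R shp y v) x u + \<Gamma> x u (\<epsilon> x *\<^sub>R shp x v)) - h x u (\<epsilon> x *\<^sub>R shp x v) *\<^sub>R N x"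
      by (rule P_dd_F_field[OF x D])
    finally show ?thesis by (simp add: d linear_scale[OF \<Gamma>_linear(2)[OF x]] scaleR_add_right)
  qed
  have "P (\<lambda>y. P N y v) x u - P (\<lambda>y. P N y u) x v = 0"
    using P_commutator[OF x smooth_N, where u = u and v = v] curv[OF F_in[OF x]]
    by (simp add: GF_commute[OF x, of "dd F x u"] GF_commute[OF x, of "dd F x v"] N_orth[OF x])
  then have "\<epsilon> x *\<^sub>R (dd (\<lambda>y. shp y v) x u + \<Gamma> x u (shp x v)) = \<epsilon> x *\<^sub>R (dd (\<lambda>y. shp y u) x v + \<Gamma> x v (shp x u))"
    unfolding 1 by (intro dd_F_eqD[OF x]) (simp only: right_minus_eq)
  then show ?thesis using \<epsilon>_nonzero[OF x] by simp
qed

end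

section \<open>Divergence of the Newton transformations\<close>

context hypersurface_patch
begin

definition Sh :: "real^'m \<Rightarrow> real^'m^'m" where
  "Sh x = matrix (shp x)"

definition Gam :: "real^'m \<Rightarrow> real^'m \<Rightarrow> real^'m^'m" where
  "Gam x u = matrix (\<Gamma> x u)"

lemma Sh_works: "x \<in> U \<Longrightarrow> Sh x *v v = shp x v"
  unfolding Sh_def by (rule matrix_linear_works[OF shp_linear])

lemma Gam_works: "x \<in> U \<Longrightarrow> Gam x u *v v = \<Gamma> x u v"
  unfolding Gam_def by (rule matrix_linear_works[OF \<Gamma>_linear(2)])

lemma Ck_on_Sh: "Ck_on k Sh U"
proof (rule Ck_on_mat[OF open_U])
  show "Ck_on k (\<lambda>x. Sh x $ i $ j) U" for i j
    unfolding Sh_def matrix_def vec_lambda_beta by (intro Ck_on_nth open_U smooth_shp)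
qed

lemma Ck_on_newton: "Ck_on k (\<lambda>x. newton j (Sh x)) U"
proof (induction j)
  case 0
  show ?case unfolding newton.simps by (rule Ck_on_const)
next
  case (Suc j)
  show ?case
    unfolding newton.simps
    by (intro Ck_on_diff Ck_on_scaleR Ck_on_const Ck_on_elem_sym Ck_on_matrix_matrix open_U Ck_on_Sh Suc)
qed

lemma Sh_self_adjoint:
  assumes x: "x \<in> U"
  shows "transpose (Sh x) ** g x = g x ** Sh x"
proof (rule matrix_eq_ipI)
  fix y z
  show "ip (transpose (Sh x) ** g x) y z = ip (g x ** Sh x) y z"
    unfolding ip_matrix_left
    unfolding ip_matrix_right Sh_works[OF x] ip_commute[OF sym_g[OF x], of y] ip_shp[OF x]
    by (rule h_sym[OF x])
qed

lemma newton_Sh_self_adjoint: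
  "x \<in> U \<Longrightarrow> transpose (newton k (Sh x)) ** g x = g x ** newton k (Sh x)"
  by (rule newton_self_adjoint[OF Sh_self_adjoint])

text \<open>Covariant derivative and divergence of a field of endomorphisms of the tangent spaces.\<close>

definition nab :: "(real^'m \<Rightarrow> real^'m^'m) \<Rightarrow> real^'m \<Rightarrow> real^'m \<Rightarrow> real^'m^'m" where
  "nab T x u = dd T x u + (Gam x u ** T x - T x ** Gam x u)"

definition tdiv :: "(real^'m \<Rightarrow> real^'m^'m) \<Rightarrow> real^'m \<Rightarrow> real^'m \<Rightarrow> real" where
  "tdiv T x v = (\<Sum>i\<in>UNIV. (nab T x (axis i 1) *v v) $ i)"

lemma nab_mult:
  assumes "(A has_derivative dd A x) (at x)" "(B has_derivative dd B x) (at x)"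
  shows "nab (\<lambda>y. A y ** B y) x u = nab A x u ** B x + A x ** nab B x u"
  unfolding nab_def dd_eqI[OF bounded_bilinear.FDERIV[OF bounded_bilinear_matrix_matrix assms]]
  by (simp add: matrix_ring_simps matrix_mul_assoc)

lemma nab_diff:
  assumes "(A has_derivative dd A x) (at x)" "(B has_derivative dd B x) (at x)"
  shows "nab (\<lambda>y. A y - B y) x u = nab A x u - nab B x u"
  unfolding nab_def dd_eqI[OF has_derivative_diff[OF assms]]
  by (simp add: matrix_ring_simps)

lemma nab_scalar:
  assumes "(c has_derivative dd c x) (at x)"
  shows "nab (\<lambda>y. c y *\<^sub>R mat 1) x u = dd c x u *\<^sub>R mat 1"
  unfolding nab_def dd_eqI[OF has_derivative_scaleR_left[OF assms]]
  by (simp add: matrix_ring_simps)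

lemma nab_Sh_works:
  assumes x: "x \<in> U"
  shows "nab Sh x u *v v = dd (\<lambda>y. shp y v) x u + \<Gamma> x u (shp x v) - shp x (\<Gamma> x u v)"
proof -
  note SD = Ck_on_has_derivative[OF Ck_on_Sh open_U x]
  have "dd (\<lambda>y. shp y v) x = dd (\<lambda>y. Sh y *v v) x"
    by (rule dd_cong[OF open_U x]) (simp add: Sh_works)
  also have "\<dots> = (\<lambda>u. dd Sh x u *v v)"
    using dd_eqI[OF bounded_bilinear.FDERIV[OF bounded_bilinear_matrix_vector SD has_derivative_const[of v]]] by simp
  finally show ?thesis
    unfolding nab_def
    by (simp add: matrix_vector_mult_add_rdistrib matrix_vector_mult_diff_rdistrib matrix_vector_mul_assoc[symmetric]
        Sh_works[OF x] Gam_works[OF x])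
qed

lemma nab_Sh_sym: "x \<in> U \<Longrightarrow> nab Sh x u *v v = nab Sh x v *v u"
  using codazzi[of x v u] by (simp add: nab_Sh_works \<Gamma>_sym[of x u v])

lemma dd_elem_sym_Sh:
  assumes x: "x \<in> U"
  shows "dd (\<lambda>y. elem_sym (Suc k) (Sh y)) x u = trace (newton k (Sh x) ** dd Sh x u)"
proof -
  have "Ck_on (Suc 0) (elem_sym (Suc k) :: real^'m^'m \<Rightarrow> real) UNIV"
    by (rule Ck_on_elem_sym[OF open_UNIV Ck_on_ident])
  from has_derivative_compose[OF Ck_on_has_derivative[OF Ck_on_Sh open_U x] Ck_on_has_derivative_UNIV[OF this]]
  show ?thesis by (simp add: dd_eqI dd_elem_sym)
qed

text \<open>The recursion gives (div T_{k+1})(v) = dH_{k+1}(v) - (div T_k)(Sv) - R, where R sums the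
  i-th components of T_k (nabla_i S) v. Codazzi turns R into trace (T_k nabla_v S), which is
  dH_{k+1}(v) by \<open>dd_elem_sym\<close>.\<close>

lemma newton_divergence_free:
  assumes x: "x \<in> U"
  shows "tdiv (\<lambda>y. newton k (Sh y)) x v = 0"
proof (induction k arbitrary: v)
  case 0
  have "nab (\<lambda>y. mat 1) x u = 0" for u by (simp add: nab_def)
  then show ?case by (simp add: tdiv_def)
next
  case (Suc k)
  let ?T = "newton k (Sh x)"
  have H: "((\<lambda>y. elem_sym (Suc k) (Sh y)) has_derivative dd (\<lambda>y. elem_sym (Suc k) (Sh y)) x) (at x)"
    by (rule Ck_on_has_derivative[OF Ck_on_elem_sym[OF open_U Ck_on_Sh] open_U x])
  have HI: "((\<lambda>y. elem_sym (Suc k) (Sh y) *\<^sub>R mat 1) has_derivative dd (\<lambda>y. elem_sym (Suc k) (Sh y) *\<^sub>R (mat 1 :: real^'m^'m)) x) (at x)"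
    by (rule Ck_on_has_derivative[OF Ck_on_scaleR[OF open_U Ck_on_elem_sym[OF open_U Ck_on_Sh] Ck_on_const] open_U x])
  have TD: "((\<lambda>y. newton k (Sh y)) has_derivative dd (\<lambda>y. newton k (Sh y)) x) (at x)"
    by (rule Ck_on_has_derivative[OF Ck_on_newton open_U x])
  have SD: "(Sh has_derivative dd Sh x) (at x)"
    by (rule Ck_on_has_derivative[OF Ck_on_Sh open_U x])
  have TSD: "((\<lambda>y. newton k (Sh y) ** Sh y) has_derivative dd (\<lambda>y. newton k (Sh y) ** Sh y) x) (at x)"
    by (rule Ck_on_has_derivative[OF Ck_on_matrix_matrix[OF open_U Ck_on_newton Ck_on_Sh] open_U x])
  \<comment> \<open>The product is taken in the order \<open>newton k ** Sh\<close>, so that the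
    derivative of \<open>newton k\<close> meets the vector \<open>Sh x *v v\<close>, to which the
    induction hypothesis applies.\<close>
  have N: "nab (\<lambda>y. newton (Suc k) (Sh y)) x u = dd (\<lambda>y. elem_sym (Suc k) (Sh y)) x u *\<^sub>R mat 1
      - (nab (\<lambda>y. newton k (Sh y)) x u ** Sh x + ?T ** nab Sh x u)" for u
    unfolding newton.simps newton_commute nab_diff[OF HI TSD] nab_scalar[OF H] nab_mult[OF TD SD] ..
  have sum1: "(\<Sum>i\<in>UNIV. dd (\<lambda>y. elem_sym (Suc k) (Sh y)) x (axis i 1) * v $ i) = dd (\<lambda>y. elem_sym (Suc k) (Sh y)) x v"
    using linear_functional_vec[OF has_derivative_linear[OF H], of v] by (simp add: mult.commute)
  \<comment> \<open>Codazzi exchanges the direction of differentiation with the argument, so the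
    contraction becomes a trace.\<close>
  have "(\<Sum>i\<in>UNIV. (?T *v (nab Sh x (axis i 1) *v v)) $ i) = trace (?T ** nab Sh x v)"
    unfolding trace_column_sum matrix_vector_mul_assoc[symmetric] nab_Sh_sym[OF x, of _ v] ..
  also have "?T ** nab Sh x v = ?T ** dd Sh x v + (?T ** Gam x v ** Sh x - ?T ** Sh x ** Gam x v)"
    by (simp add: nab_def matrix_ring_simps matrix_mul_assoc)
  \<comment> \<open>The connection terms are T (Gam S - S Gam); their trace vanishes because T
    commutes with S.\<close>
  also have "trace \<dots> = trace (?T ** dd Sh x v)"
  proof -
    have "trace (?T ** Gam x v ** Sh x) = trace (Sh x ** (?T ** Gam x v))" by (rule trace_mul_sym)
    also have "Sh x ** (?T ** Gam x v) = ?T ** Sh x ** Gam x v" by (simp add: matrix_mul_assoc newton_commute)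
    finally show ?thesis by (simp add: trace_add trace_sub)
  qed
  finally have sum2: "(\<Sum>i\<in>UNIV. (?T *v (nab Sh x (axis i 1) *v v)) $ i) = dd (\<lambda>y. elem_sym (Suc k) (Sh y)) x v"
    by (simp add: dd_elem_sym_Sh[OF x])
  have "tdiv (\<lambda>y. newton (Suc k) (Sh y)) x v
      = (\<Sum>i\<in>UNIV. dd (\<lambda>y. elem_sym (Suc k) (Sh y)) x (axis i 1) * v $ i)
        - (tdiv (\<lambda>y. newton k (Sh y)) x (Sh x *v v) + (\<Sum>i\<in>UNIV. (?T *v (nab Sh x (axis i 1) *v v)) $ i))"
    unfolding tdiv_def N
    by (simp add: matrix_vector_mult_add_rdistrib matrix_vector_mult_diff_rdistrib scaleR_matrix_vector_assoc[symmetric]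
        matrix_vector_mul_assoc[symmetric] sum_subtractf sum.distrib)
  then show ?case using Suc[of "Sh x *v v"] sum1 sum2 by simp
qed

section \<open>The divergence formula in coordinates\<close>

definition \<rho> :: "real^'m \<Rightarrow> real" where
  "\<rho> x = sqrt \<bar>det (g x)\<bar>"

text \<open>With the absolute value written as the root of a square, \<open>Ck_on_sqrt\<close>
  applies twice.\<close>

lemma \<rho>_alt: "\<rho> x = sqrt (sqrt (det (g x) * det (g x)))"
  by (simp add: \<rho>_def)

lemma det_g_nonzero: "x \<in> U \<Longrightarrow> det (g x) \<noteq> 0"
  by (rule invertible_det_nz[THEN iffD1, OF inv_g])

lemma \<rho>_pos: "x \<in> U \<Longrightarrow> 0 < \<rho> x"
  using det_g_nonzero by (simp add: \<rho>_def)

lemma smooth_\<rho>: "Ck_on k \<rho> U"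
proof -
  have "Ck_on k (\<lambda>x. sqrt (sqrt (det (g x) * det (g x)))) U"
  proof (intro Ck_on_sqrt open_U Ck_on_mult Ck_on_det smooth_g)
    fix x assume "x \<in> U"
    then show "0 < det (g x) * det (g x)"
      using det_g_nonzero not_real_square_gt_zero by blast
    then show "0 < sqrt (det (g x) * det (g x))" by (rule real_sqrt_gt_zero)
  qed
  then show ?thesis by (simp only: \<rho>_alt[abs_def])
qed

text \<open>The derivative of \<open>g\<close> is \<open>g x ** Gam x u\<close> plus its transpose,
  so Jacobi's formula gives twice the trace for det g and once the trace for the root.\<close>

lemma dd_\<rho>:
  assumes x: "x \<in> U"
  shows "dd \<rho> x u = \<rho> x * trace (Gam x u)"
proof -
  obtain R where R: "g x ** R = mat 1" "R ** g x = mat 1"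
    using inv_g[OF x] by (auto simp: invertible_def)
  have "dd g x u = g x ** Gam x u + transpose (Gam x u) ** g x"
  proof (rule matrix_eq_ipI)
    show "ip (dd g x u) y z = ip (g x ** Gam x u + transpose (Gam x u) ** g x) y z" for y z
      unfolding ip_add_form ip_matrix_left
      unfolding ip_matrix_right Gam_works[OF x] dd_g[OF x] by simp
  qed
  also have "\<dots> = g x ** (Gam x u + R ** (transpose (Gam x u) ** g x))"
    by (simp add: matrix_ring_simps matrix_mul_assoc R)
  finally have dg: "dd g x u = g x ** (Gam x u + R ** (transpose (Gam x u) ** g x))" .
  have tr: "trace (Gam x u + R ** (transpose (Gam x u) ** g x)) = 2 * trace (Gam x u)"
  proof -
    have "trace (R ** (transpose (Gam x u) ** g x)) = trace (transpose (Gam x u) ** g x ** R)"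
      by (rule trace_mul_sym)
    also have "transpose (Gam x u) ** g x ** R = transpose (Gam x u)"
      by (simp add: matrix_mul_assoc[symmetric] R)
    finally show ?thesis by (simp add: trace_add trace_transpose)
  qed
  have "Ck_on (Suc 0) (det :: real^'m^'m \<Rightarrow> real) UNIV"
    by (rule Ck_on_det[OF open_UNIV Ck_on_ident])
  from has_derivative_compose[OF Ck_on_has_derivative[OF smooth_g open_U x] Ck_on_has_derivative_UNIV[OF this]]
  have dD: "((\<lambda>y. det (g y)) has_derivative (\<lambda>u. dd det (g x) (dd g x u))) (at x)" .
  have rD: "(\<rho> has_derivative dd \<rho> x) (at x)" by (rule Ck_on_has_derivative[OF smooth_\<rho> open_U x])
  \<comment> \<open>The fourth power is the square of det g, free of roots and absolute values: one
    computation serves both signs of the determinant.\<close>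
  have r4: "\<rho> y ^ 4 = det (g y) * det (g y)" for y
  proof -
    have "\<rho> y ^ 4 = (\<rho> y * \<rho> y) * (\<rho> y * \<rho> y)" by (simp add: numeral_eq_Suc)
    then show ?thesis by (simp add: \<rho>_def)
  qed
  have "dd (\<lambda>y. \<rho> y ^ 4) x u = 4 * \<rho> x ^ 3 * dd \<rho> x u"
    using dd_eqI[OF has_derivative_power[OF rD, of 4]] by (simp add: mult_ac)
  moreover have "dd (\<lambda>y. \<rho> y ^ 4) x u = 2 * det (g x) * dd det (g x) (dd g x u)"
    unfolding r4 using dd_eqI[OF has_derivative_mult[OF dD dD]] by simp
  moreover have "dd det (g x) (dd g x u) = det (g x) * (2 * trace (Gam x u))"
    unfolding dg dd_det tr ..
  ultimately have "4 * \<rho> x ^ 3 * dd \<rho> x u = 4 * \<rho> x ^ 4 * trace (Gam x u)"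
    by (simp add: r4)
  then have "4 * \<rho> x ^ 3 * dd \<rho> x u = 4 * \<rho> x ^ 3 * (\<rho> x * trace (Gam x u))"
    by (simp add: power_eq_if mult_ac)
  then show ?thesis using \<rho>_pos[OF x] by simp
qed

text \<open>The trace that comes from \<open>dd_\<rho>\<close> supplies exactly the Christoffel
  terms that complete the plain derivatives to \<open>tdiv T\<close> and to the covariant derivative
  of \<open>Y\<close>.\<close>

lemma divergence_formula:
  assumes x: "x \<in> U" and f: "(f has_derivative dd f x) (at x)" and T: "(T has_derivative dd T x) (at x)"
    and Y: "(Y has_derivative dd Y x) (at x)" and free: "\<And>v. tdiv T x v = 0"
  shows "(\<Sum>i\<in>UNIV. dd (\<lambda>y. (\<rho> y * f y) * (T y *v Y y) $ i) x (axis i 1))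
    = \<rho> x * (dd f x (T x *v Y x) + f x * trace (T x ** matrix (\<lambda>u. dd Y x u + \<Gamma> x u (Y x))))"
proof -
  let ?e = "\<lambda>i. axis i 1 :: real^'m"
  let ?W = "T x *v Y x"
  have rD: "(\<rho> has_derivative dd \<rho> x) (at x)" by (rule Ck_on_has_derivative[OF smooth_\<rho> open_U x])
  have TY: "((\<lambda>y. (T y *v Y y) $ i) has_derivative (\<lambda>u. (T x *v dd Y x u + dd T x u *v Y x) $ i)) (at x)" for i
    by (rule bounded_linear.has_derivative[OF bounded_linear_vec_nth bounded_bilinear.FDERIV[OF bounded_bilinear_matrix_vector T Y]])
  have 1: "dd (\<lambda>y. (\<rho> y * f y) * (T y *v Y y) $ i) x u
     = \<rho> x * (f x * (T x *v dd Y x u + dd T x u *v Y x) $ i + dd f x u * ?W $ i + f x * trace (Gam x u) * ?W $ i)" for i u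
    unfolding dd_eqI[OF has_derivative_mult[OF has_derivative_mult[OF rD f] TY]] dd_\<rho>[OF x]
    by (simp add: algebra_simps)
  have flin: "(\<Sum>i\<in>UNIV. dd f x (?e i) * ?W $ i) = dd f x ?W"
    using linear_functional_vec[OF has_derivative_linear[OF f], of ?W] by (simp add: mult.commute)
  \<comment> \<open>By symmetry of \<Gamma>, the contraction over the argument becomes one over the
    direction of differentiation.\<close>
  have Gtr: "(\<Sum>i\<in>UNIV. trace (Gam x (?e i)) * w $ i) = (\<Sum>i\<in>UNIV. \<Gamma> x (?e i) w $ i)" for w
  proof -
    have "\<Gamma> x (?e j) w = (\<Sum>i\<in>UNIV. (w $ i) *\<^sub>R \<Gamma> x (?e j) (?e i))" for j
      by (rule linear_functional_vec[OF \<Gamma>_linear(2)[OF x]])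
    then have "(\<Sum>j\<in>UNIV. \<Gamma> x (?e j) w $ j) = (\<Sum>j\<in>UNIV. \<Sum>i\<in>UNIV. w $ i * \<Gamma> x (?e j) (?e i) $ j)"
      by simp
    also have "\<dots> = (\<Sum>i\<in>UNIV. \<Sum>j\<in>UNIV. w $ i * \<Gamma> x (?e j) (?e i) $ j)" by (rule sum.swap)
    also have "\<dots> = (\<Sum>i\<in>UNIV. trace (Gam x (?e i)) * w $ i)"
      unfolding trace_column_sum Gam_works[OF x] \<Gamma>_sym[OF x, of "?e _" "?e _"]
      by (simp add: sum_distrib_left mult.commute \<Gamma>_sym[OF x])
    finally show ?thesis by simp
  qed
  have Alin: "linear (\<lambda>u. dd Y x u + \<Gamma> x u (Y x))"
    by (intro linear_compose_add has_derivative_linear[OF Y] \<Gamma>_linear(1)[OF x])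
  have "(\<Sum>i\<in>UNIV. (T x *v dd Y x (?e i) + dd T x (?e i) *v Y x) $ i) + (\<Sum>i\<in>UNIV. \<Gamma> x (?e i) ?W $ i)
      = (\<Sum>i\<in>UNIV. (nab T x (?e i) *v Y x) $ i + (T x *v (dd Y x (?e i) + \<Gamma> x (?e i) (Y x))) $ i)"
    unfolding nab_def
    by (simp add: matrix_vector_mult_add_rdistrib matrix_vector_mult_diff_rdistrib matrix_vector_mul_assoc[symmetric]
        Gam_works[OF x] matrix_vector_right_distrib sum.distrib[symmetric] algebra_simps)
  also have "\<dots> = tdiv T x (Y x) + trace (T x ** matrix (\<lambda>u. dd Y x u + \<Gamma> x u (Y x)))"
    unfolding trace_column_sum matrix_vector_mul_assoc[symmetric] matrix_linear_works[OF Alin] tdiv_def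
    by (simp add: sum.distrib)
  finally have 2: "(\<Sum>i\<in>UNIV. (T x *v dd Y x (?e i) + dd T x (?e i) *v Y x) $ i) + (\<Sum>i\<in>UNIV. trace (Gam x (?e i)) * ?W $ i)
      = trace (T x ** matrix (\<lambda>u. dd Y x u + \<Gamma> x u (Y x)))"
    unfolding Gtr free by simp
  have "(\<Sum>i\<in>UNIV. dd (\<lambda>y. (\<rho> y * f y) * (T y *v Y y) $ i) x (?e i))
      = \<rho> x * (f x * ((\<Sum>i\<in>UNIV. (T x *v dd Y x (?e i) + dd T x (?e i) *v Y x) $ i) + (\<Sum>i\<in>UNIV. trace (Gam x (?e i)) * ?W $ i))
          + (\<Sum>i\<in>UNIV. dd f x (?e i) * ?W $ i))"
    unfolding 1 sum_distrib_left[symmetric] sum.distrib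
    by (simp add: algebra_simps sum_distrib_left)
  then show ?thesis unfolding 2 flin by (simp add: algebra_simps)
qed

text \<open>In X = X^T + \<mu> N the derivative of \<mu> is multiplied by \<open>N\<close> and drops
  out of pairings with tangent vectors; only \<mu> times the derivative of \<open>N\<close> survives
  beside that of X^T.\<close>

lemma conformal_trace:
  assumes x: "x \<in> U" and X: "(X has_derivative dd X x) (at x)"
    and Xs: "\<And>k. Ck_on k X U"
    and conf: "\<And>y z. GF x (P X x y) (dd F x z) + GF x (P X x z) (dd F x y) = 2 * \<alpha> * ip (g x) y z"
  shows "trace (newton k (Sh x) ** matrix (\<lambda>u. dd (\<lambda>y. tang y (X y)) x u + \<Gamma> x u (tang x (X x))))
    = \<alpha> * (real CARD('m) - real k) * elem_sym k (Sh x)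
      - GF x (N x) (X x) * (real (Suc k) * elem_sym (Suc k) (Sh x))"
proof -
  let ?Y = "\<lambda>y. tang y (X y)"
  let ?A = "matrix (\<lambda>u. dd ?Y x u + \<Gamma> x u (?Y x))"
  let ?T = "newton k (Sh x)"
  define \<mu> where "\<mu> y = \<epsilon> y * GF y (X y) (N y)" for y
  have Ysm: "Ck_on k ?Y U" for k by (rule Ck_on_tang[OF Xs])
  have Yd: "(?Y has_derivative dd ?Y x) (at x)" by (rule Ck_on_has_derivative[OF Ysm open_U x])
  have \<mu>sm: "Ck_on k \<mu> U" for k
    unfolding \<mu>_def[abs_def] by (intro Ck_on_mult Ck_on_ip open_U smooth_\<epsilon> smooth_GF Xs smooth_N)
  have \<mu>d: "(\<mu> has_derivative dd \<mu> x) (at x)" by (rule Ck_on_has_derivative[OF \<mu>sm open_U x])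
  have FYd: "((\<lambda>y. dd F y (?Y y)) has_derivative dd (\<lambda>y. dd F y (?Y y)) x) (at x)"
    by (rule Ck_on_has_derivative[OF Ck_on_dd[OF open_U smooth_F Ysm] open_U x])
  have PX: "P X x u = P (\<lambda>y. dd F y (?Y y)) x u + dd \<mu> x u *\<^sub>R N x + \<mu> x *\<^sub>R P N x u" for u
  proof -
    have "P X x u = P (\<lambda>y. dd F y (?Y y) + \<mu> y *\<^sub>R N y) x u"
      by (rule P_cong[OF x]) (unfold \<mu>_def, rule decompose)
    also have "\<dots> = P (\<lambda>y. dd F y (?Y y)) x u + dd \<mu> x u *\<^sub>R N x + \<mu> x *\<^sub>R P N x u"
      unfolding P_def dd_eqI[OF has_derivative_add[OF FYd has_derivative_scaleR[OF \<mu>d N_has_derivative[OF x]]]]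
      by (simp add: levi_civita_add[OF F_in[OF x]] levi_civita_scaleR[OF F_in[OF x]] scaleR_add_right)
    finally show ?thesis .
  qed
  have Alin: "linear (\<lambda>u. dd ?Y x u + \<Gamma> x u (?Y x))"
    by (intro linear_compose_add has_derivative_linear[OF Yd] \<Gamma>_linear(1)[OF x])
  \<comment> \<open>The sign in \<mu> and the sign in the Weingarten formula cancel here.\<close>
  have \<mu>\<epsilon>: "\<mu> x * \<epsilon> x = GF x (N x) (X x)"
    using \<epsilon>_squared[OF x] by (simp add: \<mu>_def GF_commute[OF x, of "X x"] mult.commute mult.left_commute)
  have PXt: "GF x (P X x y) (dd F x z) = ip (g x) (?A *v y) z + GF x (N x) (X x) * ip (g x) (Sh x *v y) z" for y z
    unfolding PX P_dd_F_field[OF x Yd] weingarten[OF x] matrix_linear_works[OF Alin] Sh_works[OF x]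
    by (simp add: ip_linear_simps N_orth[OF x] isometric[OF x] dd_F_simps[OF x] \<mu>\<epsilon>[symmetric])
  define B where "B = ?A - \<alpha> *\<^sub>R mat 1 + GF x (N x) (X x) *\<^sub>R Sh x"
  have "ip (transpose B ** g x + g x ** B) y z = 0" for y z
  proof -
    have "ip (g x) (?A *v y) z + ip (g x) (?A *v z) y + GF x (N x) (X x) * (ip (g x) (Sh x *v y) z + ip (g x) (Sh x *v z) y)
       = 2 * \<alpha> * ip (g x) y z"
      using conf[of y z] unfolding PXt by (simp add: algebra_simps)
    then show ?thesis
      unfolding ip_add_form ip_matrix_left
      unfolding ip_matrix_right B_def
      by (simp add: matrix_vector_mult_add_rdistrib matrix_vector_mult_diff_rdistrib scaleR_matrix_vector_assoc[symmetric]
          ip_linear_simps ip_commute[OF sym_g[OF x], of y] algebra_simps)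
  qed
  then have "transpose B ** g x + g x ** B = 0"
    by (intro matrix_eq_ipI) (simp add: ip_def)
  then have skew: "transpose B ** g x = - (g x ** B)" by (simp add: eq_neg_iff_add_eq_0)
  have "trace (?T ** B) = 0"
    by (rule trace_self_adjoint_skew[OF inv_g[OF x] newton_Sh_self_adjoint[OF x] skew])
  then have "trace (?T ** ?A) = \<alpha> * trace ?T - GF x (N x) (X x) * trace (?T ** Sh x)"
    unfolding B_def by (simp add: matrix_ring_simps trace_add trace_sub trace_scaleR)
  then show ?thesis by (simp only: trace_newton trace_newton_mult mult.assoc)
qed

text \<open>\<open>D\<close> is \<open>\<rho> div (f T\<^sub>k X\<^sup>T)\<close>, extended by zero outside \<open>U\<close>.\<close>

lemma patch_integral:
  fixes k :: nat
  assumes Xs: "\<And>k. Ck_on k X U"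
    and conf: "\<And>x y z. x \<in> U \<Longrightarrow> GF x (P X x y) (dd F x z) + GF x (P X x z) (dd F x y) = 2 * \<alpha> x * ip (g x) y z"
    and f: "Ck_on 1 f U" and K: "compact K" "K \<subseteq> U" and f0: "\<And>x. x \<notin> K \<Longrightarrow> f x = 0"
  defines "D \<equiv> \<lambda>x. if x \<in> U then \<rho> x * (dd f x (newton k (Sh x) *v tang x (X x))
      + f x * (\<alpha> x * (real CARD('m) - real k) * elem_sym k (Sh x)
        - GF x (N x) (X x) * (real (Suc k) * elem_sym (Suc k) (Sh x)))) else 0"
  shows "integrable lborel D" "(\<integral>x. D x \<partial>lborel) = 0"
proof -
  let ?Y = "\<lambda>y. tang y (X y)"
  have f': "Ck_on (Suc 0) f U" using f by simp
  \<comment> \<open>The components of the vector density \<rho> f T_k X^T. Off \<open>U\<close> the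
    other factors are arbitrary, but \<open>f\<close> vanishes there and with it
    \<open>w\<close>.\<close>
  define w where "w i y = (\<rho> y * f y) * (newton k (Sh y) *v ?Y y) $ i" for i y
  have wU: "Ck_on 1 (w i) U" for i
    unfolding w_def by (intro Ck_on_mult Ck_on_nth Ck_on_matrix_vector open_U smooth_\<rho> f Ck_on_newton Ck_on_tang Xs)
  have w0: "w i x = 0" if "x \<notin> K" for i x
    using f0[OF that] by (simp add: w_def)
  have wK: "Ck_on 1 (w i) (- K)" for i
  proof -
    have "open (- K)" using K(1) by (simp add: compact_imp_closed open_Compl)
    then have "Ck_on 1 (w i) (- K) \<longleftrightarrow> Ck_on 1 (\<lambda>_. 0 :: real) (- K)"
      by (rule Ck_on_cong) (simp add: w0)
    then show ?thesis by (simp only: Ck_on_const)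
  qed
  have w: "Ck_on 1 (w i) UNIV" for i
  proof -
    have "U \<union> - K = UNIV" using K(2) by auto
    then show ?thesis
      using Ck_on_Un[OF open_U _ wU wK] K(1) by (metis compact_imp_closed open_Compl)
  qed
  note int = integral_directional_derivative_zero[OF w K(1) w0]
  have D: "D x = (\<Sum>i\<in>UNIV. dd (w i) x (axis i 1))" for x
  proof (cases "x \<in> U")
    case x: True
    have Yd: "(?Y has_derivative dd ?Y x) (at x)" by (rule Ck_on_has_derivative[OF Ck_on_tang[OF Xs] open_U x])
    have Td: "((\<lambda>y. newton k (Sh y)) has_derivative dd (\<lambda>y. newton k (Sh y)) x) (at x)"
      by (rule Ck_on_has_derivative[OF Ck_on_newton open_U x])
    have fd: "(f has_derivative dd f x) (at x)" by (rule Ck_on_has_derivative[OF f' open_U x])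
    have Xd: "(X has_derivative dd X x) (at x)" by (rule Ck_on_has_derivative[OF Xs open_U x])
    show ?thesis
      unfolding w_def[abs_def] divergence_formula[OF x fd Td Yd newton_divergence_free[OF x]]
        conformal_trace[OF x Xd Xs conf[OF x]] D_def using x by simp
  next
    case False
    then have "x \<in> - K" using K(2) by auto
    have "dd (w i) x = dd (\<lambda>_. 0) x" for i
      by (rule dd_cong[of "- K"]) (use \<open>x \<in> - K\<close> w0 K(1) in \<open>auto simp: compact_imp_closed open_Compl\<close>)
    then show ?thesis using False by (simp add: D_def)
  qed
  show "integrable lborel D" "(\<integral>x. D x \<partial>lborel) = 0"
    unfolding D by (auto simp: int)
qed

end

section \<open>Immersed hypersurfaces and changes of charts\<close>

text \<open>The isometry \<open>\<tau>\<close> is treated as an isometric immersion of codimension zero: its pulled-back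
  connection, applied to coordinate fields, satisfies the characterization of \<open>levi_civita\<close>.\<close>

lemma levi_civita_transform:
  fixes G G' :: "real^'n \<Rightarrow> real^'n^'n"
  assumes G: "metric_field V G" and G': "metric_field V' G'"
    and W: "open W" "W \<subseteq> V" and \<tau>: "\<And>k. Ck_on k \<tau> W" "\<tau> ` W \<subseteq> V'"
    and iso: "\<And>x u v. x \<in> W \<Longrightarrow> ip (G x) u v = ip (G' (\<tau> x)) (dd \<tau> x u) (dd \<tau> x v)"
    and x: "x \<in> W" and J: "\<And>w. dd \<tau> x (K w) = w"
  shows "dd \<tau> x (levi_civita G x u v) = dd (\<lambda>y. dd \<tau> y v) x u + levi_civita G' (\<tau> x) (dd \<tau> x u) (dd \<tau> x v)"
proof -
  interpret G: metric_field V G by (rule G)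
  interpret T: metric_map V' G' W \<tau>
    using G' W \<tau> by (simp add: metric_map_def metric_map_axioms_def del: Ck_on.simps)
  have xV: "x \<in> V" using x W by auto
  have "levi_civita G x u v = K (T.P (\<lambda>y. dd \<tau> y v) x u)"
  proof (rule G.levi_civitaI[OF xV])
    show "K (T.P (\<lambda>y. dd \<tau> y v) x u) = K (T.P (\<lambda>y. dd \<tau> y u) x v)" for u v
      by (simp add: T.P_dd_F_sym[OF x, of u v])
    fix u v w
    have "ip (dd G x u) v w = dd (\<lambda>y. ip (G y) v w) x u" by (simp add: G.dd_ip_const[OF xV])
    also have "dd (\<lambda>y. ip (G y) v w) x = dd (\<lambda>y. ip (G' (\<tau> y)) (dd \<tau> y v) (dd \<tau> y w)) x"
      by (rule dd_cong[OF W(1) x]) (rule iso)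
    also have "\<dots> u = ip (G' (\<tau> x)) (T.P (\<lambda>y. dd \<tau> y v) x u) (dd \<tau> x w)
        + ip (G' (\<tau> x)) (dd \<tau> x v) (T.P (\<lambda>y. dd \<tau> y w) x u)"
      by (rule T.dd_ip_P[OF x T.dd_F_has_derivative[OF x] T.dd_F_has_derivative[OF x]])
    finally show "ip (dd G x u) v w = ip (G x) (K (T.P (\<lambda>y. dd \<tau> y v) x u)) w
        + ip (G x) v (K (T.P (\<lambda>y. dd \<tau> y w) x u))"
      by (simp add: iso[OF x] J)
  qed
  then show ?thesis by (simp add: J) (simp add: T.P_def)
qed

lemma chart_inv_coords: "is_chart c \<Longrightarrow> p \<in> cdom c \<Longrightarrow> chart_inv c (coords c p) = p"
  by (auto simp: is_chart_def homeomorphism_def)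

lemma is_chart_open: "is_chart c \<Longrightarrow> open (cdom c)" "is_chart c \<Longrightarrow> open (coords c ` cdom c)"
  by (simp_all add: is_chart_def)

text \<open>Images under a chart become preimages under its inverse, so that openness and
  measurability follow from continuity.\<close>

lemma coords_image_Int:
  assumes "is_chart c"
  shows "coords c ` (cdom c \<inter> A) = coords c ` cdom c \<inter> chart_inv c -` A"
proof (intro equalityI subsetI)
  fix x assume "x \<in> coords c ` cdom c \<inter> chart_inv c -` A"
  then obtain p where "p \<in> cdom c" "x = coords c p" "chart_inv c x \<in> A" by blast
  then show "x \<in> coords c ` (cdom c \<inter> A)" using chart_inv_coords[OF assms] by force
qed (use chart_inv_coords[OF assms] in force)

lemma open_coords_image:
  assumes c: "is_chart c" and A: "open A"
  shows "open (coords c ` (cdom c \<inter> A))"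
  unfolding coords_image_Int[OF c]
  using c A by (intro continuous_open_preimage) (auto simp: is_chart_def homeomorphism_def)

lemma smooth_onD: "smooth_on S f \<Longrightarrow> Ck_on k f S"
  by (simp add: smooth_on_def)

definition transition_domain :: "('p, 'n) chart \<Rightarrow> ('p, 'n) chart \<Rightarrow> (real^'n) set" where
  "transition_domain c d = coords c ` (cdom c \<inter> cdom d)"

lemma smooth_atlasD:
  assumes "smooth_atlas \<A>"
  shows "c \<in> \<A> \<Longrightarrow> is_chart c"
    and "c \<in> \<A> \<Longrightarrow> d \<in> \<A> \<Longrightarrow> Ck_on k (coords d \<circ> chart_inv c) (transition_domain c d)"
    and "\<exists>c\<in>\<A>. p \<in> cdom c"
proof -
  show "c \<in> \<A> \<Longrightarrow> is_chart c" using assms unfolding smooth_atlas_def by blast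
  have "c \<in> \<A> \<Longrightarrow> d \<in> \<A> \<Longrightarrow> smooth_on (transition_domain c d) (coords d \<circ> chart_inv c)"
    using assms unfolding smooth_atlas_def transition_domain_def by blast
  then show "c \<in> \<A> \<Longrightarrow> d \<in> \<A> \<Longrightarrow> Ck_on k (coords d \<circ> chart_inv c) (transition_domain c d)"
    by (rule smooth_onD)
  have "p \<in> (\<Union>c\<in>\<A>. cdom c)" using assms unfolding smooth_atlas_def by simp
  then show "\<exists>c\<in>\<A>. p \<in> cdom c" by (rule UN_E) blast
qed

lemma transition_domain_open: "is_chart c \<Longrightarrow> is_chart d \<Longrightarrow> open (transition_domain c d)"
  unfolding transition_domain_def by (rule open_coords_image) (assumption, rule is_chart_open(1))

lemma transition_has_derivative:
  assumes "smooth_atlas \<A>" "c \<in> \<A>" "d \<in> \<A>" "p \<in> cdom c" "p \<in> cdom d"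
  shows "((coords d \<circ> chart_inv c) has_derivative dd (coords d \<circ> chart_inv c) (coords c p)) (at (coords c p))"
  by (rule Ck_on_has_derivative[OF smooth_atlasD(2)[OF assms(1-3)]
      transition_domain_open[OF smooth_atlasD(1)[OF assms(1,2)] smooth_atlasD(1)[OF assms(1,3)]]])
    (use assms in \<open>simp add: transition_domain_def\<close>)

lemma jacobian_works:
  assumes "smooth_atlas \<A>" "c \<in> \<A>" "d \<in> \<A>" "p \<in> cdom c" "p \<in> cdom d"
  shows "jacobian c d p *v v = dd (coords d \<circ> chart_inv c) (coords c p) v"
  unfolding jacobian_def
  by (rule matrix_linear_works[OF has_derivative_linear[OF transition_has_derivative[OF assms]]])

lemma jacobian_inverse:
  assumes A: "smooth_atlas \<A>" "c \<in> \<A>" "d \<in> \<A>" "p \<in> cdom c" "p \<in> cdom d"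
  shows "jacobian d c p ** jacobian c d p = mat 1"
proof -
  let ?\<tau> = "coords d \<circ> chart_inv c" and ?\<sigma> = "coords c \<circ> chart_inv d"
  let ?x = "coords c p"
  have c: "is_chart c" and d: "is_chart d" by (rule smooth_atlasD(1)[OF A(1,2)], rule smooth_atlasD(1)[OF A(1,3)])
  have tx: "?\<tau> ?x = coords d p" using chart_inv_coords[OF c A(4)] by simp
  have "((\<lambda>x. ?\<sigma> (?\<tau> x)) has_derivative (\<lambda>h. dd ?\<sigma> (coords d p) (dd ?\<tau> ?x h))) (at ?x)"
    by (rule has_derivative_compose[OF transition_has_derivative[OF A]])
      (unfold tx, rule transition_has_derivative[OF A(1,3,2,5,4)])
  then have "((\<lambda>x. x) has_derivative (\<lambda>h. dd ?\<sigma> (coords d p) (dd ?\<tau> ?x h))) (at ?x)"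
    by (rule has_derivative_transform_within_open[OF _ transition_domain_open[OF c d]])
      (use A chart_inv_coords[OF c] chart_inv_coords[OF d] in \<open>auto simp: transition_domain_def\<close>)
  then have "(\<lambda>h. dd ?\<sigma> (coords d p) (dd ?\<tau> ?x h)) = (\<lambda>h. h)"
    using has_derivative_unique[OF _ has_derivative_ident] by blast
  then have "(jacobian d c p ** jacobian c d p) *v h = mat 1 *v h" for h
    by (simp add: matrix_vector_mul_assoc[symmetric] jacobian_works[OF A] jacobian_works[OF A(1,3,2,5,4)] fun_eq_iff)
  then show ?thesis unfolding matrix_eq by blast
qed

text \<open>The codomain is general because the chain rule is needed for the immersion, for the
  components of the normal and for \<open>f\<close>.\<close>

lemma dd_change_chart:
  fixes f :: "'q::topological_space \<Rightarrow> 'b::real_normed_vector" and c c' :: "('q, 'n::finite) chart"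
  assumes A: "smooth_atlas \<A>" "c \<in> \<A>" "c' \<in> \<A>" "p \<in> cdom c" "p \<in> cdom c'"
    and f: "((f \<circ> chart_inv c') has_derivative dd (f \<circ> chart_inv c') (coords c' p)) (at (coords c' p))"
  shows "dd (f \<circ> chart_inv c) (coords c p) y = dd (f \<circ> chart_inv c') (coords c' p) (jacobian c c' p *v y)"
proof -
  let ?\<sigma> = "coords c' \<circ> chart_inv c"
  have c: "is_chart c" and c': "is_chart c'"
    by (rule smooth_atlasD(1)[OF A(1,2)], rule smooth_atlasD(1)[OF A(1,3)])
  have x: "coords c p \<in> transition_domain c c'" using A by (simp add: transition_domain_def)
  have sx: "?\<sigma> (coords c p) = coords c' p" using chart_inv_coords[OF c A(4)] by simp
  have ci: "chart_inv c' (?\<sigma> y) = chart_inv c y" if "y \<in> transition_domain c c'" for y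
    using that chart_inv_coords[OF c] chart_inv_coords[OF c'] by (auto simp: transition_domain_def)
  have "((\<lambda>y. (f \<circ> chart_inv c') (?\<sigma> y)) has_derivative (\<lambda>h. dd (f \<circ> chart_inv c') (coords c' p) (dd ?\<sigma> (coords c p) h))) (at (coords c p))"
    by (rule has_derivative_compose[OF transition_has_derivative[OF A]]) (unfold sx, rule f)
  then have "((f \<circ> chart_inv c) has_derivative (\<lambda>h. dd (f \<circ> chart_inv c') (coords c' p) (dd ?\<sigma> (coords c p) h))) (at (coords c p))"
    by (rule has_derivative_transform_within_open[OF _ transition_domain_open[OF c c'] x]) (simp only: comp_apply[of f] ci)
  from dd_eqI[OF this] show ?thesis by (simp only: jacobian_works[OF A])
qed

lemma jacobian_invertible:
  assumes "smooth_atlas \<A>" "c \<in> \<A>" "d \<in> \<A>" "p \<in> cdom c" "p \<in> cdom d"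
  shows "invertible (jacobian c d p)"
  unfolding invertible_def
  using jacobian_inverse[OF assms] jacobian_inverse[OF assms(1,3,2,5,4)] by blast

lemma semi_riemannian_metric_field:
  assumes M: "semi_riemannian_manifold M" and d: "d \<in> atlas M"
  shows "metric_field (coords d ` cdom d) (local_metric M d)"
proof
  have A: "smooth_atlas (atlas M)" using M by (simp add: semi_riemannian_manifold_def)
  note ch = smooth_atlasD(1)[OF A d]
  show "open (coords d ` cdom d)" using ch by (simp add: is_chart_def)
  show "Ck_on k (local_metric M d) (coords d ` cdom d)" for k
  proof (rule smooth_onD)
    show "smooth_on (coords d ` cdom d) (local_metric M d)"
      using M d unfolding semi_riemannian_manifold_def by blast
  qed
  show "transpose (local_metric M d x) = local_metric M d x" "invertible (local_metric M d x)"
    if "x \<in> coords d ` cdom d" for x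
  proof -
    obtain q where q: "q \<in> cdom d" "x = coords d q" using \<open>x \<in> coords d ` cdom d\<close> by blast
    then have eq: "local_metric M d x = metric M d q"
      using chart_inv_coords[OF ch] by (simp add: local_metric_def)
    have "d \<in> charts_at (atlas M) q" using q d by (simp add: charts_at_def)
    then have "transpose (metric M d q) = metric M d q \<and> invertible (metric M d q)"
      using M unfolding semi_riemannian_manifold_def by blast
    then show "transpose (local_metric M d x) = local_metric M d x" "invertible (local_metric M d x)"
      unfolding eq by blast+
  qed
qed

lemma metric_transform:
  assumes "semi_riemannian_manifold M" "c \<in> charts_at (atlas M) p" "d \<in> charts_at (atlas M) p"
  shows "ip (metric M c p) u v = ip (metric M d p) (jacobian c d p *v u) (jacobian c d p *v v)"
proof -
  have "metric M c p = transpose (jacobian c d p) ** metric M d p ** jacobian c d p"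
    using assms unfolding semi_riemannian_manifold_def by blast
  then show ?thesis by (simp only: ip_congruence)
qed

locale immersed_hypersurface =
  fixes M :: "('p::{t2_space, second_countable_topology}, 'n::finite) semi_riem"
    and S :: "('q::{t2_space, second_countable_topology}, 'm::finite) semi_riem"
    and \<phi> :: "'q \<Rightarrow> 'p" and \<nu> :: "('q, 'p, 'n) vector_along"
  assumes M: "semi_riemannian_manifold M"
    and const: "constant_curvature M"
    and S: "semi_riemannian_manifold S"
    and dims: "CARD('m) + 1 = CARD('n)"
    and imm: "isometric_immersion S M \<phi>"
    and normal: "unit_normal S M \<phi> \<nu>"
begin

lemma atlas_M: "smooth_atlas (atlas M)" and atlas_S: "smooth_atlas (atlas S)"
  using M S by (auto simp: semi_riemannian_manifold_def)

lemmas chart_M = smooth_atlasD(1)[OF atlas_M] and chart_S = smooth_atlasD(1)[OF atlas_S]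

lemma isometricD:
  assumes "c \<in> charts_at (atlas S) p" "d \<in> charts_at (atlas M) (\<phi> p)"
  shows "ip (metric M d (\<phi> p)) (differential \<phi> c d p y) (differential \<phi> c d p z) = ip (metric S c p) y z"
  using imm assms unfolding isometric_immersion_def by blast

lemma normalD:
  assumes "c \<in> charts_at (atlas S) p" "d \<in> charts_at (atlas M) (\<phi> p)"
  shows "ip (metric M d (\<phi> p)) (\<nu> d p) (differential \<phi> c d p y) = 0"
    and "\<bar>ip (metric M d (\<phi> p)) (\<nu> d p) (\<nu> d p)\<bar> = 1"
  using normal assms unfolding unit_normal_def by blast+

lemma continuous_\<phi>: "continuous_on UNIV \<phi>"
  using imm by (simp add: isometric_immersion_def smooth_map_def)

definition dom :: "('q, 'm) chart \<Rightarrow> ('p, 'n) chart \<Rightarrow> 'q set" where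
  "dom c d = cdom c \<inter> \<phi> -` cdom d"

definition Udom :: "('q, 'm) chart \<Rightarrow> ('p, 'n) chart \<Rightarrow> (real^'m) set" where
  "Udom c d = coords c ` dom c d"

abbreviation Fmap :: "('q, 'm) chart \<Rightarrow> ('p, 'n) chart \<Rightarrow> real^'m \<Rightarrow> real^'n" where
  "Fmap c d \<equiv> coords d \<circ> \<phi> \<circ> chart_inv c"

lemma open_preimage: "d \<in> atlas M \<Longrightarrow> open (\<phi> -` cdom d)"
  by (rule open_vimage[OF is_chart_open(1)[OF chart_M] continuous_\<phi>])

lemma open_dom: "c \<in> atlas S \<Longrightarrow> d \<in> atlas M \<Longrightarrow> open (dom c d)"
  unfolding dom_def by (rule open_Int[OF is_chart_open(1)[OF chart_S] open_preimage])

lemma open_Udom: "c \<in> atlas S \<Longrightarrow> d \<in> atlas M \<Longrightarrow> open (Udom c d)"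
  unfolding Udom_def dom_def by (rule open_coords_image[OF chart_S open_preimage])

lemma UdomE:
  assumes "x \<in> Udom c d" "c \<in> atlas S"
  obtains p where "p \<in> dom c d" "x = coords c p" "chart_inv c x = p" "c \<in> charts_at (atlas S) p"
proof -
  obtain p where p: "p \<in> dom c d" "x = coords c p" using assms(1) unfolding Udom_def by blast
  then have "p \<in> cdom c" by (simp add: dom_def)
  then show ?thesis
    using that[OF p] chart_inv_coords[OF chart_S[OF assms(2)]] p(2) assms(2) by (simp add: charts_at_def)
qed

lemma chart_inv_dom: "c \<in> atlas S \<Longrightarrow> p \<in> dom c d \<Longrightarrow> chart_inv c (coords c p) = p"
  by (rule chart_inv_coords[OF chart_S]) (auto simp: dom_def)

lemma dom_charts: "c \<in> atlas S \<Longrightarrow> d \<in> atlas M \<Longrightarrow> p \<in> dom c d \<Longrightarrow>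
    c \<in> charts_at (atlas S) p \<and> d \<in> charts_at (atlas M) (\<phi> p)"
  by (auto simp: dom_def charts_at_def)

lemma curvature_constant:
  "\<exists>\<kappa>. \<forall>d\<in>atlas M. \<forall>z\<in>coords d ` cdom d. \<forall>u v w. curvature (local_metric M d) z u v w
     = \<kappa> *\<^sub>R (ip (local_metric M d z) v w *\<^sub>R u - ip (local_metric M d z) u w *\<^sub>R v)"
proof -
  obtain \<kappa> where k: "\<forall>p. \<forall>c\<in>charts_at (atlas M) p. \<forall>u v. plane_area (metric M c p) u v \<noteq> 0 \<longrightarrow>
        sectional_curvature (local_metric M c) (coords c p) u v = \<kappa>"
    using const unfolding constant_curvature_def by (rule exE)
  have "curvature (local_metric M d) z u v w
     = \<kappa> *\<^sub>R (ip (local_metric M d z) v w *\<^sub>R u - ip (local_metric M d z) u w *\<^sub>R v)"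
    if d: "d \<in> atlas M" and z: "z \<in> coords d ` cdom d" for d z u v w
  proof (rule metric_field.constant_curvature_tensor[OF semi_riemannian_metric_field[OF M d] z])
    \<comment> \<open>Types are nonempty, so the ambient dimension is at least 2 and nondegenerate
      planes exist.\<close>
    have "0 < CARD('m)" by simp
    with dims show "2 \<le> CARD('n)" by linarith
    obtain q where q: "q \<in> cdom d" "z = coords d q" using z by auto
    have "local_metric M d z = metric M d q"
      using q chart_inv_coords[OF chart_M[OF d]] by (simp add: local_metric_def)
    then show "sectional_curvature (local_metric M d) z u v = \<kappa>"
      if "plane_area (local_metric M d z) u v \<noteq> 0" for u v
    proof -
      have "d \<in> charts_at (atlas M) q" using q d by (simp add: charts_at_def)
      moreover have "plane_area (metric M d q) u v \<noteq> 0"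
        using that \<open>local_metric M d z = metric M d q\<close> by simp
      ultimately have "sectional_curvature (local_metric M d) (coords d q) u v = \<kappa>" using k by blast
      then show ?thesis by (simp add: q(2))
    qed
  qed
  then show ?thesis by (intro exI ballI allI)
qed

definition \<kappa> :: real where
  "\<kappa> = (SOME \<kappa>. \<forall>d\<in>atlas M. \<forall>z\<in>coords d ` cdom d. \<forall>u v w. curvature (local_metric M d) z u v w
     = \<kappa> *\<^sub>R (ip (local_metric M d z) v w *\<^sub>R u - ip (local_metric M d z) u w *\<^sub>R v))"

lemma \<kappa>_curvature:
  assumes "d \<in> atlas M" "z \<in> coords d ` cdom d"
  shows "curvature (local_metric M d) z u v w
     = \<kappa> *\<^sub>R (ip (local_metric M d z) v w *\<^sub>R u - ip (local_metric M d z) u w *\<^sub>R v)"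
proof -
  have "\<forall>d\<in>atlas M. \<forall>z\<in>coords d ` cdom d. \<forall>u v w. curvature (local_metric M d) z u v w
     = \<kappa> *\<^sub>R (ip (local_metric M d z) v w *\<^sub>R u - ip (local_metric M d z) u w *\<^sub>R v)"
    unfolding \<kappa>_def by (rule someI_ex[OF curvature_constant])
  then show ?thesis using assms by blast
qed

lemma patch:
  assumes c: "c \<in> atlas S" and d: "d \<in> atlas M"
  shows "hypersurface_patch (coords d ` cdom d) (local_metric M d) (Udom c d) (Fmap c d)
    (local_metric S c) (\<nu> d \<circ> chart_inv c) \<kappa>"
proof -
  interpret metric_field "coords d ` cdom d" "local_metric M d"
    by (rule semi_riemannian_metric_field[OF M d])
  interpret s: metric_field "coords c ` cdom c" "local_metric S c"
    by (rule semi_riemannian_metric_field[OF S c])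
  have sub: "Udom c d \<subseteq> coords c ` cdom c" by (auto simp: Udom_def dom_def)
  show ?thesis
  proof
    show "open (Udom c d)" by (rule open_Udom[OF c d])
    show "Ck_on k (Fmap c d) (Udom c d)" for k
    proof (rule smooth_onD)
      show "smooth_on (Udom c d) (Fmap c d)"
        using imm c d unfolding isometric_immersion_def smooth_map_def Udom_def dom_def by blast
    qed
    show "Fmap c d ` Udom c d \<subseteq> coords d ` cdom d"
      using chart_inv_dom[OF c] by (auto simp: Udom_def) (auto simp: dom_def)
    show "CARD('m) + 1 = CARD('n)" by (rule dims)
    show "Ck_on k (local_metric S c) (Udom c d)" for k
      by (rule Ck_on_subset[OF s.smooth_G sub])
    show "transpose (local_metric S c x) = local_metric S c x" "invertible (local_metric S c x)" if "x \<in> Udom c d" for x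
      using s.sym_G s.inv_G sub that by auto
    show "Ck_on k (\<nu> d \<circ> chart_inv c) (Udom c d)" for k
    proof (rule smooth_onD)
      show "smooth_on (Udom c d) (\<nu> d \<circ> chart_inv c)"
        using normal c d unfolding unit_normal_def section_along_def Udom_def dom_def by blast
    qed
    fix x assume x: "x \<in> Udom c d"
    obtain p where p: "p \<in> dom c d" "x = coords c p" "chart_inv c x = p" "c \<in> charts_at (atlas S) p"
      by (rule UdomE[OF x c])
    have dp: "d \<in> charts_at (atlas M) (\<phi> p)" using p(1) d by (auto simp: dom_def charts_at_def)
    have met: "local_metric M d (Fmap c d x) = metric M d (\<phi> p)"
      using p chart_inv_coords[OF chart_M[OF d]] by (simp add: local_metric_def dom_def)
    have mets: "local_metric S c x = metric S c p" using p by (simp add: local_metric_def)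
    have diff: "dd (Fmap c d) x = differential \<phi> c d p" using p by (simp add: differential_def)
    show "ip (local_metric M d (Fmap c d x)) (dd (Fmap c d) x y) (dd (Fmap c d) x z) = ip (local_metric S c x) y z" for y z
      unfolding met mets diff by (rule isometricD[OF p(4) dp])
    show "ip (local_metric M d (Fmap c d x)) ((\<nu> d \<circ> chart_inv c) x) (dd (Fmap c d) x y) = 0" for y
      unfolding met diff unfolding comp_apply p(3) by (rule normalD[OF p(4) dp])
    show "\<bar>ip (local_metric M d (Fmap c d x)) ((\<nu> d \<circ> chart_inv c) x) ((\<nu> d \<circ> chart_inv c) x)\<bar> = 1"
      unfolding met diff unfolding comp_apply p(3) by (rule normalD[OF p(4) dp])
  next
    show "curvature (local_metric M d) z u v w
       = \<kappa> *\<^sub>R (ip (local_metric M d z) v w *\<^sub>R u - ip (local_metric M d z) u w *\<^sub>R v)"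
      if "z \<in> coords d ` cdom d" for z u v w
      by (rule \<kappa>_curvature[OF d that])
  qed
qed

end

section \<open>Chart-wise definitions identified with the patch formulas\<close>

locale hypersurface_charts = immersed_hypersurface M S \<phi> \<nu>
  for M :: "('p::{t2_space, second_countable_topology}, 'n::finite) semi_riem"
    and S :: "('q::{t2_space, second_countable_topology}, 'm::finite) semi_riem"
    and \<phi> \<nu> +
  fixes c :: "('q, 'm) chart" and d :: "('p, 'n) chart"
  assumes c: "c \<in> atlas S" and d: "d \<in> atlas M"
begin

sublocale H: hypersurface_patch "coords d ` cdom d" "local_metric M d" "Udom c d" "Fmap c d"
  "local_metric S c" "\<nu> d \<circ> chart_inv c" \<kappa>
  by (rule patch[OF c d])

context
  fixes p assumes p: "p \<in> dom c d"
begin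

lemma point_in: "coords c p \<in> Udom c d"
  using p by (auto simp: Udom_def)

lemma inv_point: "chart_inv c (coords c p) = p"
  by (rule chart_inv_dom[OF c p])

lemma F_point: "Fmap c d (coords c p) = coords d (\<phi> p)"
  by (simp add: inv_point)

lemma G_point: "local_metric M d (Fmap c d (coords c p)) = metric M d (\<phi> p)"
  using p chart_inv_coords[OF chart_M[OF d]] by (simp add: inv_point local_metric_def dom_def)

lemma g_point: "local_metric S c (coords c p) = metric S c p"
  by (simp add: inv_point local_metric_def)

lemma differential_point: "differential \<phi> c d p = dd (Fmap c d) (coords c p)"
  by (simp add: differential_def)

lemma pullback_point: "pullback_deriv M \<phi> c d p y X = H.P (X d \<circ> chart_inv c) (coords c p) y"
  by (simp add: pullback_deriv_def H.P_def differential_def inv_point)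

lemma tangential_part_point: "tangential_part M \<phi> c d p w = H.tang (coords c p) w"
  unfolding tangential_part_def
proof (rule the_equality)
  show "\<forall>z. ip (metric M d (\<phi> p)) (w - differential \<phi> c d p (H.tang (coords c p) w)) (differential \<phi> c d p z) = 0"
    unfolding differential_point ip_linear_simps G_point[symmetric] H.isometric[OF point_in] H.ip_tang[OF point_in]
    by simp
next
  fix y assume y: "\<forall>z. ip (metric M d (\<phi> p)) (w - differential \<phi> c d p y) (differential \<phi> c d p z) = 0"
  have "ip (local_metric S c (coords c p)) y z = ip (metric M d (\<phi> p)) w (differential \<phi> c d p z)" for z
    using spec[OF y, of z]
    unfolding differential_point ip_linear_simps G_point[symmetric] H.isometric[OF point_in] by simp
  then show "y = H.tang (coords c p) w"
    unfolding G_point[symmetric] differential_point by (rule H.tang_eqI[OF point_in, symmetric])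
qed

lemma second_fund_point: "second_fund M \<phi> \<nu> c d p y z = H.h (coords c p) y z"
proof -
  let ?x = "coords c p"
  \<comment> \<open>The coordinate field agrees with the patch expression on the open set
    \<open>Udom c d\<close>, as \<open>H.P_cong\<close> requires.\<close>
  have eq: "(\<lambda>q. differential \<phi> c d q z) (chart_inv c x) = dd (Fmap c d) x z" if xU: "x \<in> Udom c d" for x
  proof -
    obtain q where "q \<in> dom c d" "x = coords c q" "chart_inv c x = q" by (rule UdomE[OF xU c])
    then show ?thesis by (simp add: differential_def)
  qed
  have "pullback_deriv M \<phi> c d p y (\<lambda>d' q. differential \<phi> c d' q z) = H.P (\<lambda>x. dd (Fmap c d) x z) ?x y"
    unfolding pullback_point by (rule H.P_cong[OF point_in]) (simp add: eq)
  then have pd: "pullback_deriv M \<phi> c d p y (\<lambda>d' q. differential \<phi> c d' q z)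
      = dd (Fmap c d) ?x (H.\<Gamma> ?x y z) - H.h ?x y z *\<^sub>R \<nu> d p"
    using H.gauss[OF point_in, of z y] by (simp add: inv_point)
  have tan: "H.tang ?x (dd (Fmap c d) ?x (H.\<Gamma> ?x y z) - H.h ?x y z *\<^sub>R \<nu> d p) = H.\<Gamma> ?x y z"
  proof (rule H.tang_eqI[OF point_in])
    have Nx: "(\<nu> d \<circ> chart_inv c) ?x = \<nu> d p" by (simp add: inv_point)
    show "ip (local_metric S c ?x) (H.\<Gamma> ?x y z) w
        = H.GF ?x (dd (Fmap c d) ?x (H.\<Gamma> ?x y z) - H.h ?x y z *\<^sub>R \<nu> d p) (dd (Fmap c d) ?x w)" for w
      unfolding ip_linear_simps H.isometric[OF point_in] H.N_orth[OF point_in, unfolded Nx] by simp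
  qed
  have norm: "- normal_part M \<phi> c d p (pullback_deriv M \<phi> c d p y (\<lambda>d' q. differential \<phi> c d' q z))
      = H.h ?x y z *\<^sub>R \<nu> d p"
    unfolding normal_part_def tangential_part_point pd tan differential_point by simp
  \<comment> \<open>A nonzero normal makes the scalar in \<open>second_fund\<close> unique.\<close>
  have nz: "\<nu> d p \<noteq> 0"
    using H.N_unit[OF point_in] by (auto simp: inv_point ip_linear_simps)
  show ?thesis
    unfolding second_fund_def norm by (rule the_equality) (use nz in auto)
qed

lemma shape_matrix_point: "shape_matrix S M \<phi> \<nu> c d p = H.Sh (coords c p)"
  unfolding shape_matrix_def second_fund_point g_point[symmetric]
proof (rule the_equality)
  show "\<forall>y z. ip (local_metric S c (coords c p)) (H.Sh (coords c p) *v y) z = H.h (coords c p) y z"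
    by (simp add: H.Sh_works[OF point_in] H.ip_shp[OF point_in])
next
  fix B assume B: "\<forall>y z. ip (local_metric S c (coords c p)) (B *v y) z = H.h (coords c p) y z"
  have "B *v y = H.Sh (coords c p) *v y" for y
    by (rule ip_eq_iff[OF H.inv_g[OF point_in] H.sym_g[OF point_in]])
      (simp add: B H.Sh_works[OF point_in] H.ip_shp[OF point_in])
  then show "B = H.Sh (coords c p)" unfolding matrix_eq by blast
qed

text \<open>Unlike the definition of \<open>second_fund\<close>, this expression contains no second derivatives of
  the immersion, so its behaviour under changes of charts is easy to read off.\<close>

lemma shape_matrix_formula:
  "ip (metric S c p) (shape_matrix S M \<phi> \<nu> c d p *v y) z
     = ip (metric M d (\<phi> p)) (\<nu> d p) (\<nu> d p)
       * ip (metric M d (\<phi> p)) (pullback_deriv M \<phi> c d p y \<nu>) (differential \<phi> c d p z)"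
  unfolding shape_matrix_point g_point[symmetric] H.Sh_works[OF point_in] H.shp_def ip_linear_simps
    H.ip_tang[OF point_in] pullback_point differential_point G_point[symmetric] H.\<epsilon>_def
  by (simp add: inv_point)

lemma tangential_part_formula:
  "ip (metric S c p) (tangential_part M \<phi> c d p w) z = ip (metric M d (\<phi> p)) w (differential \<phi> c d p z)"
  unfolding tangential_part_point g_point[symmetric] differential_point G_point[symmetric]
  by (rule H.ip_tang[OF point_in])

end

end

lemma gradient_eq_raise:
  assumes S: "semi_riemannian_manifold S" and c: "c \<in> charts_at (atlas S) p"
    and f: "((f \<circ> chart_inv c) has_derivative dd (f \<circ> chart_inv c) (coords c p)) (at (coords c p))"
  shows "gradient S c p f = raise (metric S c p) (dd (f \<circ> chart_inv c) (coords c p))"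
    and "ip (metric S c p) (gradient S c p f) z = dd (f \<circ> chart_inv c) (coords c p) z"
proof -
  have Q: "transpose (metric S c p) = metric S c p \<and> invertible (metric S c p)"
    using S c unfolding semi_riemannian_manifold_def by blast
  note r = ip_raise[OF conjunct2[OF Q] conjunct1[OF Q] has_derivative_linear[OF f]]
  show eq: "gradient S c p f = raise (metric S c p) (dd (f \<circ> chart_inv c) (coords c p))"
    unfolding gradient_def
    by (rule the_equality, use r in blast, rule ip_eq_iff[OF conjunct2[OF Q] conjunct1[OF Q]]) (simp add: r)
  show "ip (metric S c p) (gradient S c p f) z = dd (f \<circ> chart_inv c) (coords c p) z"
    unfolding eq by (rule r)
qed

section \<open>Changes of charts\<close>

context immersed_hypersurface
begin

lemma charts: "c \<in> atlas S \<Longrightarrow> d \<in> atlas M \<Longrightarrow> hypersurface_charts M S \<phi> \<nu> c d"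
  by unfold_locales

lemma Fmap_has_derivative:
  assumes "c \<in> atlas S" "d \<in> atlas M" "p \<in> dom c d"
  shows "(Fmap c d has_derivative differential \<phi> c d p) (at (coords c p))"
proof -
  interpret hypersurface_charts M S \<phi> \<nu> c d by (rule charts[OF assms(1,2)])
  show ?thesis
    unfolding differential_point[OF assms(3)] by (rule H.F_has_derivative[OF point_in[OF assms(3)]])
qed

text \<open>The new components of the normal are \<open>dd \<tau>\<close> of the old ones, for the
  transition map \<tau>. Their derivative contains a second derivative of \<tau>, which is the
  inhomogeneous term of \<open>levi_civita_transform\<close>; so the covariant derivative transforms
  as a vector.\<close>

lemma change_target_chart:
  assumes c: "c \<in> atlas S" and d: "d \<in> atlas M" and d': "d' \<in> atlas M" and p: "p \<in> dom c d" and p': "p \<in> dom c d'"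
  shows "differential \<phi> c d' p y = jacobian d d' (\<phi> p) *v differential \<phi> c d p y"
    and "pullback_deriv M \<phi> c d' p y \<nu> = jacobian d d' (\<phi> p) *v pullback_deriv M \<phi> c d p y \<nu>"
proof -
  interpret A: hypersurface_charts M S \<phi> \<nu> c d by (rule charts[OF c d])
  interpret A': hypersurface_charts M S \<phi> \<nu> c d' by (rule charts[OF c d'])
  let ?x = "coords c p" and ?\<tau> = "coords d' \<circ> chart_inv d" and ?z = "coords d (\<phi> p)"
  let ?W = "transition_domain d d'"
  define D where "D = coords c ` (cdom c \<inter> (\<phi> -` cdom d \<inter> \<phi> -` cdom d'))"
  have D: "open D" unfolding D_def
    by (rule open_coords_image[OF chart_S[OF c]]) (intro open_Int open_preimage d d')
  have x: "?x \<in> D" using p p' by (auto simp: D_def dom_def)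
  have pc: "p \<in> cdom c" "\<phi> p \<in> cdom d" "\<phi> p \<in> cdom d'" using p p' by (auto simp: dom_def)
  have FW: "Fmap c d ` D \<subseteq> ?W"
    using chart_inv_coords[OF chart_S[OF c]] unfolding D_def transition_domain_def by auto
  have tauF: "?\<tau> (Fmap c d y) = Fmap c d' y" if "y \<in> D" for y
    using that chart_inv_coords[OF chart_S[OF c]] chart_inv_coords[OF chart_M[OF d]] unfolding D_def by auto
  have W: "open ?W" by (rule transition_domain_open[OF chart_M[OF d] chart_M[OF d']])
  have tau: "Ck_on k ?\<tau> ?W" for k by (rule smooth_atlasD(2)[OF atlas_M d d'])
  have Fx: "Fmap c d ?x = ?z" by (rule A.F_point[OF p])
  have zW: "?z \<in> ?W" using pc by (auto simp: transition_domain_def)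
  note jac = jacobian_works[OF atlas_M d d' pc(2,3)]
  have Fd: "(Fmap c d has_derivative differential \<phi> c d p) (at ?x)" by (rule Fmap_has_derivative[OF c d p])
  have "((\<lambda>y. ?\<tau> (Fmap c d y)) has_derivative (\<lambda>h. dd ?\<tau> ?z (differential \<phi> c d p h))) (at ?x)"
    by (rule has_derivative_compose[OF Fd]) (unfold Fx, rule Ck_on_has_derivative[OF tau W zW])
  then have "(Fmap c d' has_derivative (\<lambda>h. dd ?\<tau> ?z (differential \<phi> c d p h))) (at ?x)"
    by (rule has_derivative_transform_within_open[OF _ D x]) (rule tauF)
  from dd_eqI[OF this] show diff: "differential \<phi> c d' p y = jacobian d d' (\<phi> p) *v differential \<phi> c d p y" for y
    unfolding jac A'.differential_point[OF p'] by simp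
  let ?N = "\<nu> d \<circ> chart_inv c"
  have Nd: "(?N has_derivative dd ?N ?x) (at ?x)" by (rule A.H.N_has_derivative[OF A.point_in[OF p]])
  have N': "dd ?\<tau> (Fmap c d y) (?N y) = (\<nu> d' \<circ> chart_inv c) y" if yD: "y \<in> D" for y
  proof -
    obtain q where q: "q \<in> cdom c" "\<phi> q \<in> cdom d" "\<phi> q \<in> cdom d'" "y = coords c q" using yD unfolding D_def by auto
    have ci: "chart_inv c y = q" using q chart_inv_coords[OF chart_S[OF c]] by simp
    have "d \<in> charts_at (atlas M) (\<phi> q)" "d' \<in> charts_at (atlas M) (\<phi> q)" using q d d' by (auto simp: charts_at_def)
    then have "\<nu> d' q = jacobian d d' (\<phi> q) *v \<nu> d q"
      using normal unfolding unit_normal_def section_along_def by blast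
    then show ?thesis by (simp add: ci jacobian_works[OF atlas_M d d' q(2,3)] comp_def)
  qed
  have "((\<lambda>y. dd ?\<tau> (Fmap c d y) (?N y)) has_derivative
      (\<lambda>h. dd (\<lambda>z. dd ?\<tau> z (?N ?x)) (Fmap c d ?x) (differential \<phi> c d p h) + dd ?\<tau> (Fmap c d ?x) (dd ?N ?x h))) (at ?x)"
    by (rule has_derivative_dd_apply[OF W tau D x FW Fd Nd])
  then have "((\<nu> d' \<circ> chart_inv c) has_derivative
      (\<lambda>h. dd (\<lambda>z. dd ?\<tau> z (?N ?x)) (Fmap c d ?x) (differential \<phi> c d p h) + dd ?\<tau> (Fmap c d ?x) (dd ?N ?x h))) (at ?x)"
    by (rule has_derivative_transform_within_open[OF _ D x]) (rule N')
  note dN' = dd_eqI[OF this, unfolded Fx]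
  have iso: "ip (local_metric M d z) u v = ip (local_metric M d' (?\<tau> z)) (dd ?\<tau> z u) (dd ?\<tau> z v)" if zW': "z \<in> ?W" for z u v
  proof -
    obtain q where q: "q \<in> cdom d" "q \<in> cdom d'" "z = coords d q" using zW' unfolding transition_domain_def by auto
    have ci: "chart_inv d z = q" "chart_inv d' (coords d' q) = q"
      using q chart_inv_coords[OF chart_M[OF d]] chart_inv_coords[OF chart_M[OF d']] by auto
    have "d \<in> charts_at (atlas M) q" "d' \<in> charts_at (atlas M) q" using q d d' by (auto simp: charts_at_def)
    from metric_transform[OF M this, of u v] show ?thesis
      by (simp add: local_metric_def ci jacobian_works[OF atlas_M d d' q(1,2)] q(3)[symmetric] comp_def)
  qed
  have J: "dd ?\<tau> ?z (jacobian d' d (\<phi> p) *v w) = w" for w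
    unfolding jac[symmetric] matrix_vector_mul_assoc jacobian_inverse[OF atlas_M d' d pc(3,2)] by simp
  have "dd ?\<tau> ?z (levi_civita (local_metric M d) ?z u v)
      = dd (\<lambda>y. dd ?\<tau> y v) ?z u + levi_civita (local_metric M d') (?\<tau> ?z) (dd ?\<tau> ?z u) (dd ?\<tau> ?z v)" for u v
    by (rule levi_civita_transform[OF semi_riemannian_metric_field[OF M d] semi_riemannian_metric_field[OF M d'] W _ tau _ iso zW J])
      (use chart_inv_coords[OF chart_M[OF d]] in \<open>auto simp: transition_domain_def\<close>)
  note lc = this
  have tz: "?\<tau> ?z = coords d' (\<phi> p)" using chart_inv_coords[OF chart_M[OF d] pc(2)] by simp
  have Nx: "?N ?x = \<nu> d p" using A.inv_point[OF p] by simp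
  have nu': "\<nu> d' p = dd ?\<tau> ?z (\<nu> d p)"
    using N'[OF x] A.inv_point[OF p] by (simp add: Fx)
  show "pullback_deriv M \<phi> c d' p y \<nu> = jacobian d d' (\<phi> p) *v pullback_deriv M \<phi> c d p y \<nu>"
    unfolding pullback_deriv_def dN' matrix_vector_right_distrib jac lc Nx diff tz nu' by simp
qed

lemma change_source_chart:
  assumes c: "c \<in> atlas S" and c': "c' \<in> atlas S" and d: "d \<in> atlas M" and p: "p \<in> dom c d" and p': "p \<in> dom c' d"
  shows "differential \<phi> c d p y = differential \<phi> c' d p (jacobian c c' p *v y)"
    and "pullback_deriv M \<phi> c d p y \<nu> = pullback_deriv M \<phi> c' d p (jacobian c c' p *v y) \<nu>"
proof -
  interpret A: hypersurface_charts M S \<phi> \<nu> c d by (rule charts[OF c d])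
  interpret A': hypersurface_charts M S \<phi> \<nu> c' d by (rule charts[OF c' d])
  let ?x' = "coords c' p"
  have pc: "p \<in> cdom c" "p \<in> cdom c'" using p p' by (auto simp: dom_def)
  note chain = dd_change_chart[OF atlas_S c c' pc]
  have "((coords d \<circ> \<phi> \<circ> chart_inv c') has_derivative dd (coords d \<circ> \<phi> \<circ> chart_inv c') ?x') (at ?x')"
    by (rule A'.H.F_has_derivative[OF A'.point_in[OF p']])
  from chain[OF this] show diff: "differential \<phi> c d p y = differential \<phi> c' d p (jacobian c c' p *v y)" for y
    by (simp add: differential_def)
  show "pullback_deriv M \<phi> c d p y \<nu> = pullback_deriv M \<phi> c' d p (jacobian c c' p *v y) \<nu>"
    unfolding pullback_deriv_def diff[of y] chain[OF A'.H.N_has_derivative[OF A'.point_in[OF p']]] ..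
qed

text \<open>Both sides have the same pairings with the vectors \<open>?J *v y\<close>, which fill
  the tangent space. The formulas for the shape matrix and the tangential part express these
  pairings by quantities whose transformation is known.\<close>

lemma chart_independence:
  assumes c: "c \<in> atlas S" and c': "c' \<in> atlas S" and d: "d \<in> atlas M" and d': "d' \<in> atlas M"
    and p: "p \<in> dom c d" and p': "p \<in> dom c' d'"
  shows "jacobian c c' p ** shape_matrix S M \<phi> \<nu> c d p = shape_matrix S M \<phi> \<nu> c' d' p ** jacobian c c' p"
    and "jacobian c c' p *v tangential_part M \<phi> c d p w
      = tangential_part M \<phi> c' d' p (jacobian d d' (\<phi> p) *v w)"
    and "elem_sym k (shape_matrix S M \<phi> \<nu> c d p) = elem_sym k (shape_matrix S M \<phi> \<nu> c' d' p)"
proof -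
  let ?J = "jacobian c c' p" and ?K = "jacobian d d' (\<phi> p)"
  \<comment> \<open>The charts are changed one at a time, through the intermediate pair
    \<open>c\<close>, \<open>d'\<close>.\<close>
  have m: "p \<in> dom c d'" using p p' by (auto simp: dom_def)
  have pc: "p \<in> cdom c" "p \<in> cdom c'" "\<phi> p \<in> cdom d" "\<phi> p \<in> cdom d'" using p p' by (auto simp: dom_def)
  have cc: "c \<in> charts_at (atlas S) p" "c' \<in> charts_at (atlas S) p"
      "d \<in> charts_at (atlas M) (\<phi> p)" "d' \<in> charts_at (atlas M) (\<phi> p)"
    using pc c c' d d' by (auto simp: charts_at_def)
  note mS = metric_transform[OF S cc(1,2)] and mM = metric_transform[OF M cc(3,4)]
  note tgt = change_target_chart[OF c d d' p m] and src = change_source_chart[OF c c' d' m p']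
  have inv: "invertible ?J" by (rule jacobian_invertible[OF atlas_S c c' pc(1,2)])
  have surj: "\<exists>y. w = ?J *v y" for w
    using jacobian_inverse[OF atlas_S c' c pc(2,1)] by (metis matrix_vector_mul_assoc matrix_vector_mul_lid)
  have Q: "transpose (metric S c' p) = metric S c' p \<and> invertible (metric S c' p)"
    using S cc(2) unfolding semi_riemannian_manifold_def by blast
  note eqI = ip_eq_iff[OF conjunct2[OF Q] conjunct1[OF Q]]
  have eqJ: "u = v" if "\<And>y. ip (metric S c' p) u (?J *v y) = ip (metric S c' p) v (?J *v y)" for u v
    by (rule eqI) (use surj that in metis)
  have diff: "?K *v differential \<phi> c d p y = differential \<phi> c' d' p (?J *v y)" for y
    using tgt(1) src(1) by simp
  have pull: "?K *v pullback_deriv M \<phi> c d p y \<nu> = pullback_deriv M \<phi> c' d' p (?J *v y) \<nu>" for y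
    using tgt(2) src(2) by simp
  have nu: "\<nu> d' p = ?K *v \<nu> d p"
    using normal cc(3,4) unfolding unit_normal_def section_along_def by blast
  note f1 = hypersurface_charts.shape_matrix_formula[OF charts[OF c d] p]
    and f2 = hypersurface_charts.shape_matrix_formula[OF charts[OF c' d'] p']
  note t1 = hypersurface_charts.tangential_part_formula[OF charts[OF c d] p]
    and t2 = hypersurface_charts.tangential_part_formula[OF charts[OF c' d'] p']
  have "?J *v (shape_matrix S M \<phi> \<nu> c d p *v y) = shape_matrix S M \<phi> \<nu> c' d' p *v (?J *v y)" for y
    by (rule eqJ) (simp only: mS[symmetric] f1 f2 mM diff pull nu)
  then show sh: "?J ** shape_matrix S M \<phi> \<nu> c d p = shape_matrix S M \<phi> \<nu> c' d' p ** ?J"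
    by (simp add: matrix_eq matrix_vector_mul_assoc[symmetric])
  show "?J *v tangential_part M \<phi> c d p w = tangential_part M \<phi> c' d' p (?K *v w)"
    by (rule eqJ) (simp only: mS[symmetric] t1 t2 mM diff)
  show "elem_sym k (shape_matrix S M \<phi> \<nu> c d p) = elem_sym k (shape_matrix S M \<phi> \<nu> c' d' p)"
    by (rule elem_sym_conjugate[OF inv sh])
qed

end

section \<open>Change of variables\<close>

text \<open>The change of variables theorem of the library requires a well-ordered index type.
  Every finite type has a well-ordered copy.\<close>

typedef 'a ordered_copy = "UNIV :: 'a set" by auto

instance ordered_copy :: (finite) finite
proof
  have "finite (Rep_ordered_copy ` (UNIV :: 'a ordered_copy set))" by simp
  then show "finite (UNIV :: 'a ordered_copy set)"
    by (rule finite_imageD) (simp add: inj_on_def Rep_ordered_copy_inject)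
qed

definition ordered_copy_index :: "'a::finite ordered_copy \<Rightarrow> nat" where
  "ordered_copy_index = (SOME f. inj f)"

lemma inj_ordered_copy_index: "inj ordered_copy_index"
proof -
  have "\<exists>f :: 'a ordered_copy \<Rightarrow> nat. inj f"
    using finite_imp_inj_to_nat_seg[of "UNIV :: 'a ordered_copy set"] by auto
  then show ?thesis unfolding ordered_copy_index_def by (rule someI_ex)
qed

instantiation ordered_copy :: (finite) wellorder
begin

definition less_eq_ordered_copy :: "'a ordered_copy \<Rightarrow> 'a ordered_copy \<Rightarrow> bool" where
  "x \<le> y \<longleftrightarrow> ordered_copy_index x \<le> ordered_copy_index y"

definition less_ordered_copy :: "'a ordered_copy \<Rightarrow> 'a ordered_copy \<Rightarrow> bool" where
  "x < y \<longleftrightarrow> ordered_copy_index x < ordered_copy_index y"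

instance
proof
  fix P :: "'a ordered_copy \<Rightarrow> bool" and a
  assume "\<And>x. (\<And>y. y < x \<Longrightarrow> P y) \<Longrightarrow> P x"
  then show "P a"
    unfolding less_ordered_copy_def by (rule measure_induct_rule)
qed (auto simp: less_eq_ordered_copy_def less_ordered_copy_def intro: injD[OF inj_ordered_copy_index])

end

lemma bij_Rep_ordered_copy: "bij Rep_ordered_copy"
  by (rule bij_betw_byWitness[of _ Abs_ordered_copy]) (auto simp: Rep_ordered_copy_inverse Abs_ordered_copy_inverse)

definition reindex :: "('k \<Rightarrow> 'm) \<Rightarrow> real^'m \<Rightarrow> real^'k" where
  "reindex b x = (\<chi> i. x $ b i)"

lemma reindex_inverse: "bij b \<Longrightarrow> reindex (inv b) (reindex b x) = x" "bij b \<Longrightarrow> reindex b (reindex (inv b) z) = z"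
  by (simp_all add: reindex_def vec_eq_iff bij_is_surj surj_f_inv_f bij_is_inj inv_f_f)

lemma linear_reindex: "linear (reindex b)"
  by (rule linearI) (simp_all add: reindex_def vec_eq_iff)

lemma bounded_linear_reindex: "bounded_linear (reindex b :: real^'m \<Rightarrow> real^'k)"
  using linear_reindex linear_conv_bounded_linear by blast

text \<open>Relabelling rows and columns together conjugates the permutations in the Leibniz sum by
  \<open>b\<close>, which preserves their signs.\<close>

lemma det_reindex:
  fixes A :: "real^'m^'m" and b :: "'k::finite \<Rightarrow> 'm"
  assumes b: "bij b"
  shows "det (\<chi> i j. A $ b i $ b j) = det A"
proof -
  have bb: "bij_betw b UNIV UNIV" and bi: "bij_betw (inv b) UNIV UNIV" using b by (auto simp: bij_imp_bij_inv)
  have inj: "inj b" "inj (inv b)" using b by (auto simp: bij_is_inj bij_imp_bij_inv)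
  have bs: "b (inv b y) = y" "inv b (b z) = z" for y z using b by (simp_all add: bij_is_surj surj_f_inv_f inj)
  show ?thesis
    unfolding det_def
  proof (rule sum.reindex_bij_witness[of _ "map_permutation UNIV (inv b)" "map_permutation UNIV b"])
    fix p assume p: "p \<in> {p. p permutes (UNIV :: 'k set)}"
    then have p': "p permutes UNIV" by simp
    show "map_permutation UNIV (inv b) (map_permutation UNIV b p) = p"
      by (rule map_permutation_compose_inv[OF bb p']) (simp add: inj)
    show "map_permutation UNIV b p \<in> {p. p permutes UNIV}"
      using map_permutation_permutes[OF bb p'] by simp
    have "(\<Prod>i\<in>UNIV. A $ i $ map_permutation UNIV b p i) = (\<Prod>i\<in>UNIV. A $ b i $ map_permutation UNIV b p (b i))"
      by (rule prod.reindex_bij_betw[OF bb, symmetric])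
    also have "\<dots> = (\<Prod>i\<in>UNIV. A $ b i $ b (p i))"
      by (simp add: map_permutation_apply[OF inj(1)])
    finally show "of_int (sign (map_permutation UNIV b p)) * (\<Prod>i\<in>UNIV. A $ i $ map_permutation UNIV b p i)
       = of_int (sign p) * (\<Prod>i\<in>UNIV. (\<chi> i j. A $ b i $ b j) $ i $ p i)"
      by (simp add: sign_map_permutation[OF inj(1) p'])
  next
    fix p assume p: "p \<in> {p. p permutes (UNIV :: 'm set)}"
    then have p': "p permutes UNIV" by simp
    show "map_permutation UNIV b (map_permutation UNIV (inv b) p) = p"
      by (rule map_permutation_compose_inv[OF bi p']) (simp add: bs)
    show "map_permutation UNIV (inv b) p \<in> {p. p permutes UNIV}"
      using map_permutation_permutes[OF bi p'] by simp
  qed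
qed

lemma prod_Basis_vec: "(\<Prod>e\<in>Basis. (v :: real^'n) \<bullet> e) = (\<Prod>i\<in>UNIV. v $ i)"
proof -
  have B: "(Basis :: (real^'n) set) = (\<lambda>i. axis i 1) ` UNIV" by (auto simp: Basis_vec_def)
  have inj: "inj (\<lambda>i. axis i (1::real) :: real^'n)" by (auto simp: inj_on_def axis_eq_axis)
  show ?thesis unfolding B by (simp add: prod.reindex[OF inj] inner_axis)
qed

text \<open>Preimages of boxes are boxes with permuted side lengths, and the volumes of boxes
  determine \<open>lborel\<close>.\<close>

lemma distr_lborel_reindex:
  fixes b :: "'k::finite \<Rightarrow> 'm::finite"
  assumes b: "bij b"
  shows "distr lborel borel (reindex b) = lborel"
proof (rule lborel_eqI[symmetric])
  fix l u :: "real^'k"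
  assume lu: "\<And>e. e \<in> Basis \<Longrightarrow> l \<bullet> e \<le> u \<bullet> e"
  have m: "reindex b \<in> borel_measurable borel"
    by (intro borel_measurable_continuous_onI linear_continuous_on bounded_linear_reindex)
  have bs: "b (inv b y) = y" "inv b (b z) = z" for y z using b by (simp_all add: bij_is_surj surj_f_inv_f bij_is_inj)
  have "reindex b -` box l u = box (reindex (inv b) l) (reindex (inv b) u)"
    unfolding mem_box_cart set_eq_iff vimage_eq reindex_def vec_lambda_beta using bs by metis
  moreover have "\<And>e. e \<in> Basis \<Longrightarrow> reindex (inv b) l \<bullet> e \<le> reindex (inv b) u \<bullet> e"
  proof -
    have "l $ i \<le> u $ i" for i
      using lu[of "axis i 1"] by (auto simp: inner_axis Basis_vec_def)
    then show "reindex (inv b) l \<bullet> e \<le> reindex (inv b) u \<bullet> e" if "e \<in> Basis" for e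
      using that by (auto simp: Basis_vec_def inner_axis reindex_def)
  qed
  moreover have "(\<Prod>e\<in>Basis. (reindex (inv b) u - reindex (inv b) l) \<bullet> e) = (\<Prod>e\<in>Basis. (u - l) \<bullet> e)"
    unfolding prod_Basis_vec
    using prod.reindex_bij_betw[of "inv b" UNIV UNIV "\<lambda>i. (u - l) $ i"] b by (simp add: bij_imp_bij_inv reindex_def)
  ultimately show "emeasure (distr lborel borel (reindex b)) (box l u) = ennreal (\<Prod>e\<in>Basis. (u - l) \<bullet> e)"
    using m by (simp add: emeasure_distr emeasure_lborel_box)
qed simp

text \<open>The dichotomy transfers a change of variables theorem for absolutely integrable
  functions to \<open>nn_integral\<close>: both sides are given by the same integral, or both are
  infinite.\<close>

lemma nn_integral_absolutely_integrable:
  fixes g :: "'a::euclidean_space \<Rightarrow> real"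
  assumes A: "A \<in> sets borel" and m: "(\<lambda>x. indicator A x * g x) \<in> borel_measurable borel"
    and nn: "\<And>x. x \<in> A \<Longrightarrow> 0 \<le> g x"
  shows "g absolutely_integrable_on A \<Longrightarrow> (\<integral>\<^sup>+x. ennreal (g x) * indicator A x \<partial>lborel) = ennreal (integral A g)"
    and "\<not> g absolutely_integrable_on A \<Longrightarrow> (\<integral>\<^sup>+x. ennreal (g x) * indicator A x \<partial>lborel) = \<infinity>"
proof -
  have eq: "ennreal (g x) * indicator A x = ennreal (indicator A x * g x)" for x
    by (auto simp: indicator_def)
  have abs: "g absolutely_integrable_on A \<longleftrightarrow> integrable lborel (\<lambda>x. indicator A x * g x)"
    using m by (simp add: set_integrable_def integrable_completion)
  have nn': "0 \<le> indicator A x * g x" for x using nn by (auto simp: indicator_def)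
  show "(\<integral>\<^sup>+x. ennreal (g x) * indicator A x \<partial>lborel) = ennreal (integral A g)" if "g absolutely_integrable_on A"
  proof -
    have "integral A g = (\<integral>x. indicator A x * g x \<partial>lborel)"
      using set_lebesgue_integral_eq_integral(2)[OF that] m
      by (simp add: set_lebesgue_integral_def integral_completion)
    then show ?thesis
      unfolding eq using nn_integral_eq_integral[of lborel "\<lambda>x. indicator A x * g x"] abs that nn' by simp
  qed
  show "(\<integral>\<^sup>+x. ennreal (g x) * indicator A x \<partial>lborel) = \<infinity>" if "\<not> g absolutely_integrable_on A"
  proof (rule ccontr)
    assume "\<not> ?thesis"
    then have "(\<integral>\<^sup>+x. ennreal (indicator A x * g x) \<partial>lborel) < \<infinity>" unfolding eq by (simp add: less_top)
    then have "integrable lborel (\<lambda>x. indicator A x * g x)"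
      by (intro integrableI_nonneg) (use m nn' in auto)
    then show False using abs that by simp
  qed
qed

lemma nn_integral_change_of_variables_wellorder:
  fixes \<tau> :: "real^'k::{finite,wellorder} \<Rightarrow> real^'k::_" and f :: "real^'k::_ \<Rightarrow> real"
  assumes A: "A \<in> sets borel" and B: "\<tau> ` A \<in> sets borel"
    and der: "\<And>x. x \<in> A \<Longrightarrow> (\<tau> has_derivative \<tau>' x) (at x)" and inj: "inj_on \<tau> A"
    and nn: "\<And>y. y \<in> \<tau> ` A \<Longrightarrow> 0 \<le> f y"
    and m1: "(\<lambda>x. indicator A x * (\<bar>det (matrix (\<tau>' x))\<bar> * f (\<tau> x))) \<in> borel_measurable borel"
    and m2: "(\<lambda>y. indicator (\<tau> ` A) y * f y) \<in> borel_measurable borel"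
  shows "(\<integral>\<^sup>+x. ennreal (\<bar>det (matrix (\<tau>' x))\<bar> * f (\<tau> x)) * indicator A x \<partial>lborel)
     = (\<integral>\<^sup>+y. ennreal (f y) * indicator (\<tau> ` A) y \<partial>lborel)"
proof -
  let ?g = "\<lambda>x. \<bar>det (matrix (\<tau>' x))\<bar> * f (\<tau> x)"
  have AL: "A \<in> sets lebesgue" using A by simp
  have derW: "\<And>x. x \<in> A \<Longrightarrow> (\<tau> has_derivative \<tau>' x) (at x within A)"
    using der has_derivative_at_withinI by blast
  \<comment> \<open>The theorem is about vector-valued integrands, so \<open>f\<close> is read as a
    map into \<open>real^1\<close>; \<open>r\<close> carries the value of the integral.\<close>
  have cov: "(?g absolutely_integrable_on A \<and> integral A ?g = r)
     \<longleftrightarrow> (f absolutely_integrable_on (\<tau> ` A) \<and> integral (\<tau> ` A) f = r)" for r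
    using has_absolute_integral_change_of_variables[OF AL derW inj, of "\<lambda>y. vec (f y) :: real^1" "vec r"]
    by (simp add: absolutely_integrable_on_1_iff integral_on_1_eq vec_eq_iff)
  show ?thesis
  proof (cases "f absolutely_integrable_on (\<tau> ` A)")
    case True
    then have "?g absolutely_integrable_on A" "integral A ?g = integral (\<tau> ` A) f" using cov by blast+
    then show ?thesis
      using nn_integral_absolutely_integrable(1)[OF A m1] nn_integral_absolutely_integrable(1)[OF B m2 nn] nn True
      by auto
  next
    case False
    then have "\<not> ?g absolutely_integrable_on A" using cov by blast
    then show ?thesis
      using nn_integral_absolutely_integrable(2)[OF A m1] nn_integral_absolutely_integrable(2)[OF B m2 nn] nn False
      by auto
  qed
qed

text \<open>Conjugation with the relabelling by \<open>ordered_copy\<close> preserves Lebesgue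
  measure and Jacobian determinants, which reduces the claim to the ordered case.\<close>

lemma nn_integral_change_of_variables:
  fixes \<tau> :: "real^'m::finite \<Rightarrow> real^'m" and f :: "real^'m \<Rightarrow> real"
  assumes A: "A \<in> sets borel" and B: "\<tau> ` A \<in> sets borel"
    and der: "\<And>x. x \<in> A \<Longrightarrow> (\<tau> has_derivative \<tau>' x) (at x)" and inj: "inj_on \<tau> A"
    and nn: "\<And>y. y \<in> \<tau> ` A \<Longrightarrow> 0 \<le> f y"
    and m1: "(\<lambda>x. indicator A x * (\<bar>det (matrix (\<tau>' x))\<bar> * f (\<tau> x))) \<in> borel_measurable borel"
    and m2: "(\<lambda>y. indicator (\<tau> ` A) y * f y) \<in> borel_measurable borel"
  shows "(\<integral>\<^sup>+x. ennreal (\<bar>det (matrix (\<tau>' x))\<bar> * f (\<tau> x)) * indicator A x \<partial>lborel)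
     = (\<integral>\<^sup>+y. ennreal (f y) * indicator (\<tau> ` A) y \<partial>lborel)"
proof -
  let ?b = "Rep_ordered_copy :: 'm ordered_copy \<Rightarrow> 'm"
  note bij = bij_Rep_ordered_copy[where 'a = 'm]
  define R :: "real^'m \<Rightarrow> real^'m ordered_copy" where "R = reindex ?b"
  define R' :: "real^'m ordered_copy \<Rightarrow> real^'m" where "R' = reindex (inv ?b)"
  have inv: "R' (R x) = x" "R (R' z) = z" for x z unfolding R_def R'_def by (rule reindex_inverse[OF bij])+
  have bl: "bounded_linear R" "bounded_linear R'" unfolding R_def R'_def by (rule bounded_linear_reindex)+
  have meas: "R \<in> borel_measurable borel" "R' \<in> borel_measurable borel"
    using bl by (auto intro!: borel_measurable_continuous_onI linear_continuous_on)
  have dR': "distr lborel borel R' = lborel"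
    unfolding R'_def by (rule distr_lborel_reindex[OF bij_imp_bij_inv[OF bij]])
  have shift: "(\<integral>\<^sup>+x. h x \<partial>lborel) = (\<integral>\<^sup>+z. h (R' z) \<partial>lborel)" if "h \<in> borel_measurable borel" for h :: "real^'m \<Rightarrow> ennreal"
    by (subst dR'[symmetric], rule nn_integral_distr) (use meas that in auto)
  have preim: "R ` C = R' -` C" for C using inv by (auto simp: image_iff) metis
  have ind: "indicator (R ` C) z = (indicator C (R' z) :: 'z::zero_neq_one)" for C z
    unfolding preim by (simp add: indicator_def)
  have RA: "R ` A \<in> sets borel" "R ` (\<tau> ` A) \<in> sets borel"
    unfolding preim using measurable_sets_borel[OF meas(2) A] measurable_sets_borel[OF meas(2) B] by auto
  define \<sigma> where "\<sigma> z = R (\<tau> (R' z))" for z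
  define \<sigma>' where "\<sigma>' z v = R (\<tau>' (R' z) (R' v))" for z v
  have im: "\<sigma> ` R ` A = R ` \<tau> ` A" by (auto simp: \<sigma>_def inv image_image)
  have dets: "det (matrix (\<sigma>' z)) = det (matrix (\<tau>' (R' z)))" for z
  proof -
    have ax: "R' (axis j 1) = axis (?b j) 1" for j
      using bij by (auto simp: R'_def reindex_def vec_eq_iff axis_def bij_is_inj bij_is_surj inv_f_eq surj_f_inv_f)
    have "matrix (\<sigma>' z) = (\<chi> i j. matrix (\<tau>' (R' z)) $ ?b i $ ?b j)"
      by (simp add: matrix_def \<sigma>'_def vec_eq_iff R_def reindex_def ax)
    then show ?thesis by (simp add: det_reindex[OF bij])
  qed
  have "(\<integral>\<^sup>+z. ennreal (\<bar>det (matrix (\<sigma>' z))\<bar> * f (R' (\<sigma> z))) * indicator (R ` A) z \<partial>lborel)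
     = (\<integral>\<^sup>+y. ennreal (f (R' y)) * indicator (\<sigma> ` R ` A) y \<partial>lborel)"
  proof (rule nn_integral_change_of_variables_wellorder[of "R ` A" \<sigma> \<sigma>' "\<lambda>y. f (R' y)"])
    show "R ` A \<in> sets borel" "\<sigma> ` R ` A \<in> sets borel" using RA im by auto
    show "(\<sigma> has_derivative \<sigma>' z) (at z)" if "z \<in> R ` A" for z
    proof -
      have "R' z \<in> A" using that inv by auto
      have "((\<lambda>z. \<tau> (R' z)) has_derivative (\<lambda>v. \<tau>' (R' z) (R' v))) (at z)"
        by (rule has_derivative_compose[OF bounded_linear_imp_has_derivative[OF bl(2)] der[OF \<open>R' z \<in> A\<close>]])
      from bounded_linear.has_derivative[OF bl(1) this] show ?thesis
        by (simp add: \<sigma>_def[abs_def] \<sigma>'_def[abs_def])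
    qed
    show "inj_on \<sigma> (R ` A)"
      using inj inv unfolding inj_on_def \<sigma>_def by (metis imageE)
    show "0 \<le> f (R' y)" if "y \<in> \<sigma> ` R ` A" for y
      using that nn inv unfolding im by auto
    have "(\<lambda>z. indicator A (R' z) * (\<bar>det (matrix (\<tau>' (R' z)))\<bar> * f (\<tau> (R' z)))) \<in> borel_measurable borel"
      using measurable_compose[OF meas(2) m1] .
    then show "(\<lambda>z. indicator (R ` A) z * (\<bar>det (matrix (\<sigma>' z))\<bar> * f (R' (\<sigma> z)))) \<in> borel_measurable borel"
      by (simp only: ind dets \<sigma>_def inv)
    have "(\<lambda>z. indicator (\<tau> ` A) (R' z) * f (R' z)) \<in> borel_measurable borel"
      using measurable_compose[OF meas(2) m2] .
    then show "(\<lambda>y. indicator (\<sigma> ` R ` A) y * f (R' y)) \<in> borel_measurable borel"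
      by (simp only: ind im)
  qed
  then have k: "(\<integral>\<^sup>+z. ennreal (\<bar>det (matrix (\<tau>' (R' z)))\<bar> * f (\<tau> (R' z))) * indicator A (R' z) \<partial>lborel)
     = (\<integral>\<^sup>+y. ennreal (f (R' y)) * indicator (\<tau> ` A) (R' y) \<partial>lborel)"
    unfolding im by (simp only: ind dets \<sigma>_def inv)
  have e: "ennreal r * indicator C x = ennreal (indicator C x * r)" for r :: real and C :: "(real^'m) set" and x
    by (auto simp: indicator_def)
  have "(\<lambda>x. ennreal (\<bar>det (matrix (\<tau>' x))\<bar> * f (\<tau> x)) * indicator A x) \<in> borel_measurable borel"
    "(\<lambda>y. ennreal (f y) * indicator (\<tau> ` A) y) \<in> borel_measurable borel"
    unfolding e using m1 m2 by auto
  from shift[OF this(1)] shift[OF this(2)] k show ?thesis by simp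
qed

section \<open>The volume measure\<close>

definition volume_density :: "('q, 'm::finite) semi_riem \<Rightarrow> ('q, 'm) chart \<Rightarrow> real^'m \<Rightarrow> real" where
  "volume_density S c x = sqrt \<bar>det (local_metric S c x)\<bar>"

definition chart_volume :: "('q, 'm::finite) semi_riem \<Rightarrow> ('q, 'm) chart \<Rightarrow> 'q set \<Rightarrow> ennreal" where
  "chart_volume S c B = (\<integral>\<^sup>+ x. ennreal (volume_density S c x) * indicator (coords c ` B) x \<partial>lborel)"

lemma chart_image_borel:
  fixes c :: "('q::topological_space, 'm::finite) chart"
  assumes c: "is_chart c" and B: "B \<in> sets borel" "B \<subseteq> cdom c"
  shows "coords c ` B \<in> sets borel"
proof -
  let ?I = "coords c ` cdom c"
  have I: "?I \<in> sets borel" using is_chart_open(2)[OF c] by simp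
  have "continuous_on ?I (chart_inv c)" using c by (simp add: is_chart_def homeomorphism_def)
  then have "chart_inv c \<in> borel_measurable (restrict_space borel ?I)"
    by (rule borel_measurable_continuous_on_restrict)
  from measurable_sets[OF this B(1)] have "chart_inv c -` B \<inter> ?I \<in> sets borel"
    using I by (simp add: space_restrict_space sets_restrict_space_iff)
  moreover have "coords c ` B = chart_inv c -` B \<inter> ?I"
  proof -
    have "cdom c \<inter> B = B" using B(2) by blast
    then show ?thesis using coords_image_Int[OF c, of B] by (simp only: Int_commute)
  qed
  ultimately show ?thesis by simp
qed

locale riemannian_atlas =
  fixes S :: "('q::{t2_space, second_countable_topology}, 'm::finite) semi_riem"
  assumes S: "semi_riemannian_manifold S"
begin

lemma atlas: "smooth_atlas (atlas S)"
  using S by (simp add: semi_riemannian_manifold_def)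

lemmas chart = smooth_atlasD(1)[OF atlas]

lemma continuous_volume_density:
  assumes c: "c \<in> atlas S"
  shows "continuous_on (coords c ` cdom c) (volume_density S c)"
proof -
  interpret metric_field "coords c ` cdom c" "local_metric S c"
    by (rule semi_riemannian_metric_field[OF S c])
  have "continuous_on (coords c ` cdom c) (\<lambda>x. det (local_metric S c x))"
    by (rule Ck_on_continuous[OF Ck_on_det[OF open_V smooth_G]])
  then show ?thesis
    unfolding volume_density_def[abs_def] by (intro continuous_intros)
qed

lemma volume_density_measurable:
  assumes c: "c \<in> atlas S" and B: "B \<in> sets borel" "B \<subseteq> cdom c"
  shows "(\<lambda>x. indicator (coords c ` B) x * volume_density S c x) \<in> borel_measurable borel"
proof -
  have "(\<lambda>x. indicator (coords c ` cdom c) x *\<^sub>R volume_density S c x) \<in> borel_measurable borel"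
    using is_chart_open(2)[OF chart[OF c]] continuous_volume_density[OF c]
    by (intro borel_measurable_continuous_on_indicator) auto
  moreover have "indicator (coords c ` B) \<in> borel_measurable borel"
    using chart_image_borel[OF chart[OF c] B] by simp
  ultimately have "(\<lambda>x. indicator (coords c ` B) x * (indicator (coords c ` cdom c) x *\<^sub>R volume_density S c x)) \<in> borel_measurable borel"
    by (rule borel_measurable_times[rotated])
  moreover have "indicator (coords c ` B) x * (indicator (coords c ` cdom c) x *\<^sub>R volume_density S c x)
      = indicator (coords c ` B) x * volume_density S c x" for x
    using B(2) by (auto simp: indicator_def)
  ultimately show ?thesis by (simp only:)
qed

text \<open>The Gram matrices differ by a congruence with the Jacobian, so the densities differ by
  its absolute determinant, the factor in the change of variables.\<close>

lemma chart_volume_overlap: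
  assumes c: "c \<in> atlas S" and d: "d \<in> atlas S" and B: "B \<in> sets borel" "B \<subseteq> cdom c" "B \<subseteq> cdom d"
  shows "chart_volume S c B = chart_volume S d B"
proof -
  let ?\<tau> = "coords d \<circ> chart_inv c"
  let ?A = "coords c ` B"
  have im: "?\<tau> ` ?A = coords d ` B"
    using B(2) chart_inv_coords[OF chart[OF c]] by (auto simp: image_image subset_iff intro!: image_eqI)
  have dens: "volume_density S c x = \<bar>det (matrix (dd ?\<tau> x))\<bar> * volume_density S d (?\<tau> x)" if xA: "x \<in> ?A" for x
  proof -
    obtain p where p: "p \<in> B" "x = coords c p" using xA by auto
    then have pc: "p \<in> cdom c" "p \<in> cdom d" using B by auto
    have inv: "chart_inv c x = p" "chart_inv d (coords d p) = p"
      using p pc chart_inv_coords[OF chart[OF c]] chart_inv_coords[OF chart[OF d]] by auto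
    have J: "matrix (dd ?\<tau> x) = jacobian c d p" by (simp add: jacobian_def p(2))
    have "c \<in> charts_at (atlas S) p" "d \<in> charts_at (atlas S) p" using pc c d by (auto simp: charts_at_def)
    then have "metric S c p = transpose (jacobian c d p) ** metric S d p ** jacobian c d p"
      using S unfolding semi_riemannian_manifold_def by blast
    then have "det (metric S c p) = (det (jacobian c d p) * det (jacobian c d p)) * det (metric S d p)"
      by (simp add: det_mul)
    then have "sqrt \<bar>det (metric S c p)\<bar> = \<bar>det (jacobian c d p)\<bar> * sqrt \<bar>det (metric S d p)\<bar>"
      by (simp add: abs_mult real_sqrt_mult)
    then show ?thesis
      by (simp add: volume_density_def local_metric_def inv J[simplified comp_def] J)
  qed
  have A: "?A \<in> sets borel" "?\<tau> ` ?A \<in> sets borel"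
    unfolding im using chart_image_borel chart c d B by blast+
  have "chart_volume S c B = (\<integral>\<^sup>+x. ennreal (\<bar>det (matrix (dd ?\<tau> x))\<bar> * volume_density S d (?\<tau> x)) * indicator ?A x \<partial>lborel)"
    unfolding chart_volume_def by (rule nn_integral_cong) (use dens in \<open>auto simp: indicator_def\<close>)
  also have "\<dots> = (\<integral>\<^sup>+y. ennreal (volume_density S d y) * indicator (?\<tau> ` ?A) y \<partial>lborel)"
  proof (rule nn_integral_change_of_variables[OF A])
    show "(?\<tau> has_derivative dd ?\<tau> x) (at x)" if xA: "x \<in> ?A" for x
    proof -
      obtain p where p: "p \<in> B" "x = coords c p" using xA by auto
      then have pc: "p \<in> cdom c" "p \<in> cdom d" using B by auto
      show ?thesis unfolding p(2) by (rule transition_has_derivative[OF atlas c d pc])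
    qed
    show "inj_on ?\<tau> ?A"
    proof (rule inj_onI)
      fix x y assume "x \<in> ?A" "y \<in> ?A" and e: "?\<tau> x = ?\<tau> y"
      then obtain p q where p: "p \<in> B" "x = coords c p" and q: "q \<in> B" "y = coords c q" by auto
      have "chart_inv c x = p" "chart_inv c y = q" using p q B chart_inv_coords[OF chart[OF c]] by auto
      then have "coords d p = coords d q" using e by simp
      then have "p = q" using p q B chart_inv_coords[OF chart[OF d]] by (metis subsetD)
      then show "x = y" using p q by simp
    qed
    show "0 \<le> volume_density S d y" for y by (simp add: volume_density_def)
    have e: "indicator ?A x * (\<bar>det (matrix (dd ?\<tau> x))\<bar> * volume_density S d (?\<tau> x)) = indicator ?A x * volume_density S c x" for x
      using dens by (auto simp: indicator_def)
    show "(\<lambda>x. indicator ?A x * (\<bar>det (matrix (dd ?\<tau> x))\<bar> * volume_density S d (?\<tau> x))) \<in> borel_measurable borel"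
      unfolding e by (rule volume_density_measurable[OF c B(1,2)])
    show "(\<lambda>y. indicator (?\<tau> ` ?A) y * volume_density S d y) \<in> borel_measurable borel"
      unfolding im by (rule volume_density_measurable[OF d B(1,3)])
  qed
  also have "\<dots> = chart_volume S d B" unfolding im chart_volume_def ..
  finally show ?thesis .
qed

text \<open>Made total to be Borel on the whole space; the constant value off the chart image is
  harmless, as the density of \<open>chart_measure\<close> is zero there.\<close>

definition total_inv :: "('q, 'm) chart \<Rightarrow> real^'m \<Rightarrow> 'q" where
  "total_inv c x = (if x \<in> coords c ` cdom c then chart_inv c x else undefined)"

definition chart_measure :: "('q, 'm) chart \<Rightarrow> 'q measure" where
  "chart_measure c = distr (density lborel (\<lambda>x. ennreal (indicator (coords c ` cdom c) x * volume_density S c x)))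
     borel (total_inv c)"

lemma sets_chart_measure [simp]: "sets (chart_measure c) = sets borel"
  by (simp add: chart_measure_def)

lemma total_inv_measurable: "c \<in> atlas S \<Longrightarrow> total_inv c \<in> borel_measurable borel"
  unfolding total_inv_def[abs_def]
  using is_chart_open(2)[OF chart] chart
  by (intro borel_measurable_continuous_on_if) (auto simp: is_chart_def homeomorphism_def)

lemma cdom_borel: "c \<in> atlas S \<Longrightarrow> cdom c \<in> sets borel"
  using is_chart_open(1)[OF chart] by simp

lemma dens_measurable: "c \<in> atlas S \<Longrightarrow> (\<lambda>x. indicator (coords c ` cdom c) x * volume_density S c x) \<in> borel_measurable borel"
  by (rule volume_density_measurable[OF _ cdom_borel]) auto

lemma emeasure_chart_measure:
  assumes c: "c \<in> atlas S" and B: "B \<in> sets borel"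
  shows "emeasure (chart_measure c) B = chart_volume S c (B \<inter> cdom c)"
proof -
  have ti: "total_inv c \<in> borel_measurable lborel" using total_inv_measurable[OF c] by simp
  have "emeasure (chart_measure c) B
     = emeasure (density lborel (\<lambda>x. ennreal (indicator (coords c ` cdom c) x * volume_density S c x))) (total_inv c -` B)"
    unfolding chart_measure_def using ti B by (simp add: emeasure_distr)
  also have "\<dots> = (\<integral>\<^sup>+x. ennreal (indicator (coords c ` cdom c) x * volume_density S c x) * indicator (total_inv c -` B) x \<partial>lborel)"
    using dens_measurable[OF c] measurable_sets_borel[OF total_inv_measurable[OF c] B] by (intro emeasure_density) auto
  also have "\<dots> = chart_volume S c (B \<inter> cdom c)"
    unfolding chart_volume_def
  proof (rule nn_integral_cong)
    fix x
    show "ennreal (indicator (coords c ` cdom c) x * volume_density S c x) * indicator (total_inv c -` B) x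
       = ennreal (volume_density S c x) * indicator (coords c ` (B \<inter> cdom c)) x"
      unfolding Int_commute[of B] coords_image_Int[OF chart[OF c]]
      by (auto simp: total_inv_def indicator_def)
  qed
  finally show ?thesis .
qed

text \<open>Justifies the \<open>SOME\<close> in \<open>volume_measure\<close>. By compactness
  finitely many charts cover; their measures, restricted to the disjoint pieces \<open>Q i\<close>,
  are added. On a set inside a chart \<open>c\<close>, \<open>chart_volume_overlap\<close> replaces
  the measure on each piece by that of \<open>c\<close>.\<close>

lemma volume_measure_exists:
  assumes compact: "compact (UNIV :: 'q set)"
  shows "\<exists>\<mu>. sets \<mu> = sets borel \<and> (\<forall>c\<in>atlas S. \<forall>B\<in>sets borel. B \<subseteq> cdom c \<longrightarrow> emeasure \<mu> B = chart_volume S c B)"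
proof -
  have "UNIV \<subseteq> (\<Union>c\<in>atlas S. cdom c)" using atlas by (simp add: smooth_atlas_def)
  then obtain C where C: "C \<subseteq> atlas S" "finite C" "UNIV \<subseteq> (\<Union>c\<in>C. cdom c)"
    by (rule compactE_image[OF compact _ , rotated]) (use is_chart_open(1)[OF chart] in auto)
  obtain cs where cs: "set cs = C" using finite_list[OF C(2)] by blast
  let ?r = "length cs"
  have csA: "cs ! i \<in> atlas S" if "i < ?r" for i using that cs C(1) nth_mem by blast
  define Q where "Q i = cdom (cs ! i) - (\<Union>j<i. cdom (cs ! j))" for i
  have Qb: "Q i \<in> sets borel" if "i < ?r" for i
    unfolding Q_def using that csA by (intro sets.Diff sets.finite_UN cdom_borel) auto
  have Qdisj: "Q i \<inter> Q j = {}" if "i < j" for i j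
    using that by (auto simp: Q_def)
  have Qdis: "disjoint_family_on Q {..<?r}"
    unfolding disjoint_family_on_def using Qdisj by (metis Int_commute linorder_neqE_nat)
  have Qcov: "(\<Union>i<?r. Q i) = UNIV"
  proof -
    have "q \<in> (\<Union>i<?r. Q i)" for q
    proof -
      define i where "i = (LEAST i. i < ?r \<and> q \<in> cdom (cs ! i))"
      have "\<exists>i. i < ?r \<and> q \<in> cdom (cs ! i)"
        using C(3) cs by (metis UNIV_I UN_E in_set_conv_nth subsetD)
      then have i: "i < ?r \<and> q \<in> cdom (cs ! i)" unfolding i_def by (rule LeastI_ex)
      moreover have "q \<notin> cdom (cs ! j)" if "j < i" for j
        using not_less_Least[of j "\<lambda>i. i < ?r \<and> q \<in> cdom (cs ! i)"] that i unfolding i_def[symmetric] by auto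
      ultimately show ?thesis by (auto simp: Q_def)
    qed
    then show ?thesis by auto
  qed
  define m where "m B = (\<Sum>i<?r. emeasure (chart_measure (cs ! i)) (B \<inter> Q i))" for B
  define \<mu> where "\<mu> = measure_of UNIV (sets borel) m"
  have sets: "sets \<mu> = sets borel"
    unfolding \<mu>_def using sets.sigma_sets_eq[of "borel :: 'q measure"] by (simp add: sets_measure_of_conv)
  have "countably_additive (sets borel) m"
  proof (rule countably_additiveI)
    fix A :: "nat \<Rightarrow> 'q set"
    assume A: "range A \<subseteq> sets borel" "disjoint_family A"
    have "(\<Sum>n. m (A n)) = (\<Sum>i<?r. \<Sum>n. emeasure (chart_measure (cs ! i)) (A n \<inter> Q i))"
      unfolding m_def by (rule suminf_sum) simp
    also have "\<dots> = (\<Sum>i<?r. emeasure (chart_measure (cs ! i)) (\<Union>n. A n \<inter> Q i))"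
    proof (rule sum.cong[OF refl])
      fix i assume "i \<in> {..<?r}"
      then show "(\<Sum>n. emeasure (chart_measure (cs ! i)) (A n \<inter> Q i)) = emeasure (chart_measure (cs ! i)) (\<Union>n. A n \<inter> Q i)"
        using A Qb[of i] by (intro suminf_emeasure) (auto simp: disjoint_family_on_def)
    qed
    finally show "(\<Sum>n. m (A n)) = m (\<Union>n. A n)" by (simp add: m_def Int_UN_distrib2 Int_UN_distrib)
  qed
  then have em: "emeasure \<mu> B = m B" if "B \<in> sets borel" for B
    unfolding \<mu>_def
    by (intro emeasure_measure_of_sigma) (use that sets.sigma_algebra_axioms[of "borel :: 'q measure"] in \<open>auto simp: positive_def m_def\<close>)
  have "emeasure \<mu> B = chart_volume S c B" if c: "c \<in> atlas S" and B: "B \<in> sets borel" "B \<subseteq> cdom c" for c B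
  proof -
    have "emeasure \<mu> B = (\<Sum>i<?r. emeasure (chart_measure c) (B \<inter> Q i))"
      unfolding em[OF B(1)] m_def
    proof (rule sum.cong[OF refl])
      fix i assume "i \<in> {..<?r}"
      then have i: "i < ?r" by simp
      have BQ: "B \<inter> Q i \<in> sets borel" using B(1) Qb[OF i] by auto
      have sub: "B \<inter> Q i \<subseteq> cdom (cs ! i)" "B \<inter> Q i \<subseteq> cdom c" using B(2) by (auto simp: Q_def)
      show "emeasure (chart_measure (cs ! i)) (B \<inter> Q i) = emeasure (chart_measure c) (B \<inter> Q i)"
        unfolding emeasure_chart_measure[OF csA[OF i] BQ] emeasure_chart_measure[OF c BQ]
          Int_absorb2[OF sub(1)] Int_absorb2[OF sub(2)]
        by (rule chart_volume_overlap[OF csA[OF i] c BQ sub])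
    qed
    also have "\<dots> = emeasure (chart_measure c) (\<Union>i<?r. B \<inter> Q i)"
    proof (rule sum_emeasure)
      show "disjoint_family_on (\<lambda>i. B \<inter> Q i) {..<?r}"
        using Qdis unfolding disjoint_family_on_def by blast
    qed (use B Qb in auto)
    also have "(\<Union>i<?r. B \<inter> Q i) = B" using Qcov by auto
    also have "emeasure (chart_measure c) B = chart_volume S c B"
      unfolding emeasure_chart_measure[OF c B(1)] Int_absorb2[OF B(2)] ..
    finally show ?thesis .
  qed
  then show ?thesis using sets by blast
qed

lemma volume_measure_props:
  assumes compact: "compact (UNIV :: 'q set)"
  shows "sets (volume_measure S) = sets borel"
    and "c \<in> atlas S \<Longrightarrow> B \<in> sets borel \<Longrightarrow> B \<subseteq> cdom c \<Longrightarrow> emeasure (volume_measure S) B = chart_volume S c B"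
proof -
  have *: "sets (volume_measure S) = sets borel \<and>
      (\<forall>c\<in>atlas S. \<forall>B\<in>sets borel. B \<subseteq> cdom c \<longrightarrow> emeasure (volume_measure S) B = chart_volume S c B)"
    using someI_ex[OF volume_measure_exists[OF compact]]
    unfolding volume_measure_def chart_volume_def volume_density_def by blast
  then show "sets (volume_measure S) = sets borel"
    and "c \<in> atlas S \<Longrightarrow> B \<in> sets borel \<Longrightarrow> B \<subseteq> cdom c \<Longrightarrow> emeasure (volume_measure S) B = chart_volume S c B"
    by blast+
qed

text \<open>This holds for whichever measure \<open>SOME\<close> has picked, since the proof rests
  on its two defining properties.\<close>

lemma density_volume_measure:
  assumes compact: "compact (UNIV :: 'q set)" and c: "c \<in> atlas S"
  shows "density (volume_measure S) (indicator (cdom c)) = chart_measure c"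
proof (rule measure_eqI)
  note vm = volume_measure_props[OF compact]
  show "sets (density (volume_measure S) (indicator (cdom c))) = sets (chart_measure c)" by (simp add: vm(1))
  fix B assume "B \<in> sets (density (volume_measure S) (indicator (cdom c)))"
  then have B: "B \<in> sets borel" by (simp add: vm(1))
  have cb: "cdom c \<in> sets (volume_measure S)" "B \<in> sets (volume_measure S)" using B cdom_borel[OF c] by (simp_all add: vm(1))
  have "emeasure (density (volume_measure S) (indicator (cdom c))) B = emeasure (volume_measure S) (B \<inter> cdom c)"
    using cb by (simp add: emeasure_density indicator_inter_arith[symmetric] Int_commute)
  also have "\<dots> = chart_volume S c (B \<inter> cdom c)"
    using B cdom_borel[OF c] by (intro vm(2)[OF c]) auto
  finally show "emeasure (density (volume_measure S) (indicator (cdom c))) B = emeasure (chart_measure c) B"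
    unfolding emeasure_chart_measure[OF c B] .
qed

lemma volume_integral_chart:
  fixes h :: "'q \<Rightarrow> real"
  assumes compact: "compact (UNIV :: 'q set)" and c: "c \<in> atlas S"
    and h: "h \<in> borel_measurable borel" and h0: "\<And>q. q \<notin> cdom c \<Longrightarrow> h q = 0"
    and k: "\<And>x. k x = (if x \<in> coords c ` cdom c then volume_density S c x * h (chart_inv c x) else 0)"
    and int: "integrable lborel k"
  shows "integrable (volume_measure S) h" "(\<integral>p. h p \<partial>volume_measure S) = (\<integral>x. k x \<partial>lborel)"
proof -
  let ?w = "\<lambda>x. indicator (coords c ` cdom c) x * volume_density S c x"
  note vm = volume_measure_props[OF compact]
  have wnn: "0 \<le> ?w x" for x by (simp add: volume_density_def)
  have kw: "k = (\<lambda>x. ?w x *\<^sub>R h (total_inv c x))" by (auto simp: k total_inv_def fun_eq_iff)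
  have ti: "total_inv c \<in> borel_measurable lborel" using total_inv_measurable[OF c] by simp
  have wm: "?w \<in> borel_measurable lborel" using dens_measurable[OF c] by simp
  have hm: "h \<in> borel_measurable (volume_measure S)" using h vm(1) by (simp cong: measurable_cong_sets)
  have hti: "(\<lambda>x. h (total_inv c x)) \<in> borel_measurable lborel" using measurable_compose[OF ti h] .
  have ind: "(indicator (cdom c) :: 'q \<Rightarrow> real) \<in> borel_measurable (volume_measure S)"
    using cdom_borel[OF c] vm(1) by (intro borel_measurable_indicator) simp
  have eqh: "(\<lambda>q. indicator (cdom c) q *\<^sub>R h q) = h" using h0 by (auto simp: fun_eq_iff indicator_def)
  have dv: "density (volume_measure S) (\<lambda>q. ennreal (indicator (cdom c) q)) = chart_measure c"
    using density_volume_measure[OF compact c] by (simp add: ennreal_indicator)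
  have "integrable (chart_measure c) h \<longleftrightarrow> integrable (density lborel (\<lambda>x. ennreal (?w x))) (\<lambda>x. h (total_inv c x))"
    unfolding chart_measure_def using ti h by (intro integrable_distr_eq) auto
  also have "\<dots> \<longleftrightarrow> integrable lborel k"
    unfolding kw using wnn wm hti by (intro integrable_density) auto
  finally have ic: "integrable (chart_measure c) h" using int by simp
  then have "integrable (density (volume_measure S) (\<lambda>q. ennreal (indicator (cdom c) q))) h" by (simp only: dv)
  then have "integrable (volume_measure S) (\<lambda>q. indicator (cdom c) q *\<^sub>R h q)"
    by (subst (asm) integrable_density[OF hm ind]) auto
  then show "integrable (volume_measure S) h" by (simp only: eqh)
  have "(\<integral>p. h p \<partial>volume_measure S) = (\<integral>p. indicator (cdom c) p *\<^sub>R h p \<partial>volume_measure S)" by (simp only: eqh)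
  also have "\<dots> = (\<integral>p. h p \<partial>density (volume_measure S) (\<lambda>q. ennreal (indicator (cdom c) q)))"
    by (rule integral_density[OF hm ind, symmetric]) auto
  also have "\<dots> = (\<integral>p. h p \<partial>chart_measure c)" by (simp only: dv)
  also have "\<dots> = (\<integral>x. h (total_inv c x) \<partial>density lborel (\<lambda>x. ennreal (?w x)))"
    unfolding chart_measure_def using ti h by (intro integral_distr) auto
  also have "\<dots> = (\<integral>x. k x \<partial>lborel)"
    unfolding kw by (rule integral_density[OF hti wm]) (use wnn in auto)
  finally show "(\<integral>p. h p \<partial>volume_measure S) = (\<integral>x. k x \<partial>lborel)" .
qed

end

section \<open>Localization and the integral formula\<close>

lemma pos_part_square_derivative: "((\<lambda>s. (max 0 s)\<^sup>2) has_real_derivative 2 * max 0 s) (at s)"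
proof -
  consider "s > 0" | "s < 0" | "s = 0" by linarith
  then show ?thesis
  proof cases
    case 1
    have "((\<lambda>s. s\<^sup>2) has_real_derivative 2 * max 0 s) (at s)"
      using 1 by (auto intro!: derivative_eq_intros)
    then show ?thesis
      by (rule has_field_derivative_transform_within_open[of _ _ _ "{0<..}"]) (use 1 in auto)
  next
    case 2
    have "((\<lambda>s. 0) has_real_derivative 2 * max 0 s) (at s)"
      using 2 by (auto intro!: derivative_eq_intros)
    then show ?thesis
      by (rule has_field_derivative_transform_within_open[of _ _ _ "{..<0}"]) (use 2 in auto)
  next
    case 3
    \<comment> \<open>Squaring smooths the corner of the positive part: the quotient at 0 is bounded
      by the increment.\<close>
    have b: "norm ((max 0 h)\<^sup>2 / h) \<le> \<bar>h\<bar>" for h :: real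
      by (cases "h > 0") (auto simp: power2_eq_square max_def)
    have "((\<lambda>h. (max 0 h)\<^sup>2 / h) \<longlongrightarrow> 0) (at (0::real))"
      by (rule Lim_null_comparison[of _ "\<lambda>h. \<bar>h\<bar>"]) (use b in \<open>auto intro!: tendsto_eq_intros\<close>)
    then show ?thesis using 3 by (simp add: has_field_derivative_iff)
  qed
qed

text \<open>Only C^1, but \<open>patch_integral\<close> differentiates the localized function once,
  so an explicit piecewise polynomial suffices.\<close>

definition bump :: "'a::euclidean_space \<Rightarrow> real \<Rightarrow> 'a \<Rightarrow> real" where
  "bump a r x = (max 0 (r\<^sup>2 - (x - a) \<bullet> (x - a)))\<^sup>2"

lemma Ck_on_bump: "Ck_on 1 (bump a r) UNIV"
  unfolding One_nat_def
proof (rule Ck_on_SucI[OF open_UNIV])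
  fix x
  have 1: "((\<lambda>x. r\<^sup>2 - (x - a) \<bullet> (x - a)) has_derivative (\<lambda>v. - (2 * ((x - a) \<bullet> v)))) (at x)"
    by (auto intro!: derivative_eq_intros simp: inner_commute)
  have 2: "((\<lambda>s. (max 0 s)\<^sup>2) has_derivative (\<lambda>t. t * (2 * max 0 (r\<^sup>2 - (x - a) \<bullet> (x - a))))) (at (r\<^sup>2 - (x - a) \<bullet> (x - a)))"
    by (rule has_derivative_eq_rhs[OF pos_part_square_derivative[unfolded has_field_derivative_def] ext])
      (simp add: mult.commute)
  from has_derivative_compose[OF 1 2]
  show "(bump a r has_derivative (\<lambda>v. - (2 * ((x - a) \<bullet> v)) * (2 * max 0 (r\<^sup>2 - (x - a) \<bullet> (x - a))))) (at x)"
    by (simp only: bump_def[abs_def])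
next
  show "Ck_on 0 (\<lambda>x. - (2 * ((x - a) \<bullet> v)) * (2 * max 0 (r\<^sup>2 - (x - a) \<bullet> (x - a)))) UNIV" for v
    unfolding Ck_on.simps by (intro continuous_intros)
qed

lemma bump_nonneg: "0 \<le> bump a r x" by (simp add: bump_def)

lemma bump_pos: "x \<in> ball a r \<Longrightarrow> 0 < bump a r x"
proof -
  assume "x \<in> ball a r"
  then have "norm (x - a) < r" by (simp add: dist_norm norm_minus_commute)
  then have "(norm (x - a))\<^sup>2 < r\<^sup>2" by (intro power_strict_mono) auto
  then show ?thesis by (simp add: bump_def power2_norm_eq_inner)
qed

lemma bump_zero: "0 < r \<Longrightarrow> x \<notin> cball a r \<Longrightarrow> bump a r x = 0"
proof -
  assume r: "0 < r" and "x \<notin> cball a r"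
  then have "r < norm (x - a)" by (simp add: dist_norm norm_minus_commute)
  then have "r\<^sup>2 < (norm (x - a))\<^sup>2" using r by (intro power_strict_mono) auto
  then show ?thesis by (simp add: bump_def power2_norm_eq_inner)
qed

text \<open>The regularity that survives localization: a smooth \<open>f\<close> multiplied by
  normalized bumps is in general just C^1.\<close>

definition C1_fun :: "('q, 'm::finite) semi_riem \<Rightarrow> ('q \<Rightarrow> real) \<Rightarrow> bool" where
  "C1_fun S f \<longleftrightarrow> (\<forall>c\<in>atlas S. Ck_on 1 (f \<circ> chart_inv c) (coords c ` cdom c))"

context riemannian_atlas
begin

definition chart_bump :: "('q, 'm) chart \<Rightarrow> real^'m \<Rightarrow> real \<Rightarrow> 'q \<Rightarrow> real" where
  "chart_bump c a r q = (if q \<in> cdom c then bump a r (coords c q) else 0)"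

text \<open>Another chart \<open>e\<close> is covered by two open pieces: the overlap with
  \<open>c\<close>, where the function is a bump composed with a transition map, and the complement
  of the compact set \<open>Z\<close>, where it is zero. \<open>Z\<close> is closed because the
  space is Hausdorff.\<close>

lemma C1_chart_bump:
  assumes c: "c \<in> atlas S" and r: "0 < r" and sub: "cball a r \<subseteq> coords c ` cdom c"
  shows "C1_fun S (chart_bump c a r)"
  unfolding C1_fun_def
proof
  fix e assume e: "e \<in> atlas S"
  let ?b = "chart_bump c a r \<circ> chart_inv e"
  define Z where "Z = chart_inv c ` cball a r"
  have "continuous_on (cball a r) (chart_inv c)"
    using chart[OF c] continuous_on_subset[OF _ sub] by (auto simp: is_chart_def homeomorphism_def)
  then have "compact Z" unfolding Z_def by (intro compact_continuous_image compact_cball)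
  then have Z: "open (- Z)" by (simp add: compact_imp_closed open_Compl)
  define W1 where "W1 = transition_domain e c"
  define W2 where "W2 = coords e ` (cdom e \<inter> - Z)"
  have W: "open W1" "open W2"
    unfolding W1_def W2_def by (rule transition_domain_open[OF chart[OF e] chart[OF c]], rule open_coords_image[OF chart[OF e] Z])
  have zero: "chart_bump c a r q = 0" if "q \<notin> Z" for q
  proof (cases "q \<in> cdom c")
    case True
    then have "coords c q \<notin> cball a r"
      using that chart_inv_coords[OF chart[OF c] True] unfolding Z_def by (metis imageI)
    from bump_zero[OF r this] show ?thesis by (simp add: chart_bump_def)
  qed (simp add: chart_bump_def)
  have 1: "Ck_on 1 ?b W1"
  proof -
    have "Ck_on 1 (\<lambda>x. bump a r ((coords c \<circ> chart_inv e) x)) W1"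
      unfolding W1_def
      by (rule Ck_on_compose[OF transition_domain_open[OF chart[OF e] chart[OF c]] open_UNIV subset_UNIV
            smooth_atlasD(2)[OF atlas e c] Ck_on_bump])
    moreover have "?b x = bump a r ((coords c \<circ> chart_inv e) x)" if "x \<in> W1" for x
      using that chart_inv_coords[OF chart[OF e]] by (auto simp: W1_def transition_domain_def chart_bump_def)
    ultimately show ?thesis by (subst Ck_on_cong[OF W(1)])
  qed
  have 2: "Ck_on 1 ?b W2"
  proof -
    have "?b x = 0" if "x \<in> W2" for x
      using that chart_inv_coords[OF chart[OF e]] zero by (auto simp: W2_def)
    then have "Ck_on 1 ?b W2 \<longleftrightarrow> Ck_on 1 (\<lambda>_. 0 :: real) W2" by (rule Ck_on_cong[OF W(2)])
    then show ?thesis by (simp only: Ck_on_const)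
  qed
  have "Z \<subseteq> cdom c"
  proof
    fix q assume "q \<in> Z"
    then obtain x where "x \<in> cball a r" "q = chart_inv c x" by (auto simp: Z_def)
    then obtain q' where "q' \<in> cdom c" "x = coords c q'" using sub by blast
    then show "q \<in> cdom c" using chart_inv_coords[OF chart[OF c]] \<open>q = chart_inv c x\<close> by simp
  qed
  then have "coords e ` cdom e = W1 \<union> W2" by (auto simp: W1_def W2_def transition_domain_def)
  then show "Ck_on 1 ?b (coords e ` cdom e)"
    using Ck_on_Un[OF W 1 2] by simp
qed

end

section \<open>The scalars of the statement in arbitrary charts\<close>

context immersed_hypersurface
begin

lemma C1_funD:
  assumes "C1_fun S f" "c \<in> atlas S" "p \<in> cdom c"
  shows "((f \<circ> chart_inv c) has_derivative dd (f \<circ> chart_inv c) (coords c p)) (at (coords c p))"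
proof (rule Ck_on_has_derivative)
  show "Ck_on (Suc 0) (f \<circ> chart_inv c) (coords c ` cdom c)"
    using assms(1,2) by (simp add: C1_fun_def)
qed (use is_chart_open(2)[OF chart_S[OF assms(2)]] assms(3) in auto)

lemma chart_at_in: "chart_at S p \<in> charts_at (atlas S) p" "chart_at M q \<in> charts_at (atlas M) q"
proof -
  have "\<exists>c. c \<in> charts_at (atlas S) p" "\<exists>c. c \<in> charts_at (atlas M) q"
    using smooth_atlasD(3)[OF atlas_S, of p] smooth_atlasD(3)[OF atlas_M, of q] unfolding charts_at_def by blast+
  then show "chart_at S p \<in> charts_at (atlas S) p" "chart_at M q \<in> charts_at (atlas M) q"
    unfolding chart_at_def by (auto intro: someI_ex)
qed

lemma chart_at_facts:
  "chart_at S p \<in> atlas S" "chart_at M (\<phi> p) \<in> atlas M" "p \<in> dom (chart_at S p) (chart_at M (\<phi> p))" 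
  using chart_at_in(1)[of p] chart_at_in(2)[of "\<phi> p"] by (auto simp: charts_at_def dom_def)

lemma mean_curv_chart:
  assumes "c \<in> atlas S" "d \<in> atlas M" "p \<in> dom c d"
  shows "mean_curv S M \<phi> \<nu> k p = elem_sym k (shape_matrix S M \<phi> \<nu> c d p)"
  unfolding mean_curv_def
  by (rule chart_independence(3)[OF chart_at_facts(1) assms(1) chart_at_facts(2) assms(2) chart_at_facts(3) assms(3)])

lemma section_transform:
  assumes "section_along S M \<phi> X" "d \<in> charts_at (atlas M) (\<phi> p)" "e \<in> charts_at (atlas M) (\<phi> p)"
  shows "X e p = jacobian d e (\<phi> p) *v X d p"
  using assms unfolding section_along_def by blast

lemma along_inner_chart:
  assumes X: "section_along S M \<phi> X" and d: "d \<in> charts_at (atlas M) (\<phi> p)"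
  shows "along_inner M \<phi> \<nu> X p = ip (metric M d (\<phi> p)) (\<nu> d p) (X d p)"
proof -
  have \<nu>: "section_along S M \<phi> \<nu>" using normal by (simp add: unit_normal_def)
  let ?e = "chart_at M (\<phi> p)"
  have e: "?e \<in> charts_at (atlas M) (\<phi> p)" by (rule chart_at_in)
  show ?thesis
    unfolding along_inner_def Let_def section_transform[OF X d e] section_transform[OF \<nu> d e]
    by (rule metric_transform[OF M d e, symmetric])
qed

text \<open>Self-adjointness moves \<open>newton k\<close> from the gradient to the tangential part.
  The gradient then acts as the differential of \<open>f\<close>, and only the vector T_k X^T has to
  be compared between charts.\<close>

lemma newton_grad_inner_chart:
  assumes X: "section_along S M \<phi> X" and f: "C1_fun S f"
    and c: "c \<in> atlas S" and d: "d \<in> atlas M" and p: "p \<in> dom c d"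
  shows "newton_grad_inner S M \<phi> \<nu> k f X p = dd (f \<circ> chart_inv c) (coords c p)
     (newton k (shape_matrix S M \<phi> \<nu> c d p) *v tangential_part M \<phi> c d p (X d p))"
proof -
  let ?c = "chart_at S p" and ?d = "chart_at M (\<phi> p)"
  note ca = chart_at_facts[of p]
  interpret A: hypersurface_charts M S \<phi> \<nu> ?c ?d by (rule charts[OF ca(1,2)])
  let ?T = "newton k (shape_matrix S M \<phi> \<nu> ?c ?d p)" and ?Y = "tangential_part M \<phi> ?c ?d p (X ?d p)"
  have pc: "p \<in> cdom c" "p \<in> cdom ?c" using p ca(3) by (auto simp: dom_def)
  have dd: "d \<in> charts_at (atlas M) (\<phi> p)" using p d by (auto simp: dom_def charts_at_def)
  have sa: "transpose ?T ** metric S ?c p = metric S ?c p ** ?T"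
    unfolding A.shape_matrix_point[OF ca(3)] A.g_point[OF ca(3), symmetric]
    by (rule A.H.newton_Sh_self_adjoint[OF A.point_in[OF ca(3)]])
  have "newton_grad_inner S M \<phi> \<nu> k f X p = ip (metric S ?c p) (?T *v gradient S ?c p f) ?Y"
    by (simp add: newton_grad_inner_def Let_def)
  also have "\<dots> = ip (metric S ?c p) (gradient S ?c p f) (?T *v ?Y)"
    unfolding ip_matrix_left[symmetric] sa unfolding ip_matrix_right ..
  also have "\<dots> = dd (f \<circ> chart_inv ?c) (coords ?c p) (?T *v ?Y)"
    by (rule gradient_eq_raise(2)[OF S chart_at_in(1) C1_funD[OF f ca(1) pc(2)]])
  also have "?T *v ?Y = jacobian c ?c p *v (newton k (shape_matrix S M \<phi> \<nu> c d p) *v tangential_part M \<phi> c d p (X d p))"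
  proof -
    note ci = chart_independence[OF c ca(1) d ca(2) p ca(3)]
    have inv: "invertible (jacobian c ?c p)" by (rule jacobian_invertible[OF atlas_S c ca(1) pc])
    have "?Y = jacobian c ?c p *v tangential_part M \<phi> c d p (X d p)"
      unfolding ci(2) section_transform[OF X dd chart_at_in(2)] ..
    then show ?thesis
      using newton_conjugate[OF inv ci(1), of k] by (simp add: matrix_vector_mul_assoc)
  qed
  also have "dd (f \<circ> chart_inv ?c) (coords ?c p) (jacobian c ?c p *v (newton k (shape_matrix S M \<phi> \<nu> c d p) *v tangential_part M \<phi> c d p (X d p)))
     = dd (f \<circ> chart_inv c) (coords c p) (newton k (shape_matrix S M \<phi> \<nu> c d p) *v tangential_part M \<phi> c d p (X d p))"
    by (rule dd_change_chart[OF atlas_S c ca(1) pc C1_funD[OF f ca(1) pc(2)], symmetric])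
  finally show ?thesis .
qed

text \<open>The interface between the measure and the coordinates: continuity on
  \<open>Udom c d\<close> and compact support settle measurability and integrability for the three
  integrands of the formula.\<close>

lemma patch_volume_integral:
  assumes compact: "compact (UNIV :: 'q set)" and c: "c \<in> atlas S" and d: "d \<in> atlas M"
    and K: "compact K" "K \<subseteq> Udom c d" and hc: "continuous_on (Udom c d) hc"
    and h0: "\<forall>x\<in>Udom c d - K. hc x = 0"
    and h: "\<And>q. h q = (if q \<in> dom c d then hc (coords c q) else 0)"
  shows "integrable (volume_measure S) h"
    and "integrable lborel (\<lambda>x. if x \<in> Udom c d then volume_density S c x * hc x else 0)"
    and "(\<integral>p. h p \<partial>volume_measure S) = (\<integral>x. (if x \<in> Udom c d then volume_density S c x * hc x else 0) \<partial>lborel)"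
proof -
  interpret R: riemannian_atlas S by unfold_locales (rule S)
  let ?k = "\<lambda>x. if x \<in> Udom c d then volume_density S c x * hc x else 0"
  have sub: "Udom c d \<subseteq> coords c ` cdom c" by (auto simp: Udom_def dom_def)
  have "integrable lborel (\<lambda>x. indicator K x *\<^sub>R (volume_density S c x * hc x))"
    by (intro borel_integrable_compact K(1) continuous_on_mult
        continuous_on_subset[OF R.continuous_volume_density[OF c] order_trans[OF K(2) sub]] continuous_on_subset[OF hc K(2)])
  also have "(\<lambda>x. indicator K x *\<^sub>R (volume_density S c x * hc x)) = ?k"
    using h0 K(2) by (auto simp: fun_eq_iff indicator_def)
  finally show int: "integrable lborel ?k" .
  have dom: "open (dom c d)" by (rule open_dom[OF c d])
  have "continuous_on (dom c d) (coords c)"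
    using chart_S[OF c] by (auto simp: is_chart_def homeomorphism_def dom_def intro: continuous_on_subset)
  then have "continuous_on (dom c d) (\<lambda>q. hc (coords c q))"
    by (rule continuous_on_compose2[OF hc]) (simp add: Udom_def)
  then have "(\<lambda>q. if q \<in> dom c d then hc (coords c q) else 0) \<in> borel_measurable borel"
    using dom by (intro borel_measurable_continuous_on_if) auto
  then have hm: "h \<in> borel_measurable borel" by (simp only: h[abs_def])
  have hz: "h q = 0" if "q \<notin> cdom c" for q using that by (simp add: h dom_def)
  have keq: "?k x = (if x \<in> coords c ` cdom c then volume_density S c x * h (chart_inv c x) else 0)" for x
  proof (cases "x \<in> coords c ` cdom c")
    case True
    then obtain q where q: "q \<in> cdom c" "x = coords c q" by auto
    have ci: "chart_inv c x = q" using q chart_inv_coords[OF chart_S[OF c]] by simp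
    have "x \<in> Udom c d \<longleftrightarrow> q \<in> dom c d"
    proof
      assume "x \<in> Udom c d"
      then obtain q' where "q' \<in> dom c d" "chart_inv c x = q'" by (rule UdomE[OF _ c]) 
      then show "q \<in> dom c d" using ci by simp
    qed (use q in \<open>auto simp: Udom_def\<close>)
    then show ?thesis using True by (simp add: ci h) (simp add: q(2))
  qed (use sub in auto)
  note vic = R.volume_integral_chart[OF compact c hm hz keq int]
  show "integrable (volume_measure S) h" by (rule vic(1))
  show "(\<integral>p. h p \<partial>volume_measure S) = (\<integral>x. ?k x \<partial>lborel)" by (rule vic(2))
qed

end

text \<open>Matches the normalizations: (n-1-k) H_k and (k+1) H_{k+1} are the same multiple of
  \<sigma>_k and \<sigma>_{k+1}.\<close>

lemma binomial_descent: "k \<le> m \<Longrightarrow> real (Suc k) * real (m choose Suc k) = (real m - real k) * real (m choose k)"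
proof -
  assume k: "k \<le> m"
  have "Suc k * (m choose Suc k) = (m - k) * (m choose k)"
    by (simp only: binomial_absorption binomial_absorb_comp)
  then have "real (Suc k * (m choose Suc k)) = real ((m - k) * (m choose k))" by (simp only:)
  then show ?thesis using k by (simp only: of_nat_mult of_nat_diff)
qed

section \<open>The local formula and the partition of unity\<close>

context immersed_hypersurface
begin

lemma supported_integral_formula:
  assumes compact: "compact (UNIV :: 'q set)" and X: "section_along S M \<phi> X"
    and conf: "conformal_along S M \<phi> X \<alpha>" and kn: "k < CARD('m)" and f: "C1_fun S f"
    and c: "c \<in> atlas S" and d: "d \<in> atlas M" and K: "compact K" "K \<subseteq> Udom c d"
    and supp: "\<And>q. f q \<noteq> 0 \<Longrightarrow> q \<in> dom c d \<and> coords c q \<in> K"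
  shows "integrable (volume_measure S) (\<lambda>p. \<alpha> p * f p * norm_mean_curv S M \<phi> \<nu> k p)"
    and "integrable (volume_measure S) (\<lambda>p. f p * norm_mean_curv S M \<phi> \<nu> (k + 1) p * along_inner M \<phi> \<nu> X p)"
    and "integrable (volume_measure S) (newton_grad_inner S M \<phi> \<nu> k f X)"
    and "(\<integral>p. \<alpha> p * f p * norm_mean_curv S M \<phi> \<nu> k p \<partial>volume_measure S)
       = (\<integral>p. f p * norm_mean_curv S M \<phi> \<nu> (k + 1) p * along_inner M \<phi> \<nu> X p \<partial>volume_measure S)
         - 1 / ((real CARD('m) - real k) * real (CARD('m) choose k))
           * (\<integral>p. newton_grad_inner S M \<phi> \<nu> k f X p \<partial>volume_measure S)"
proof -
  interpret A: hypersurface_charts M S \<phi> \<nu> c d by (rule charts[OF c d])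
  let ?U = "Udom c d" and ?m = "CARD('m)"
  have oU: "open ?U" by (rule open_Udom[OF c d])
  define X' where "X' = X d \<circ> chart_inv c"
  define f' where "f' x = (if x \<in> ?U then f (chart_inv c x) else 0)" for x
  \<comment> \<open>\<alpha> is given without regularity. The trace of the conformality condition
    expresses it through derivatives of \<open>X\<close>, which gives the continuity needed for
    integrability.\<close>
  define \<alpha>' where "\<alpha>' x = (\<Sum>i\<in>UNIV. A.H.tang x (A.H.P X' x (axis i 1)) $ i) / real ?m" for x
  have X's: "Ck_on j X' ?U" for j
  proof (rule smooth_onD)
    show "smooth_on ?U X'"
      using X c d unfolding section_along_def Udom_def dom_def X'_def by blast
  qed
  have f'C: "Ck_on 1 f' ?U"
  proof -
    have "Ck_on 1 (f \<circ> chart_inv c) (coords c ` cdom c)"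
      using f c unfolding C1_fun_def by blast
    then have "Ck_on 1 (f \<circ> chart_inv c) ?U"
      by (rule Ck_on_subset) (auto simp: Udom_def dom_def)
    moreover have "Ck_on 1 f' ?U \<longleftrightarrow> Ck_on 1 (f \<circ> chart_inv c) ?U"
      by (rule Ck_on_cong[OF oU]) (simp add: f'_def)
    ultimately show ?thesis by blast
  qed
  have f'0: "f' x = 0" if xK: "x \<notin> K" for x
  proof (cases "x \<in> ?U")
    case True
    then obtain q where "q \<in> dom c d" "x = coords c q" "chart_inv c x = q" by (rule UdomE[OF _ c])
    then show ?thesis using supp[of q] xK by (auto simp: f'_def)
  qed (simp add: f'_def)
  have f'pt: "f' (coords c p) = f p" if "p \<in> dom c d" for p
    using A.point_in[OF that] A.inv_point[OF that] by (simp add: f'_def)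
  have X'pt: "X' (coords c p) = X d p" if "p \<in> dom c d" for p
    using A.inv_point[OF that] by (simp add: X'_def)
  have confH: "A.H.GF (coords c p) (A.H.P X' (coords c p) y) (dd (Fmap c d) (coords c p) z)
      + A.H.GF (coords c p) (A.H.P X' (coords c p) z) (dd (Fmap c d) (coords c p) y)
      = 2 * \<alpha> p * ip (local_metric S c (coords c p)) y z" if p: "p \<in> dom c d" for p y z
  proof -
    have "c \<in> charts_at (atlas S) p" "d \<in> charts_at (atlas M) (\<phi> p)" using dom_charts[OF c d p] by auto
    then have "ip (metric M d (\<phi> p)) (pullback_deriv M \<phi> c d p y X) (differential \<phi> c d p z)
        + ip (metric M d (\<phi> p)) (pullback_deriv M \<phi> c d p z X) (differential \<phi> c d p y)
        = 2 * \<alpha> p * ip (metric S c p) y z"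
      using conf unfolding conformal_along_def by blast
    then show ?thesis
      unfolding A.pullback_point[OF p] A.differential_point[OF p] A.g_point[OF p, symmetric] A.G_point[OF p, symmetric] X'_def .
  qed
  have \<alpha>: "\<alpha> p = \<alpha>' (coords c p)" if p: "p \<in> dom c d" for p
  proof -
    let ?x = "coords c p"
    note x = A.point_in[OF p]
    let ?\<beta> = "\<lambda>y. A.H.tang ?x (A.H.P X' ?x y)"
    have lin: "linear ?\<beta>"
    proof (rule linearI; rule A.H.tang_eqI[OF x])
      note pl = A.H.P_linear[OF x Ck_on_has_derivative[OF X's oU x]]
      show "ip (local_metric S c ?x) (?\<beta> a + ?\<beta> b) z = A.H.GF ?x (A.H.P X' ?x (a + b)) (dd (Fmap c d) ?x z)" for a b z
        by (simp only: linear_add[OF pl] ip_linear_simps A.H.ip_tang[OF x])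
      show "ip (local_metric S c ?x) (r *\<^sub>R ?\<beta> b) z = A.H.GF ?x (A.H.P X' ?x (r *\<^sub>R b)) (dd (Fmap c d) ?x z)" for r b z
        by (simp only: linear_scale[OF pl] ip_linear_simps A.H.ip_tang[OF x])
    qed
    \<comment> \<open>The skew-adjointness argument again, with the identity in the role of T_k, so
      that \<open>B\<close> has trace zero.\<close>
    define B where "B = matrix ?\<beta> - \<alpha> p *\<^sub>R mat 1"
    let ?g = "local_metric S c ?x"
    have "ip (transpose B ** ?g + ?g ** B) y z = 0" for y z
    proof -
      have "ip ?g (?\<beta> y) z + ip ?g (?\<beta> z) y = 2 * \<alpha> p * ip ?g y z"
        unfolding A.H.ip_tang[OF x] by (rule confH[OF p])
      then show ?thesis
        unfolding ip_add_form ip_matrix_left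
        unfolding ip_matrix_right B_def
        by (simp add: matrix_vector_mult_diff_rdistrib scaleR_matrix_vector_assoc[symmetric] matrix_linear_works[OF lin]
            ip_linear_simps ip_commute[OF A.H.sym_g[OF x], of y])
    qed
    then have "transpose B ** ?g + ?g ** B = 0"
      by (intro matrix_eq_ipI) (simp add: ip_def)
    then have skew: "transpose B ** ?g = - (?g ** B)" by (simp add: eq_neg_iff_add_eq_0)
    have "trace (mat 1 ** B) = 0"
      by (rule trace_self_adjoint_skew[OF A.H.inv_g[OF x] _ skew]) (simp add: transpose_mat)
    then have "trace (matrix ?\<beta>) = \<alpha> p * real ?m"
      by (simp add: B_def trace_sub trace_scaleR) (simp add: trace_def mat_def)
    moreover have "trace (matrix ?\<beta>) = (\<Sum>i\<in>UNIV. ?\<beta> (axis i 1) $ i)"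
      unfolding trace_column_sum matrix_linear_works[OF lin] ..
    ultimately show ?thesis by (simp add: \<alpha>'_def)
  qed
  define h1 where "h1 x = \<alpha>' x * f' x * (elem_sym k (A.H.Sh x) / real (?m choose k))" for x
  define h2 where "h2 x = f' x * (elem_sym (k + 1) (A.H.Sh x) / real (?m choose (k + 1)))
      * A.H.GF x ((\<nu> d \<circ> chart_inv c) x) (X' x)" for x
  define h3 where "h3 x = dd f' x (newton k (A.H.Sh x) *v A.H.tang x (X' x))" for x
  have f'C0: "Ck_on 0 f' ?U" by (rule Ck_on_le[OF f'C]) simp
  have cont1: "continuous_on ?U h1"
    unfolding h1_def[abs_def] \<alpha>'_def
    by (rule Ck_on_continuous[of 0]) (intro Ck_on_mult Ck_on_divide Ck_on_sum Ck_on_nth Ck_on_const Ck_on_elem_sym oU f'C0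
        A.H.Ck_on_Sh A.H.Ck_on_tang A.H.Ck_on_P X's; use kn in simp)
  have cont2: "continuous_on ?U h2"
    unfolding h2_def[abs_def]
    by (rule Ck_on_continuous[of 0]) (intro Ck_on_mult Ck_on_divide Ck_on_const Ck_on_elem_sym Ck_on_ip oU f'C0
        A.H.Ck_on_Sh A.H.smooth_GF A.H.smooth_N X's; use kn in simp)
  have cont3: "continuous_on ?U h3"
    unfolding h3_def[abs_def]
    by (rule Ck_on_continuous[of 0], rule Ck_on_dd[OF oU f'C[unfolded One_nat_def]])
      (intro Ck_on_matrix_vector oU A.H.Ck_on_newton A.H.Ck_on_tang X's)
  have oK: "open (- K)" using K(1) by (simp add: compact_imp_closed open_Compl)
  have z1: "\<forall>x\<in>?U - K. h1 x = 0" and z2: "\<forall>x\<in>?U - K. h2 x = 0"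
    using f'0 by (simp_all add: h1_def h2_def)
  have z3: "\<forall>x\<in>?U - K. h3 x = 0"
  proof
    fix x assume "x \<in> ?U - K"
    then have "x \<in> - K" by simp
    have "dd f' x = dd (\<lambda>_. 0) x" by (rule dd_cong[OF oK \<open>x \<in> - K\<close>]) (simp add: f'0)
    then show "h3 x = 0" by (simp add: h3_def)
  qed
  have fz: "f q = 0" if "q \<notin> dom c d" for q using supp[of q] that by auto
  have nm: "norm_mean_curv S M \<phi> \<nu> j q = elem_sym j (A.H.Sh (coords c q)) / real (?m choose j)" if "q \<in> dom c d" for j q
    unfolding norm_mean_curv_def mean_curv_chart[OF c d that] A.shape_matrix_point[OF that] ..
  have I1: "\<alpha> q * f q * norm_mean_curv S M \<phi> \<nu> k q = (if q \<in> dom c d then h1 (coords c q) else 0)" for q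
    using fz[of q] by (simp add: h1_def nm \<alpha> f'pt)
  have I2: "f q * norm_mean_curv S M \<phi> \<nu> (k + 1) q * along_inner M \<phi> \<nu> X q = (if q \<in> dom c d then h2 (coords c q) else 0)" for q
  proof (cases "q \<in> dom c d")
    case True
    have "along_inner M \<phi> \<nu> X q = A.H.GF (coords c q) ((\<nu> d \<circ> chart_inv c) (coords c q)) (X' (coords c q))"
      using along_inner_chart[OF X, of d q] dom_charts[OF c d True]
      unfolding A.G_point[OF True] X'pt[OF True] by (simp add: A.inv_point[OF True])
    then show ?thesis using True by (simp add: h2_def nm[OF True] f'pt[OF True] del: comp_apply)
  qed (simp add: fz)
  have I3: "newton_grad_inner S M \<phi> \<nu> k f X q = (if q \<in> dom c d then h3 (coords c q) else 0)" for q
  proof (cases "q \<in> dom c d")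
    case True
    have "dd (f \<circ> chart_inv c) (coords c q) = dd f' (coords c q)"
      by (rule dd_cong[OF oU A.point_in[OF True]]) (simp add: f'_def)
    then show ?thesis
      using True newton_grad_inner_chart[OF X f c d True, of k]
      by (simp add: h3_def A.shape_matrix_point[OF True] A.tangential_part_point[OF True] X'pt[OF True])
  next
    case False
    let ?c = "chart_at S q" and ?d = "chart_at M (\<phi> q)"
    note ca = chart_at_facts[of q]
    \<comment> \<open>Vanishing of \<open>f\<close> at \<open>q\<close> alone does not annihilate
      its gradient. The support lies in the compact, hence closed, set \<open>Z\<close>, so
      \<open>f\<close> vanishes near \<open>q\<close>.\<close>
    define Z where "Z = chart_inv c ` K"
    have Zdom: "Z \<subseteq> dom c d"
    proof
      fix p assume "p \<in> Z"
      then obtain x where x: "x \<in> K" "p = chart_inv c x" by (auto simp: Z_def)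
      then have "x \<in> ?U" using K(2) by auto
      then show "p \<in> dom c d" using x by (elim UdomE[OF _ c]) simp
    qed
    have "continuous_on K (chart_inv c)"
      by (rule continuous_on_subset[of "coords c ` cdom c"])
        (use chart_S[OF c] K(2) in \<open>auto simp: is_chart_def homeomorphism_def Udom_def dom_def\<close>)
    then have "compact Z" unfolding Z_def by (intro compact_continuous_image K(1))
    then have Z: "open (- Z)" by (simp add: compact_imp_closed open_Compl)
    have f0: "f p = 0" if "p \<notin> Z" for p
    proof (rule ccontr)
      assume "f p \<noteq> 0"
      then have "p \<in> dom c d" "coords c p \<in> K" using supp by auto
      then have "p = chart_inv c (coords c p)" "coords c p \<in> K" using A.inv_point by simp_all
      then have "p \<in> Z" unfolding Z_def by (rule image_eqI)
      then show False using that by simp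
    qed
    let ?W = "coords ?c ` (cdom ?c \<inter> - Z)"
    have W: "open ?W" by (rule open_coords_image[OF chart_S[OF ca(1)] Z])
    have "q \<in> cdom ?c" "q \<notin> Z" using ca(3) False Zdom unfolding dom_def by blast+
    then have qW: "coords ?c q \<in> ?W" by blast
    have "dd (f \<circ> chart_inv ?c) (coords ?c q) = dd (\<lambda>_. 0) (coords ?c q)"
    proof (rule dd_cong[OF W qW])
      fix y assume "y \<in> ?W"
      then obtain p where p: "p \<in> cdom ?c" "p \<notin> Z" "y = coords ?c p" by blast
      show "(f \<circ> chart_inv ?c) y = 0"
        unfolding p(3) comp_apply chart_inv_coords[OF chart_S[OF ca(1)] p(1)] by (rule f0[OF p(2)])
    qed
    then have dz: "dd (f \<circ> chart_inv ?c) (coords ?c q) v = 0" for v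
      by (simp only: frechet_derivative_const)
    show ?thesis
      unfolding newton_grad_inner_chart[OF X f ca] dz using False by simp
  qed
  note P1 = patch_volume_integral[where h = "\<lambda>p. \<alpha> p * f p * norm_mean_curv S M \<phi> \<nu> k p" and hc = h1, OF compact c d K cont1 z1 I1]
  note P2 = patch_volume_integral[where h = "\<lambda>p. f p * norm_mean_curv S M \<phi> \<nu> (k + 1) p * along_inner M \<phi> \<nu> X p" and hc = h2, OF compact c d K cont2 z2 I2]
  note P3 = patch_volume_integral[where h = "newton_grad_inner S M \<phi> \<nu> k f X" and hc = h3, OF compact c d K cont3 z3 I3]
  show "integrable (volume_measure S) (\<lambda>p. \<alpha> p * f p * norm_mean_curv S M \<phi> \<nu> k p)"
    by (rule P1(1))
  show "integrable (volume_measure S) (\<lambda>p. f p * norm_mean_curv S M \<phi> \<nu> (k + 1) p * along_inner M \<phi> \<nu> X p)"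
    by (rule P2(1))
  show "integrable (volume_measure S) (newton_grad_inner S M \<phi> \<nu> k f X)"
    by (rule P3(1))
  let ?k = "\<lambda>h x. if x \<in> ?U then volume_density S c x * h x else 0"
  \<comment> \<open>Clears both binomials at once: by \<open>binomial_descent\<close> it is also
    \<open>Suc k\<close> times the binomial of index \<open>k + 1\<close>.\<close>
  define C where "C = (real ?m - real k) * real (?m choose k)"
  have Cpos: "C \<noteq> 0" using kn by (simp add: C_def)
  have b1: "real (?m choose k) \<noteq> 0" "real (?m choose (k + 1)) \<noteq> 0" using kn by simp_all
  have b2: "real (Suc k) = C / real (?m choose (k + 1))"
    using binomial_descent[of k ?m] kn b1 unfolding C_def by (simp add: field_simps)
  have rho: "A.H.\<rho> x = volume_density S c x" for x by (simp add: A.H.\<rho>_def volume_density_def)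
  define D where "D x = (if x \<in> ?U then A.H.\<rho> x * (dd f' x (newton k (A.H.Sh x) *v A.H.tang x (X' x))
      + f' x * (\<alpha>' x * (real CARD('m) - real k) * elem_sym k (A.H.Sh x)
        - A.H.GF x ((\<nu> d \<circ> chart_inv c) x) (X' x) * (real (Suc k) * elem_sym (Suc k) (A.H.Sh x)))) else 0)" for x
  have confU: "A.H.GF x (A.H.P X' x y) (dd (Fmap c d) x z) + A.H.GF x (A.H.P X' x z) (dd (Fmap c d) x y)
      = 2 * \<alpha>' x * ip (local_metric S c x) y z" if xU: "x \<in> ?U" for x y z
  proof -
    obtain p where p: "p \<in> dom c d" "x = coords c p" by (rule UdomE[OF xU c])
    show ?thesis unfolding p(2) \<alpha>[OF p(1), symmetric] by (rule confH[OF p(1)])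
  qed
  have D0: "(\<integral>x. D x \<partial>lborel) = 0"
    unfolding D_def by (rule A.H.patch_integral(2)[OF X's confU f'C K f'0])
  \<comment> \<open>With this decomposition the vanishing of the integral of \<open>D\<close> is the
    claim multiplied by \<open>C\<close>.\<close>
  have "D x = ?k h3 x + (C * ?k h1 x - C * ?k h2 x)" for x
  proof (cases "x \<in> ?U")
    case True
    have "C * h1 x = \<alpha>' x * f' x * ((real ?m - real k) * elem_sym k (A.H.Sh x))"
      using b1 by (simp add: C_def h1_def)
    moreover have "C * h2 x = f' x * (real (Suc k) * elem_sym (Suc k) (A.H.Sh x)) * A.H.GF x ((\<nu> d \<circ> chart_inv c) x) (X' x)"
      unfolding b2 h2_def by simp
    moreover have "D x = volume_density S c x * (h3 x + (\<alpha>' x * f' x * ((real ?m - real k) * elem_sym k (A.H.Sh x))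
       - f' x * (real (Suc k) * elem_sym (Suc k) (A.H.Sh x)) * A.H.GF x ((\<nu> d \<circ> chart_inv c) x) (X' x)))"
      unfolding D_def rho h3_def using True by (simp add: algebra_simps del: comp_apply of_nat_Suc)
    ultimately have "D x = volume_density S c x * (h3 x + (C * h1 x - C * h2 x))" by (simp only:)
    then show ?thesis using True by (simp add: algebra_simps)
  qed (simp add: D_def)
  then have "(\<integral>x. D x \<partial>lborel) = (\<integral>x. ?k h3 x + (C * ?k h1 x - C * ?k h2 x) \<partial>lborel)" by (simp only:)
  also have "\<dots> = (\<integral>x. ?k h3 x \<partial>lborel) + (C * (\<integral>x. ?k h1 x \<partial>lborel) - C * (\<integral>x. ?k h2 x \<partial>lborel))"
    using P1(2) P2(2) P3(2)
    by (subst Bochner_Integration.integral_add, simp, simp, subst Bochner_Integration.integral_diff, simp, simp)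
      (simp only: integral_mult_right_zero)
  finally have E: "(\<integral>x. ?k h3 x \<partial>lborel) + (C * (\<integral>x. ?k h1 x \<partial>lborel) - C * (\<integral>x. ?k h2 x \<partial>lborel)) = 0"
    unfolding D0 by simp
  then have "(\<integral>x. ?k h1 x \<partial>lborel) = (\<integral>x. ?k h2 x \<partial>lborel) - 1 / C * (\<integral>x. ?k h3 x \<partial>lborel)"
    using Cpos by (simp add: field_simps)
  then have fin: "(\<integral>x. ?k h1 x \<partial>lborel) = (\<integral>x. ?k h2 x \<partial>lborel) - 1 / ((real CARD('m) - real k) * real (CARD('m) choose k)) * (\<integral>x. ?k h3 x \<partial>lborel)"
    by (simp only: C_def)
  show "(\<integral>p. \<alpha> p * f p * norm_mean_curv S M \<phi> \<nu> k p \<partial>volume_measure S)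
       = (\<integral>p. f p * norm_mean_curv S M \<phi> \<nu> (k + 1) p * along_inner M \<phi> \<nu> X p \<partial>volume_measure S)
         - 1 / ((real CARD('m) - real k) * real (CARD('m) choose k))
           * (\<integral>p. newton_grad_inner S M \<phi> \<nu> k f X p \<partial>volume_measure S)"
    by (rule trans[OF P1(3) trans[OF fin]])
      (rule arg_cong2[where f = "\<lambda>a b. a - _ * b", OF P2(3)[symmetric] P3(3)[symmetric]])
qed

lemma newton_grad_inner_sum:
  assumes X: "section_along S M \<phi> X" and T: "finite T" and f: "\<And>i. i \<in> T \<Longrightarrow> C1_fun S (F i)"
    and sum: "C1_fun S (\<lambda>q. \<Sum>i\<in>T. F i q)"
  shows "newton_grad_inner S M \<phi> \<nu> k (\<lambda>q. \<Sum>i\<in>T. F i q) X p = (\<Sum>i\<in>T. newton_grad_inner S M \<phi> \<nu> k (F i) X p)"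
proof -
  let ?c = "chart_at S p"
  note ca = chart_at_facts[of p]
  have pc: "p \<in> cdom ?c" using ca(3) by (simp add: dom_def)
  have "((\<lambda>x. \<Sum>i\<in>T. (F i \<circ> chart_inv ?c) x) has_derivative (\<lambda>h. \<Sum>i\<in>T. dd (F i \<circ> chart_inv ?c) (coords ?c p) h)) (at (coords ?c p))"
    by (rule has_derivative_sum) (rule C1_funD[OF f ca(1) pc])
  then have "dd ((\<lambda>q. \<Sum>i\<in>T. F i q) \<circ> chart_inv ?c) (coords ?c p) h = (\<Sum>i\<in>T. dd (F i \<circ> chart_inv ?c) (coords ?c p) h)" for h
    by (simp add: comp_def dd_eqI)
  then show ?thesis
    unfolding newton_grad_inner_chart[OF X sum ca] by (simp add: newton_grad_inner_chart[OF X f ca])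
qed

lemma integral_formula:
  assumes compact: "compact (UNIV :: 'q set)" and X: "section_along S M \<phi> X"
    and conf: "conformal_along S M \<phi> X \<alpha>" and kn: "k < CARD('m)" and f: "C1_fun S f"
  shows "(\<integral>p. \<alpha> p * f p * norm_mean_curv S M \<phi> \<nu> k p \<partial>volume_measure S)
       = (\<integral>p. f p * norm_mean_curv S M \<phi> \<nu> (k + 1) p * along_inner M \<phi> \<nu> X p \<partial>volume_measure S)
         - 1 / ((real CARD('m) - real k) * real (CARD('m) choose k))
           * (\<integral>p. newton_grad_inner S M \<phi> \<nu> k f X p \<partial>volume_measure S)"
proof -
  interpret R: riemannian_atlas S by unfold_locales (rule S)
  define c where "c p = chart_at S p" for p
  define d where "d p = chart_at M (\<phi> p)" for p
  have cd: "c p \<in> atlas S" "d p \<in> atlas M" "p \<in> dom (c p) (d p)" for p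
    using chart_at_facts[of p] by (simp_all add: c_def d_def)
  \<comment> \<open>The closed balls become the compact supports of the pieces; the open ones give
    the cover from which finitely many are chosen.\<close>
  have "\<exists>r>0. cball (coords (c p) p) r \<subseteq> Udom (c p) (d p)" for p
    using open_Udom[OF cd(1,2)] cd(3)[of p] unfolding open_contains_cball Udom_def by blast
  then obtain r where r: "\<And>p. 0 < r p" "\<And>p. cball (coords (c p) p) (r p) \<subseteq> Udom (c p) (d p)"
    by metis
  define b where "b p = R.chart_bump (c p) (coords (c p) p) (r p)" for p
  have Usub: "Udom (c p) (d p) \<subseteq> coords (c p) ` cdom (c p)" for p by (auto simp: Udom_def dom_def)
  have bC: "C1_fun S (b p)" for p
    unfolding b_def by (rule R.C1_chart_bump[OF cd(1) r(1) order_trans[OF r(2) Usub]])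
  define V where "V p = cdom (c p) \<inter> coords (c p) -` ball (coords (c p) p) (r p)" for p
  have oV: "open (V p)" for p
    unfolding V_def using chart_S[OF cd(1)[of p]]
    by (intro continuous_open_preimage) (auto simp: is_chart_def homeomorphism_def)
  have pV: "p \<in> V p" for p using cd(3)[of p] r(1)[of p] by (simp add: V_def dom_def)
  obtain T where T: "finite T" "UNIV \<subseteq> (\<Union>p\<in>T. V p)"
    by (rule compactE_image[OF compact, of UNIV V]) (use oV pV in auto)
  have bnn: "0 \<le> b p q" for p q by (simp add: b_def R.chart_bump_def bump_nonneg)
  have bpos: "0 < b p q" if "q \<in> V p" for p q
    using that bump_pos[of "coords (c p) q" "coords (c p) p" "r p"] by (simp add: V_def b_def R.chart_bump_def)
  define s where "s q = (\<Sum>p\<in>T. b p q)" for q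
  have spos: "0 < s q" for q
  proof -
    obtain p where "p \<in> T" "q \<in> V p" using T(2) by blast
    then show ?thesis unfolding s_def using bnn bpos by (intro sum_pos2[OF T(1)]) auto
  qed
  define F where "F p q = f q * b p q / s q" for p q
  have Fsum: "f q = (\<Sum>p\<in>T. F p q)" for q
  proof -
    have "(\<Sum>p\<in>T. F p q) = f q * s q / s q" by (simp add: F_def s_def sum_distrib_left sum_divide_distrib)
    then show ?thesis using spos[of q] by simp
  qed
  have FC: "C1_fun S (F p)" for p
    unfolding C1_fun_def
  proof
    fix e assume e: "e \<in> atlas S"
    let ?W = "coords e ` cdom e"
    have W: "open ?W" by (rule is_chart_open(2)[OF chart_S[OF e]])
    have fb: "Ck_on 1 (\<lambda>x. f (chart_inv e x)) ?W" "\<And>p. Ck_on 1 (\<lambda>x. b p (chart_inv e x)) ?W"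
      using f bC e by (simp_all add: C1_fun_def comp_def del: Ck_on.simps One_nat_def)
    have nz: "(\<Sum>p\<in>T. b p (chart_inv e x)) \<noteq> 0" for x using spos[of "chart_inv e x"] by (simp add: s_def)
    show "Ck_on 1 (F p \<circ> chart_inv e) ?W"
      unfolding F_def s_def comp_def
      by (rule Ck_on_divide[OF W Ck_on_mult[OF W fb] Ck_on_sum[OF W fb(2)] nz])
  qed
  have supp: "q \<in> dom (c p) (d p) \<and> coords (c p) q \<in> cball (coords (c p) p) (r p)" if "F p q \<noteq> 0" for p q
  proof -
    have "b p q \<noteq> 0" using that by (auto simp: F_def)
    then have q: "q \<in> cdom (c p)" "bump (coords (c p) p) (r p) (coords (c p) q) \<noteq> 0"
      by (auto simp: b_def R.chart_bump_def split: if_splits)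
    then have cb: "coords (c p) q \<in> cball (coords (c p) p) (r p)" using bump_zero[OF r(1)] by blast
    then have "coords (c p) q \<in> Udom (c p) (d p)" using r(2) by blast
    then obtain q' where "q' \<in> dom (c p) (d p)" "chart_inv (c p) (coords (c p) q) = q'" by (rule UdomE[OF _ cd(1)])
    then have "q \<in> dom (c p) (d p)" using chart_inv_coords[OF chart_S[OF cd(1)] q(1)] by simp
    with cb show ?thesis by blast
  qed
  note piece = supported_integral_formula[OF compact X conf kn FC cd(1,2) compact_cball r(2) supp]
  let ?vm = "volume_measure S"
  let ?I1 = "\<lambda>f p. \<alpha> p * f p * norm_mean_curv S M \<phi> \<nu> k p"
  let ?I2 = "\<lambda>f p. f p * norm_mean_curv S M \<phi> \<nu> (k + 1) p * along_inner M \<phi> \<nu> X p"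
  let ?C = "1 / ((real CARD('m) - real k) * real (CARD('m) choose k))"
  have s1: "(\<integral>p. ?I1 f p \<partial>?vm) = (\<Sum>i\<in>T. \<integral>p. ?I1 (F i) p \<partial>?vm)"
  proof -
    have e: "?I1 f p = (\<Sum>i\<in>T. ?I1 (F i) p)" for p
      unfolding Fsum[of p] by (simp only: sum_distrib_left sum_distrib_right)
    show ?thesis unfolding e by (rule Bochner_Integration.integral_sum) (rule piece(1))
  qed
  have s2: "(\<integral>p. ?I2 f p \<partial>?vm) = (\<Sum>i\<in>T. \<integral>p. ?I2 (F i) p \<partial>?vm)"
  proof -
    have e: "?I2 f p = (\<Sum>i\<in>T. ?I2 (F i) p)" for p
      unfolding Fsum[of p] by (simp only: sum_distrib_left sum_distrib_right)
    show ?thesis unfolding e by (rule Bochner_Integration.integral_sum) (rule piece(2))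
  qed
  have s3: "(\<integral>p. newton_grad_inner S M \<phi> \<nu> k f X p \<partial>?vm) = (\<Sum>i\<in>T. \<integral>p. newton_grad_inner S M \<phi> \<nu> k (F i) X p \<partial>?vm)"
  proof -
    have ff: "f = (\<lambda>q. \<Sum>i\<in>T. F i q)" using Fsum by blast
    have "C1_fun S (\<lambda>q. \<Sum>i\<in>T. F i q)" using f by (subst (asm) ff)
    from newton_grad_inner_sum[OF X T(1) FC this, of k]
    have e: "newton_grad_inner S M \<phi> \<nu> k f X p = (\<Sum>i\<in>T. newton_grad_inner S M \<phi> \<nu> k (F i) X p)" for p
      unfolding ff[symmetric] .
    show ?thesis unfolding e by (rule Bochner_Integration.integral_sum) (rule piece(3))
  qed
  have "(\<Sum>i\<in>T. \<integral>p. ?I1 (F i) p \<partial>?vm) = (\<Sum>i\<in>T. (\<integral>p. ?I2 (F i) p \<partial>?vm) - ?C * (\<integral>p. newton_grad_inner S M \<phi> \<nu> k (F i) X p \<partial>?vm))"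
    by (rule sum.cong[OF refl]) (rule piece(4))
  also have "\<dots> = (\<Sum>i\<in>T. \<integral>p. ?I2 (F i) p \<partial>?vm) - ?C * (\<Sum>i\<in>T. \<integral>p. newton_grad_inner S M \<phi> \<nu> k (F i) X p \<partial>?vm)"
    by (simp only: sum_subtractf sum_distrib_left)
  finally show ?thesis unfolding s1 s2 s3 .
qed

end

theorem theorem1p1:
  fixes M :: "('p::{t2_space, second_countable_topology}, 'n::finite) semi_riem"
    and S :: "('q::{t2_space, second_countable_topology}, 'm::finite) semi_riem"
    and \<phi> :: "'q \<Rightarrow> 'p"
    and \<nu> X :: "('q, 'p, 'n) vector_along"
    and \<alpha> f :: "'q \<Rightarrow> real"
    and k :: nat
  assumes "semi_riemannian_manifold M"
    and "constant_curvature M"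
    and "semi_riemannian_manifold S"
    and "oriented_atlas (atlas S)"
    and "compact (UNIV :: 'q set)"
    and "CARD('m) + 1 = CARD('n)"
    and "isometric_immersion S M \<phi>"
    and "unit_normal S M \<phi> \<nu>"
    and "section_along S M \<phi> X"
    and "conformal_along S M \<phi> X \<alpha>"
    and "smooth_fun (atlas S) f"
    and "k + 2 \<le> CARD('n)"
  shows "(\<integral>p. \<alpha> p * f p * norm_mean_curv S M \<phi> \<nu> k p \<partial>volume_measure S)
       = (\<integral>p. f p * norm_mean_curv S M \<phi> \<nu> (k + 1) p * along_inner M \<phi> \<nu> X p \<partial>volume_measure S)
         - 1 / (real (CARD('n) - 1 - k) * real ((CARD('n) - 1) choose k))
           * (\<integral>p. newton_grad_inner S M \<phi> \<nu> k f X p \<partial>volume_measure S)"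
proof -
  interpret immersed_hypersurface M S \<phi> \<nu>
    by unfold_locales (fact assms)+
  have f: "C1_fun S f"
    unfolding C1_fun_def using assms(11) smooth_onD unfolding smooth_fun_def by blast
  have n: "CARD('n) - 1 = CARD('m)" and k: "k < CARD('m)" using assms(6,12) by linarith+
  \<comment> \<open>The truncated subtraction of the statement is a genuine one, since
    \<open>k\<close> lies below the dimension of the hypersurface.\<close>
  have r: "real (CARD('m) - k) = real CARD('m) - real k" using k by (simp add: of_nat_diff)
  show ?thesis
    unfolding n r by (rule integral_formula[OF assms(5,9,10) k f])
qed

end
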